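(* Let $n\in\{2,3,4\}$, let $X$ be an $n$-dimensional random variable with probability density $p(x)$, and for $t>0$ let $X_t = X+Z_t$, where $Z_t\sim N_n(0,tI)$ is independent of $X$. Let $H(X_t)$ be the differential entropy of $X_t$. Then $$D(3,n):\qquad \frac{d^3}{dt^3}H(X_t)\ \ge\ 0 .$$
   Context: The density of $X_t$ is $$p_t(x_t)=\frac{1}{(2\pi t)^{n/2}}\int_{\mathbb{R}^n}p(x)\exp\left(-\frac{\|x_t-x\|^2}{2t}\right)dx ,$$ where $\|\cdot\|$ is the Euclidean norm, and the differential entropy of $X_t$ is $$H(X_t)=-\int_{\mathbb{R}^n}p_t(x_t)\log p_t(x_t)\,dx_t .$$ *)

theory Defs
  imports "HOL-Probability.Probability"
begin

text \<open>The density of $N_n(0, tI)$ for $t > 0$, where $n$ is the cardinality of the index type.\<close>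

definition gaussian_density :: "real \<Rightarrow> real ^ 'n \<Rightarrow> real" where
  "gaussian_density t z =
     1 / (2 * pi * t) powr (real CARD('n) / 2) * exp (- (norm z)\<^sup>2 / (2 * t))"

text \<open>
  Differential entropy in nats. If the entropy integral diverges, the value is 0, as for every
  Bochner integral. Lemma \<open>differential_entropy_smoothed\<close> below expresses it through densities.
\<close>

definition differential_entropy :: "'a measure \<Rightarrow> ('a \<Rightarrow> real ^ 'n) \<Rightarrow> real" where
  "differential_entropy M Y = prob_space.entropy M (exp 1) lborel Y"

definition smoothed_density :: "(real ^ 'n \<Rightarrow> real) \<Rightarrow> real \<Rightarrow> real ^ 'n \<Rightarrow> real" where
  "smoothed_density p t y =
     1 / (2 * pi * t) powr (real CARD('n) / 2) *
       (\<integral>x. p x * exp (- (norm (y - x))\<^sup>2 / (2 * t)) \<partial>lborel)"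

lemma smoothed_density_altdef:
  "smoothed_density p t y = (\<integral>x. p x * gaussian_density t (y - x) \<partial>lborel)"
proof -
  have "smoothed_density p t y =
      (\<integral>x. (1 / (2 * pi * t) powr (real CARD('a) / 2)) *
        (p x * exp (- (norm (y - x))\<^sup>2 / (2 * t))) \<partial>lborel)"
    unfolding smoothed_density_def by (rule integral_mult_right_zero[symmetric])
  also have "\<dots> = (\<integral>x. p x * gaussian_density t (y - x) \<partial>lborel)"
    by (simp add: gaussian_density_def mult.left_commute)
  finally show ?thesis .
qed

lemma gaussian_density_nonneg: "0 \<le> gaussian_density t z"
  by (simp add: gaussian_density_def)

lemma borel_measurable_gaussian_density [measurable]:
  "gaussian_density t \<in> borel_measurable borel"
  unfolding gaussian_density_def by measurable

lemma gaussian_density_le: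
  fixes z :: "real ^ 'n"
  assumes "0 < t"
  shows "gaussian_density t z \<le> 1 / (2 * pi * t) powr (real CARD('n) / 2)"
  using assms by (simp add: gaussian_density_def divide_right_mono)

lemma (in prob_space) distributed_smoothed:
  fixes X Z :: "'a \<Rightarrow> real ^ 'n" and p :: "real ^ 'n \<Rightarrow> real"
  assumes X: "distributed M lborel X (\<lambda>x. ennreal (p x))" and p: "\<And>x. 0 \<le> p x"
    and Z: "distributed M lborel Z (\<lambda>z. ennreal (gaussian_density t z))"
    and ind: "indep_var borel X borel Z" and t: "0 < t"
  shows "distributed M lborel (\<lambda>\<omega>. X \<omega> + Z \<omega>) (\<lambda>y. ennreal (smoothed_density p t y))"
proof -
  have [measurable]: "p \<in> borel_measurable borel"
    using distributed_real_measurable[OF _ X] p by simp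
  have rX [measurable]: "random_variable borel X" and rZ [measurable]: "random_variable borel Z"
    using distributed_measurable[OF X] distributed_measurable[OF Z] by simp_all
  have dX: "distr M lborel X = density lborel (\<lambda>x. ennreal (p x))"
    and dZ: "distr M lborel Z = density lborel (\<lambda>z. ennreal (gaussian_density t z))"
    using X Z by (simp_all add: distributed_def)
  have fX: "finite_measure (density lborel (\<lambda>x. ennreal (p x)))"
    unfolding dX[symmetric] by (intro finite_measure_distr) simp
  have fZ: "finite_measure (density lborel (\<lambda>z. ennreal (gaussian_density t z) :: ennreal)
      :: (real ^ 'n) measure)"
    unfolding dZ[symmetric] by (intro finite_measure_distr) simp
  have intp: "integrable lborel p"
  proof (rule integrableI_nonneg)
    have "(\<integral>\<^sup>+x. ennreal (p x) \<partial>lborel) =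
        emeasure (density lborel (\<lambda>x. ennreal (p x))) UNIV"
      by (subst emeasure_density) simp_all
    also have "\<dots> < \<infinity>"
      using finite_measure.emeasure_finite[OF fX, of UNIV] by (simp add: less_top)
    finally show "(\<integral>\<^sup>+x. ennreal (p x) \<partial>lborel) < \<infinity>" .
  qed (use p in simp_all)
  have intpg: "integrable lborel (\<lambda>x. p x * gaussian_density t (y - x))" for y
  proof (rule Bochner_Integration.integrable_bound)
    show "integrable lborel (\<lambda>x. p x * (1 / (2 * pi * t) powr (real CARD('n) / 2)))"
      using intp by simp
    show "AE x in lborel. norm (p x * gaussian_density t (y - x))
        \<le> norm (p x * (1 / (2 * pi * t) powr (real CARD('n) / 2)))"
    proof (rule AE_I2)
      fix x
      show "norm (p x * gaussian_density t (y - x))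
        \<le> norm (p x * (1 / (2 * pi * t) powr (real CARD('n) / 2)))"
        using mult_left_mono[OF gaussian_density_le[OF t, of "y - x"] p[of x]]
          p[of x] gaussian_density_nonneg[of t "y - x"]
        by (simp add: abs_mult)
    qed
  qed measurable
  have nn: "(\<integral>\<^sup>+x. ennreal (p x) * ennreal (gaussian_density t (y - x)) \<partial>lborel) =
      ennreal (smoothed_density p t y)" for y
    unfolding smoothed_density_altdef
    by (subst nn_integral_eq_integral[OF intpg[of y], symmetric])
      (simp_all add: p gaussian_density_nonneg ennreal_mult)
  have [measurable]: "smoothed_density p t \<in> borel_measurable borel"
    unfolding smoothed_density_altdef[abs_def] by measurable
  have "distr M lborel (\<lambda>\<omega>. X \<omega> + Z \<omega>) = density lborel (\<lambda>y. ennreal (smoothed_density p t y))"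
  proof (rule measure_eqI)
    fix A assume "A \<in> sets (distr M lborel (\<lambda>\<omega>. X \<omega> + Z \<omega>))"
    then have [measurable]: "A \<in> sets borel" by simp
    have shift: "(\<integral>\<^sup>+z. ennreal (gaussian_density t z) * indicator A (x + z) \<partial>lborel) =
        (\<integral>\<^sup>+y. ennreal (gaussian_density t (y - x)) * indicator A y \<partial>lborel)" for x
    proof -
      have "(\<integral>\<^sup>+y. ennreal (gaussian_density t (y - x)) * indicator A y \<partial>lborel) =
          (\<integral>\<^sup>+y. ennreal (gaussian_density t (y - x)) * indicator A y \<partial>distr lborel borel ((+) x))"
        by (simp only: lborel_distr_plus)
      also have "\<dots> = (\<integral>\<^sup>+z. ennreal (gaussian_density t z) * indicator A (x + z) \<partial>lborel)"
        by (subst nn_integral_distr) simp_all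
      finally show ?thesis by simp
    qed
    have "emeasure (distr M lborel (\<lambda>\<omega>. X \<omega> + Z \<omega>)) A =
        (\<integral>\<^sup>+u. indicator A u \<partial>(density lborel (\<lambda>x. ennreal (p x)) \<star>
          density lborel (\<lambda>z. ennreal (gaussian_density t z))))"
      using sum_indep_random_variable_lborel[OF ind] by (simp add: dX dZ)
    also have "\<dots> = (\<integral>\<^sup>+x. \<integral>\<^sup>+z. indicator A (x + z)
        \<partial>density lborel (\<lambda>z. ennreal (gaussian_density t z)) \<partial>density lborel (\<lambda>x. ennreal (p x)))"
      by (rule nn_integral_convolution[OF fX fZ]) simp_all
    also have "\<dots> = (\<integral>\<^sup>+x. ennreal (p x) *
        (\<integral>\<^sup>+z. ennreal (gaussian_density t z) * indicator A (x + z) \<partial>lborel) \<partial>lborel)"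
      by (simp add: nn_integral_density)
    also have "\<dots> = (\<integral>\<^sup>+x. (\<integral>\<^sup>+y. ennreal (p x) *
        (ennreal (gaussian_density t (y - x)) * indicator A y) \<partial>lborel) \<partial>lborel)"
      by (simp add: shift nn_integral_cmult)
    also have "\<dots> = (\<integral>\<^sup>+y. (\<integral>\<^sup>+x. ennreal (p x) *
        (ennreal (gaussian_density t (y - x)) * indicator A y) \<partial>lborel) \<partial>lborel)"
      by (rule lborel_pair.Fubini') measurable
    also have "\<dots> = (\<integral>\<^sup>+y. (\<integral>\<^sup>+x. ennreal (p x) * ennreal (gaussian_density t (y - x)) \<partial>lborel) *
        indicator A y \<partial>lborel)"
      by (simp add: nn_integral_multc mult.assoc[symmetric])
    also have "\<dots> = emeasure (density lborel (\<lambda>y. ennreal (smoothed_density p t y))) A"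
      by (simp add: nn emeasure_density)
    finally show "emeasure (distr M lborel (\<lambda>\<omega>. X \<omega> + Z \<omega>)) A =
        emeasure (density lborel (\<lambda>y. ennreal (smoothed_density p t y))) A" .
  qed simp
  then show ?thesis
    by (simp add: distributed_def)
qed

lemma (in prob_space) differential_entropy_smoothed:
  fixes X Z :: "'a \<Rightarrow> real ^ 'n" and p :: "real ^ 'n \<Rightarrow> real"
  assumes "distributed M lborel X (\<lambda>x. ennreal (p x))" and p: "\<And>x. 0 \<le> p x"
    and "distributed M lborel Z (\<lambda>z. ennreal (gaussian_density t z))"
    and "indep_var borel X borel Z" and "0 < t"
  shows "differential_entropy M (\<lambda>\<omega>. X \<omega> + Z \<omega>) =
    - (\<integral>y. smoothed_density p t y * ln (smoothed_density p t y) \<partial>lborel)"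
proof -
  interpret information_space M "exp 1"
    by unfold_locales simp
  have "0 \<le> smoothed_density p t y" for y
    unfolding smoothed_density_altdef
    by (intro Bochner_Integration.integral_nonneg) (simp add: p gaussian_density_nonneg)
  from entropy_distr[OF distributed_smoothed[OF assms] this] show ?thesis
    by (simp add: differential_entropy_def log_def)
qed

end

theory Submission
  imports Defs
begin

text \<open>
  Write $p_t = u(t, \cdot)$, $v = \nabla \ln p_t$, $A = \nabla^2 \ln p_t$, $B = \nabla^3 \ln p_t$ and
  $E_t$ for the expectation under $p_t$. From the heat equation and integration by parts,
  $H' = E_t |v|^2 / 2$, $H'' = - E_t |A|^2 / 2$ and $H''' = E_t (|B|^2 - 2 \mathrm{tr} A^3) / 2$.
  Every vector field $F$ of moderate growth satisfies $E_t (v \cdot F + \mathrm{div} F) = 0$. Adding suitable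
  multiples of such identities to $|B|^2 - 2 \mathrm{tr} A^3$ turns it into a quadratic form in
  $B$, $A \otimes v$, $v \otimes v \otimes v$ that is nonnegative in dimension at most 4.

  For the analysis, $\partial^\alpha p_t / p_t$ is a conditional expectation of a Hermite polynomial, so
  Jensen's inequality bounds $p_t |\partial^\alpha p_t / p_t|^k$ by a multiple of $p_c$ with a larger $c$, locally
  uniformly in $t$. If the entropy is finite at one time, an elementary Harnack inequality makes
  $p_b \ln p_a$ integrable for all $a, b > 0$. Otherwise the entropy integral diverges at all times
  and the formal entropy is constantly 0.
\<close>

section \<open>The Gaussian kernel\<close>

text \<open>The obstacle is that an arbitrary density has neither moments nor a tail bound, so no
  fixed weight can dominate the integrands. The only integrable majorants at hand are the flow
  itself at other times, which is why bounds take the form \<open>C * u c\<close>. The logarithm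
  escapes this scheme: if \<open>ln (u t y)\<close> were always \<open>moderate\<close>, every
  entropy would be finite. It occurs only in the step from the entropy to its first derivative;
  afterwards all integrands are polynomials in the quotients \<open>q \<alpha>\<close>.

  The dimension enters through two projection inequalities for tensors with three indices and trace
  vector s: |S|^2 >= 3 |s|^2 / (n + 2) if S is symmetric, and (n - 1) |R|^2 >= 2 |s|^2 if R is
  antisymmetric in its outer indices. They reduce the tensors to their trace vectors; what remains
  is a quadratic form in four vectors, whose positivity is a finite rational check at n = 4. In the
  final combination, the null identities with fourth derivatives of ln p_t occur in pairs in which
  these cancel.\<close>

fun herm :: "nat \<Rightarrow> real \<Rightarrow> real \<Rightarrow> real" where
  "herm 0 t x = 1"
| "herm (Suc 0) t x = - x / t"
| "herm (Suc (Suc m)) t x = - (x / t) * herm (Suc m) t x - (real (Suc m) / t) * herm m t x"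

text \<open>One equation for both nontrivial clauses: at \<open>m = 0\<close> the truncated
  \<open>m - 1\<close> is harmless because its coefficient vanishes.\<close>

lemma herm_Suc: "herm (Suc m) t x = - (x / t) * herm m t x - (real m / t) * herm (m - 1) t x"
  by (cases m) auto

text \<open>The lowering rule of Hermite polynomials: differentiating the recurrence gives a
  combination that \<open>herm_Suc\<close> folds back into a single term.\<close>

lemma has_derivative_herm_space:
  assumes "0 < t"
  shows "((\<lambda>x. herm m t x) has_real_derivative - (real m / t) * herm (m - 1) t x) (at x)"
proof (induction m rule: less_induct)
  case (less m)
  show ?case
  proof (cases m)
    case (Suc k)
    have e: "herm m t = (\<lambda>x. - (x / t) * herm k t x - (real k / t) * herm (k - 1) t x)"
      using Suc herm_Suc by auto
    have d1: "((\<lambda>x. herm k t x) has_real_derivative - (real k / t) * herm (k - 1) t x) (at x)"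
      using less Suc by auto
    have d2: "((\<lambda>x. herm (k - 1) t x) has_real_derivative - (real (k - 1) / t) * herm (k - 1 - 1) t x) (at x)"
      using less[of "k - 1"] Suc by auto
    have x: "((\<lambda>x. - (x / t)) has_real_derivative - (1 / t)) (at x)"
      using assms by (auto intro!: derivative_eq_intros)
    have "((\<lambda>x. - (x / t) * herm k t x - (real k / t) * herm (k - 1) t x) has_real_derivative
       - (1 / t) * herm k t x + - (x / t) * (- (real k / t) * herm (k - 1) t x)
        - (real k / t) * (- (real (k - 1) / t) * herm (k - 1 - 1) t x)) (at x)"
      using DERIV_diff[OF DERIV_mult[OF x d1] DERIV_cmult[OF d2, of "real k / t"]]
      by (simp add: algebra_simps)
    moreover have "- (1 / t) * herm k t x + - (x / t) * (- (real k / t) * herm (k - 1) t x)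
        - (real k / t) * (- (real (k - 1) / t) * herm (k - 1 - 1) t x)
        = - (real m / t) * herm (m - 1) t x"
    proof (cases k)
      case (Suc j)
      then show ?thesis
        using \<open>m = Suc k\<close> assms by (simp add: herm_Suc[of j]) (simp add: field_simps)
    qed (use Suc in simp)
    ultimately show ?thesis unfolding e by simp
  qed simp
qed

text \<open>Reflects the scaling of \<open>herm m t x\<close> as t^(-m/2) times a polynomial in x /
  sqrt t: Euler's relation trades the time derivative for the space derivative.\<close>

lemma has_derivative_herm_time:
  assumes t: "0 < t"
  shows "((\<lambda>t. herm m t x) has_real_derivative
     - (real m / (2 * t)) * herm m t x + (real m * x / (2 * t\<^sup>2)) * herm (m - 1) t x) (at t)"
proof (induction m rule: less_induct)
  case (less m)
  show ?case
  proof (cases m)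
    case (Suc k)
    have e: "(\<lambda>t. herm m t x) = (\<lambda>t. - (x / t) * herm k t x - (real k / t) * herm (k - 1) t x)"
      using Suc herm_Suc by auto
    define h0 h1 h2 where "h0 = herm k t x" and "h1 = herm (k - 1) t x" and "h2 = herm (k - 1 - 1) t x"
    have d1: "((\<lambda>t. herm k t x) has_real_derivative
         - (real k / (2 * t)) * h0 + (real k * x / (2 * t\<^sup>2)) * h1) (at t)"
      using less Suc unfolding h0_def h1_def by auto
    have d2: "((\<lambda>t. herm (k - 1) t x) has_real_derivative
         - (real (k - 1) / (2 * t)) * h1 + (real (k - 1) * x / (2 * t\<^sup>2)) * h2) (at t)"
      using less[of "k - 1"] Suc unfolding h1_def h2_def by auto
    have x: "((\<lambda>t. - (x / t)) has_real_derivative x / t\<^sup>2) (at t)"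
      and k: "((\<lambda>t. real k / t) has_real_derivative - (real k / t\<^sup>2)) (at t)"
      using t by (auto intro!: derivative_eq_intros simp: power2_eq_square)
    have "((\<lambda>t. - (x / t) * herm k t x - (real k / t) * herm (k - 1) t x) has_real_derivative
       (x / t\<^sup>2) * h0 - (x / t) * (- (real k / (2 * t)) * h0 + (real k * x / (2 * t\<^sup>2)) * h1)
       + (real k / t\<^sup>2) * h1 - (real k / t) * (- (real (k - 1) / (2 * t)) * h1 + (real (k - 1) * x / (2 * t\<^sup>2)) * h2)) (at t)"
      unfolding h0_def h1_def h2_def
      using DERIV_diff[OF DERIV_mult[OF x d1] DERIV_mult[OF k d2]]
      unfolding h0_def h1_def h2_def by (simp add: algebra_simps)
    \<comment> \<open>The factor \<open>real k\<close> keeps this true at \<open>k = 0\<close>,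
      where the recurrence for \<open>h0\<close> itself fails.\<close>
    moreover have h0: "real k * h0 = real k * (- (x / t) * h1 - (real (k - 1) / t) * h2)"
      unfolding h0_def h1_def h2_def by (cases k) (auto simp: herm_Suc)
    have hm: "herm m t x = - (x / t) * h0 - (real k / t) * h1"
      using Suc herm_Suc unfolding h0_def h1_def by auto
    have "(x / t\<^sup>2) * h0 - (x / t) * (- (real k / (2 * t)) * h0 + (real k * x / (2 * t\<^sup>2)) * h1)
       + (real k / t\<^sup>2) * h1 - (real k / t) * (- (real (k - 1) / (2 * t)) * h1 + (real (k - 1) * x / (2 * t\<^sup>2)) * h2)
        = - (real m / (2 * t)) * herm m t x + (real m * x / (2 * t\<^sup>2)) * h0"
    proof (cases "k = 0")
      case False
      define K where "K = real (k - 1)"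
      have k: "real k = K + 1" and m: "real m = K + 2" using False Suc by (auto simp: K_def)
      have h0': "h0 = - (x / t) * h1 - (K / t) * h2"
        using h0 False by (simp add: K_def)
      show ?thesis unfolding hm unfolding h0' K_def[symmetric] unfolding k m
        using t by (simp add: field_simps power2_eq_square)
    next
      case True
      then show ?thesis using hm Suc t by (simp add: field_simps power2_eq_square)
    qed
    ultimately show ?thesis unfolding e h0_def using Suc by simp
  qed simp
qed

section \<open>The one-dimensional heat kernel and its derivatives\<close>

definition gauss1 :: "real \<Rightarrow> real \<Rightarrow> real" where
  "gauss1 t x = 1 / sqrt (2 * pi * t) * exp (- x\<^sup>2 / (2 * t))"

text \<open>The sign convention of \<open>herm\<close> makes this the \<open>m\<close>-th derivative
  of \<open>gauss1 t\<close>, so raising \<open>m\<close> by one is differentiation.\<close>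

definition kern1 :: "nat \<Rightarrow> real \<Rightarrow> real \<Rightarrow> real" where
  "kern1 m t x = herm m t x * gauss1 t x"

lemma has_derivative_kern1_space:
  assumes t: "0 < t"
  shows "((\<lambda>x. kern1 m t x) has_real_derivative kern1 (Suc m) t x) (at x)"
proof -
  have g: "((\<lambda>x. gauss1 t x) has_real_derivative - (x / t) * gauss1 t x) (at x)"
    unfolding gauss1_def
    by (rule derivative_eq_intros refl | use t in simp)+
  show ?thesis
    unfolding kern1_def herm_Suc
    by (rule derivative_eq_intros has_derivative_herm_space[OF t] g refl)+ (simp add: algebra_simps)
qed

text \<open>The heat equation; the factor one half appears because \<open>t\<close> is the
  variance.\<close>

lemma has_derivative_kern1_time:
  assumes t: "0 < t"
  shows "((\<lambda>t. kern1 m t x) has_real_derivative kern1 (Suc (Suc m)) t x / 2) (at t)"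
proof -
  have g: "((\<lambda>t. gauss1 t x) has_real_derivative (x\<^sup>2 / (2 * t\<^sup>2) - 1 / (2 * t)) * gauss1 t x) (at t)"
  proof -
    have 1: "((\<lambda>t. 1 / sqrt (2 * pi * t)) has_real_derivative - (1 / (2 * t)) * (1 / sqrt (2 * pi * t))) (at t)"
    proof -
      have s: "((\<lambda>t. sqrt (2 * pi * t)) has_real_derivative inverse (sqrt (2 * pi * t)) / 2 * (2 * pi)) (at t)"
        using DERIV_chain2[OF DERIV_real_sqrt DERIV_cmult_Id, of "2 * pi" t] t by simp
      have "((\<lambda>t. inverse (sqrt (2 * pi * t))) has_real_derivative
          - (inverse (sqrt (2 * pi * t)) / 2 * (2 * pi) * inverse (sqrt (2 * pi * t) ^ Suc (Suc 0)))) (at t)"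
        using DERIV_inverse_fun[OF s] t by simp
      also have "inverse (sqrt (2 * pi * t) ^ Suc (Suc 0)) = 1 / (2 * pi * t)"
        using t by (simp add: inverse_eq_divide)
      finally show ?thesis by (simp add: inverse_eq_divide mult.commute)
    qed
    have 2: "((\<lambda>t. - x\<^sup>2 / (2 * t)) has_real_derivative x\<^sup>2 / (2 * t\<^sup>2)) (at t)"
      using t by (auto intro!: derivative_eq_intros simp: power2_eq_square)
    show ?thesis unfolding gauss1_def
      using DERIV_mult[OF 1 DERIV_fun_exp[OF 2]] by (simp add: algebra_simps)
  qed
  have e: "herm (Suc (Suc m)) t x = - (x / t) * (- (x / t) * herm m t x - (real m / t) * herm (m - 1) t x)
      - ((real m + 1) / t) * herm m t x"
    by (simp add: herm_Suc[of m])
  define h0 h1 where "h0 = herm m t x" and "h1 = herm (m - 1) t x"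
  have h: "((\<lambda>t. herm m t x) has_real_derivative
     - (real m / (2 * t)) * h0 + (real m * x / (2 * t\<^sup>2)) * h1) (at t)"
    using has_derivative_herm_time[OF t] unfolding h0_def h1_def .
  have "((\<lambda>t. herm m t x * gauss1 t x) has_real_derivative
     (- (real m / (2 * t)) * h0 + (real m * x / (2 * t\<^sup>2)) * h1) * gauss1 t x
      + ((x\<^sup>2 / (2 * t\<^sup>2) - 1 / (2 * t)) * gauss1 t x) * h0) (at t)"
    using DERIV_mult[OF h g] unfolding h0_def .
  also have "(- (real m / (2 * t)) * h0 + (real m * x / (2 * t\<^sup>2)) * h1) * gauss1 t x
      + ((x\<^sup>2 / (2 * t\<^sup>2) - 1 / (2 * t)) * gauss1 t x) * h0 = kern1 (Suc (Suc m)) t x / 2"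
  proof -
    have "(- (real m / (2 * t)) * h0 + (real m * x / (2 * t\<^sup>2)) * h1)
      + (x\<^sup>2 / (2 * t\<^sup>2) - 1 / (2 * t)) * h0
      = (- (x / t) * (- (x / t) * h0 - (real m / t) * h1) - ((real m + 1) / t) * h0) / 2"
      using t by (simp add: field_simps power2_eq_square)
    then show ?thesis unfolding kern1_def e h0_def[symmetric] h1_def[symmetric]
      by (simp add: algebra_simps add_divide_distrib power2_eq_square)
  qed
  finally show ?thesis unfolding kern1_def .
qed

section \<open>Products over the coordinates\<close>

definition hpoly :: "'n multiset \<Rightarrow> real \<Rightarrow> real ^ 'n \<Rightarrow> real" where
  "hpoly \<alpha> t z = (\<Prod>j\<in>UNIV. herm (count \<alpha> j) t (z $ j))"

text \<open>A multi-index is a multiset of coordinates: \<open>add_mset i\<close> is one more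
  derivative in direction \<open>i\<close>, and the symmetry of mixed partial derivatives holds by
  construction.\<close>

definition kern :: "'n multiset \<Rightarrow> real \<Rightarrow> real ^ 'n \<Rightarrow> real" where
  "kern \<alpha> t z = hpoly \<alpha> t z * gaussian_density t z"

lemma gaussian_density_prod:
  fixes z :: "real ^ 'n"
  assumes t: "0 < t"
  shows "gaussian_density t z = (\<Prod>j\<in>UNIV. gauss1 t (z $ j))"
proof -
  have n: "(norm z)\<^sup>2 = (\<Sum>j\<in>UNIV. (z $ j)\<^sup>2)"
    by (simp add: norm_vec_def L2_set_def sum_nonneg)
  have "sqrt (2 * pi * t) ^ CARD('n) = (2 * pi * t) powr (real CARD('n) / 2)"
    using t by (simp add: powr_half_sqrt[symmetric] powr_realpow[symmetric] powr_powr)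
  then show ?thesis
    unfolding gaussian_density_def gauss1_def n prod.distrib
    by (simp add: exp_sum[symmetric] sum_divide_distrib sum_negf power_divide power_one_over)
qed

lemma kern_prod:
  assumes t: "0 < t"
  shows "kern \<alpha> t z = (\<Prod>j\<in>UNIV. kern1 (count \<alpha> j) t (z $ j))"
  using t by (simp add: kern_def hpoly_def gaussian_density_prod kern1_def prod.distrib)

lemma has_derivative_kern_space:
  fixes z :: "real ^ 'n"
  assumes t: "0 < t"
  shows "((\<lambda>s. kern \<alpha> t (z + s *\<^sub>R axis i 1)) has_real_derivative
      kern (add_mset i \<alpha>) t (z + s *\<^sub>R axis i 1)) (at s)"
proof -
  define P where "P = (\<Prod>j\<in>UNIV - {i}. kern1 (count \<alpha> j) t (z $ j))"
  have e: "kern \<beta> t (z + s *\<^sub>R axis i 1) = kern1 (count \<beta> i) t (z $ i + s) * P"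
    if "\<And>j. j \<noteq> i \<Longrightarrow> count \<beta> j = count \<alpha> j" for s \<beta>
  proof -
    have "(\<Prod>j\<in>UNIV - {i}. kern1 (count \<beta> j) t ((z + s *\<^sub>R axis i 1) $ j)) = P"
      unfolding P_def by (rule prod.cong) (auto simp: axis_def that)
    then show ?thesis
      using t by (subst kern_prod) (auto simp: prod.remove[of UNIV i])
  qed
  have "((\<lambda>s. kern1 (count \<alpha> i) t (z $ i + s)) has_real_derivative kern1 (Suc (count \<alpha> i)) t (z $ i + s)) (at s)"
    using has_derivative_kern1_space[OF t, of "count \<alpha> i" "z $ i + s"]
    using DERIV_shift[of "kern1 (count \<alpha> i) t" _ s "z $ i"] by (simp add: add.commute)
  from DERIV_cmult_right[OF this, of P] show ?thesis
    by (simp add: e)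
qed

lemma has_derivative_kern_time:
  fixes z :: "real ^ 'n"
  assumes t: "0 < t"
  shows "((\<lambda>t. kern \<alpha> t z) has_real_derivative
      (\<Sum>j\<in>UNIV. kern (add_mset j (add_mset j \<alpha>)) t z) / 2) (at t)"
proof -
  have e: "kern (add_mset i (add_mset i \<alpha>)) t z =
     kern1 (Suc (Suc (count \<alpha> i))) t (z $ i) * (\<Prod>j\<in>UNIV - {i}. kern1 (count \<alpha> j) t (z $ j))" for i
    using t by (subst kern_prod) (auto simp: prod.remove[of UNIV i] intro!: prod.cong)
  have "((\<lambda>t. \<Prod>j\<in>UNIV. kern1 (count \<alpha> j) t (z $ j)) has_real_derivative
      (\<Sum>j\<in>UNIV. (kern1 (Suc (Suc (count \<alpha> j))) t (z $ j) / 2) *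
         (\<Prod>k\<in>UNIV - {j}. kern1 (count \<alpha> k) t (z $ k)))) (at t)"
    by (rule has_field_derivative_prod) (rule has_derivative_kern1_time[OF t])
  also have "(\<Sum>j\<in>UNIV. (kern1 (Suc (Suc (count \<alpha> j))) t (z $ j) / 2) *
         (\<Prod>k\<in>UNIV - {j}. kern1 (count \<alpha> k) t (z $ k))) = (\<Sum>j\<in>UNIV. kern (add_mset j (add_mset j \<alpha>)) t z) / 2"
    by (simp add: e sum_divide_distrib)
  finally have *: "((\<lambda>t. \<Prod>j\<in>UNIV. kern1 (count \<alpha> j) t (z $ j)) has_real_derivative
     (\<Sum>j\<in>UNIV. kern (add_mset j (add_mset j \<alpha>)) t z) / 2) (at t)" .
  show ?thesis
    by (rule has_field_derivative_transform_within_open[OF *, of "{0<..}"]) (use t in \<open>auto simp: kern_prod\<close>)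
qed

section \<open>Gaussian bounds for polynomial factors, uniform in time\<close>

lemma herm_bound:
  assumes a: "0 < a" and e: "0 < \<epsilon>"
  obtains C where "0 < C" "\<And>t x. a \<le> t \<Longrightarrow> \<bar>herm m t x\<bar> \<le> C * exp (\<epsilon> * x\<^sup>2)"
proof -
  have "\<forall>\<epsilon>>0. \<exists>C>0. \<forall>t x. a \<le> t \<longrightarrow> \<bar>herm m t x\<bar> \<le> C * exp (\<epsilon> * x\<^sup>2)"
  proof (induction m rule: less_induct)
    case (less m)
    show ?case
    proof (intro allI impI)
      fix \<epsilon> :: real assume e: "0 < \<epsilon>"
      show "\<exists>C>0. \<forall>t x. a \<le> t \<longrightarrow> \<bar>herm m t x\<bar> \<le> C * exp (\<epsilon> * x\<^sup>2)"
      proof (cases m)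
        case 0
        then show ?thesis using e by (intro exI[of _ 1]) auto
      next
        case (Suc k)
        obtain C1 where C1: "C1 > 0" "\<And>t x. a \<le> t \<Longrightarrow> \<bar>herm k t x\<bar> \<le> C1 * exp (\<epsilon> / 2 * x\<^sup>2)"
          using less[of k] Suc e by (metis half_gt_zero lessI)
        obtain C2 where C2: "C2 > 0" "\<And>t x. a \<le> t \<Longrightarrow> \<bar>herm (k - 1) t x\<bar> \<le> C2 * exp (\<epsilon> * x\<^sup>2)"
          using less[of "k - 1"] Suc e by (metis diff_le_self le_imp_less_Suc)
        \<comment> \<open>Half of the exponent pays for the factor \<open>x\<close> in the
          recurrence, the other half for \<open>herm k\<close>.\<close>
        have x: "\<bar>x\<bar> \<le> (1 + 2 / \<epsilon>) * exp (\<epsilon> / 2 * x\<^sup>2)" for x :: real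
        proof -
          have "\<bar>x\<bar> \<le> 1 + x\<^sup>2"
            using zero_le_power2[of "\<bar>x\<bar> - 1"] abs_ge_zero[of x] by (simp add: power2_diff)
          also have "\<dots> \<le> (1 + 2 / \<epsilon>) * (1 + \<epsilon> / 2 * x\<^sup>2)"
            using e by (simp add: field_simps)
          also have "\<dots> \<le> (1 + 2 / \<epsilon>) * exp (\<epsilon> / 2 * x\<^sup>2)"
            using e by (intro mult_left_mono exp_ge_add_one_self) auto
          finally show ?thesis .
        qed
        show ?thesis
        proof (intro exI[of _ "(1 + 2 / \<epsilon>) * C1 / a + real k * C2 / a"] conjI allI impI)
          show "0 < (1 + 2 / \<epsilon>) * C1 / a + real k * C2 / a"
            using e a C1 C2 by (intro add_pos_nonneg divide_pos_pos mult_pos_pos) (auto intro: add_pos_pos)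
          fix t x assume at: "a \<le> t"
          have h1: "\<bar>x\<bar> * \<bar>herm k t x\<bar> \<le> ((1 + 2 / \<epsilon>) * exp (\<epsilon> / 2 * x\<^sup>2)) * (C1 * exp (\<epsilon> / 2 * x\<^sup>2))"
            using e by (intro mult_mono x C1 at) auto
          also have "\<dots> = (1 + 2 / \<epsilon>) * C1 * exp (\<epsilon> * x\<^sup>2)"
            by (simp flip: exp_add)
          finally have h1: "\<bar>x\<bar> * \<bar>herm k t x\<bar> \<le> (1 + 2 / \<epsilon>) * C1 * exp (\<epsilon> * x\<^sup>2)" .
          have h2: "real k * \<bar>herm (k - 1) t x\<bar> \<le> real k * (C2 * exp (\<epsilon> * x\<^sup>2))"
            by (intro mult_left_mono C2 at) auto
          have "\<bar>herm m t x\<bar> = \<bar>(x * herm k t x + real k * herm (k - 1) t x) / t\<bar>"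
            unfolding Suc herm_Suc by (subst abs_minus_cancel[symmetric]) (simp add: add_divide_distrib)
          also have "\<dots> = \<bar>x * herm k t x + real k * herm (k - 1) t x\<bar> / t"
            using at a by simp
          also have "\<dots> \<le> (\<bar>x\<bar> * \<bar>herm k t x\<bar> + real k * \<bar>herm (k - 1) t x\<bar>) / t"
            using at a by (intro divide_right_mono) (auto simp: abs_mult intro: order_trans[OF abs_triangle_ineq])
          also have "\<dots> \<le> ((1 + 2 / \<epsilon>) * C1 * exp (\<epsilon> * x\<^sup>2) + real k * (C2 * exp (\<epsilon> * x\<^sup>2))) / a"
            using at a e C1 C2 by (intro frac_le add_mono h1 h2) auto
          finally show "\<bar>herm m t x\<bar> \<le> ((1 + 2 / \<epsilon>) * C1 / a + real k * C2 / a) * exp (\<epsilon> * x\<^sup>2)"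
            by (simp add: algebra_simps add_divide_distrib)
        qed
      qed
    qed
  qed
  then show ?thesis using that e by blast
qed

lemma hpoly_bound:
  assumes a: "0 < a" and e: "0 < \<epsilon>"
  obtains C where "0 < C" "\<And>t (z :: real ^ 'n). a \<le> t \<Longrightarrow> \<bar>hpoly \<alpha> t z\<bar> \<le> C * exp (\<epsilon> * (norm z)\<^sup>2)"
proof -
  have "\<exists>C>0. \<forall>t x. a \<le> t \<longrightarrow> \<bar>herm (count \<alpha> j) t x\<bar> \<le> C * exp (\<epsilon> * x\<^sup>2)" for j
    using herm_bound[OF a e] by metis
  then obtain C where C: "\<And>j. C j > 0" "\<And>j t x. a \<le> t \<Longrightarrow> \<bar>herm (count \<alpha> j) t x\<bar> \<le> C j * exp (\<epsilon> * x\<^sup>2)"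
    by metis
  show ?thesis
  proof (rule that[of "\<Prod>j\<in>UNIV. C j"])
    show "0 < (\<Prod>j\<in>UNIV. C j)" using C by (intro prod_pos) auto
    fix t and z :: "real ^ 'n" assume at: "a \<le> t"
    have n: "(norm z)\<^sup>2 = (\<Sum>j\<in>UNIV. (z $ j)\<^sup>2)"
      by (simp add: norm_vec_def L2_set_def sum_nonneg)
    have "\<bar>hpoly \<alpha> t z\<bar> \<le> (\<Prod>j\<in>UNIV. C j * exp (\<epsilon> * (z $ j)\<^sup>2))"
      unfolding hpoly_def abs_prod by (intro prod_mono) (auto intro!: C at)
    then show "\<bar>hpoly \<alpha> t z\<bar> \<le> (\<Prod>j\<in>UNIV. C j) * exp (\<epsilon> * (norm z)\<^sup>2)"
      by (simp add: n prod.distrib exp_sum sum_distrib_left)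
  qed
qed

text \<open>The quotient of the two densities is largest at the origin, where it equals the
  constant.\<close>

lemma gaussian_density_mono_scaled:
  fixes z :: "real ^ 'n"
  assumes "0 < a" "a \<le> b"
  shows "gaussian_density a z \<le> (b / a) powr (real CARD('n) / 2) * gaussian_density b z"
proof -
  have "- (norm z)\<^sup>2 / (2 * a) \<le> - (norm z)\<^sup>2 / (2 * b)"
    using assms by (simp add: frac_le)
  moreover have "1 / (2 * pi * a) powr (real CARD('n) / 2)
      = (b / a) powr (real CARD('n) / 2) * (1 / (2 * pi * b) powr (real CARD('n) / 2))"
    using assms by (simp add: powr_divide powr_mult)
  ultimately show ?thesis using assms unfolding gaussian_density_def
    by (auto intro!: divide_right_mono mult_left_mono)
qed

lemma gaussian_density_pos: "0 < t \<Longrightarrow> 0 < gaussian_density t z"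
  by (simp add: gaussian_density_def)

text \<open>Halving the exponent absorbs every polynomial factor.\<close>

lemma kern_power_bound:
  assumes a: "0 < a" and ab: "a \<le> b"
  obtains C where "0 < C" "\<And>t (z :: real ^ 'n). a \<le> t \<Longrightarrow> t \<le> b \<Longrightarrow>
    \<bar>hpoly \<alpha> t z\<bar> ^ k * gaussian_density t z \<le> C * gaussian_density (2 * b) z"
proof -
  \<comment> \<open>With this choice the \<open>k\<close>-th power costs at most exp(|z|^2 / (4 b)),
    half of the decay of the density of variance \<open>b\<close>; \<open>k + 1\<close> avoids
    division by zero at \<open>k = 0\<close>.\<close>
  define \<epsilon> where "\<epsilon> = 1 / (4 * b * (real k + 1))"
  have b: "0 < b" using a ab by simp
  have e: "0 < \<epsilon>" using b by (simp add: \<epsilon>_def)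
  obtain C where C: "0 < C" "\<And>t (z :: real ^ 'n). a \<le> t \<Longrightarrow> \<bar>hpoly \<alpha> t z\<bar> \<le> C * exp (\<epsilon> * (norm z)\<^sup>2)"
    by (rule hpoly_bound[OF a e]) blast
  define B where "B = (b / a) powr (real CARD('n) / 2)"
  define E where "E = 2 powr (real CARD('n) / 2)"
  show ?thesis
  proof (rule that[of "C ^ k * (B * E)"])
    show "0 < C ^ k * (B * E)" using C a b by (simp add: B_def E_def)
    fix t and z :: "real ^ 'n" assume t: "a \<le> t" "t \<le> b"
    have "\<bar>hpoly \<alpha> t z\<bar> ^ k \<le> (C * exp (\<epsilon> * (norm z)\<^sup>2)) ^ k"
      by (intro power_mono C t) auto
    also have "\<dots> = C ^ k * exp (real k * \<epsilon> * (norm z)\<^sup>2)"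
      by (simp add: power_mult_distrib exp_of_nat_mult[symmetric] mult_ac)
    also have "\<dots> \<le> C ^ k * exp (1 / (4 * b) * (norm z)\<^sup>2)"
    proof -
      have "real k * \<epsilon> \<le> 1 / (4 * b)" using b by (simp add: \<epsilon>_def divide_simps)
      from mult_right_mono[OF this, of "(norm z)\<^sup>2"] show ?thesis
        using C by (intro mult_left_mono) auto
    qed
    finally have 1: "\<bar>hpoly \<alpha> t z\<bar> ^ k \<le> C ^ k * exp (1 / (4 * b) * (norm z)\<^sup>2)" .
    have "gaussian_density t z \<le> (b / t) powr (real CARD('n) / 2) * gaussian_density b z"
      using a t by (intro gaussian_density_mono_scaled) auto
    also have "\<dots> \<le> B * gaussian_density b z"
      unfolding B_def using a t b
      by (intro mult_right_mono powr_mono2 gaussian_density_nonneg) (auto simp: field_simps)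
    finally have 2: "gaussian_density t z \<le> B * gaussian_density b z" .
    have 3: "exp (1 / (4 * b) * (norm z)\<^sup>2) * gaussian_density b z = E * gaussian_density (2 * b) z"
    proof -
      have p: "1 / (2 * pi * b) powr (real CARD('n) / 2) = E * (1 / (2 * pi * (2 * b)) powr (real CARD('n) / 2))"
      proof -
        have "(2 * pi * (2 * b)) powr (real CARD('n) / 2) = E * (2 * pi * b) powr (real CARD('n) / 2)"
          using powr_mult[of 2 "2 * pi * b" "real CARD('n) / 2"] b by (simp add: mult_ac E_def)
        then show ?thesis by (simp add: E_def)
      qed
      have "1 / (4 * b) * (norm z)\<^sup>2 + - (norm z)\<^sup>2 / (2 * b) = - (norm z)\<^sup>2 / (2 * (2 * b))"
        using b by (simp add: field_simps)
      then show ?thesis unfolding gaussian_density_def p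
        by (simp add: exp_add[symmetric])
    qed
    have "\<bar>hpoly \<alpha> t z\<bar> ^ k * gaussian_density t z
       \<le> (C ^ k * exp (1 / (4 * b) * (norm z)\<^sup>2)) * (B * gaussian_density b z)"
      using C by (intro mult_mono 1 2 gaussian_density_nonneg) auto
    also have "\<dots> = C ^ k * B * (exp (1 / (4 * b) * (norm z)\<^sup>2) * gaussian_density b z)" by simp
    also have "\<dots> = C ^ k * (B * E) * gaussian_density (2 * b) z" unfolding 3 by simp
    finally show "\<bar>hpoly \<alpha> t z\<bar> ^ k * gaussian_density t z \<le> C ^ k * (B * E) * gaussian_density (2 * b) z" .
  qed
qed

text \<open>By the parallelogram law |z + w|^2 is at most 2 |z|^2 + 2 |w|^2, and doubling the
  variance pays for the factor 2. Integration over the starting point turns this into the Harnack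
  inequality \<open>u_harnack\<close>.\<close>

lemma gaussian_density_shift:
  fixes z w :: "real ^ 'n"
  assumes "0 < a"
  shows "exp (- (norm w)\<^sup>2 / a) * gaussian_density (a / 2) z
     \<le> 2 powr (real CARD('n) / 2) * gaussian_density a (z + w)"
proof -
  have p: "1 / (2 * pi * (a / 2)) powr (real CARD('n) / 2) =
      2 powr (real CARD('n) / 2) * (1 / (2 * pi * a) powr (real CARD('n) / 2))"
    using assms by (simp add: powr_mult powr_divide)
  have "(norm (z + w))\<^sup>2 \<le> 2 * (norm z)\<^sup>2 + 2 * (norm w)\<^sup>2"
  proof -
    have "(norm (z + w))\<^sup>2 + (norm (z - w))\<^sup>2 = 2 * (norm z)\<^sup>2 + 2 * (norm w)\<^sup>2"
      by (simp add: power2_norm_eq_inner algebra_simps)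
    then show ?thesis by (smt (verit) zero_le_power2)
  qed
  then have "- (norm w)\<^sup>2 / a + - (norm z)\<^sup>2 / (2 * (a / 2)) \<le> - (norm (z + w))\<^sup>2 / (2 * a)"
    using assms divide_right_mono[of "(norm (z + w))\<^sup>2" "2 * (norm z)\<^sup>2 + 2 * (norm w)\<^sup>2" "2 * a"]
    by (simp add: add_divide_distrib)
  then show ?thesis
    unfolding gaussian_density_def p
    by (simp add: mult.assoc mult.left_commute[of "exp _"] flip: exp_add) (auto intro!: divide_right_mono)
qed

section \<open>Smoothing a probability measure\<close>

text \<open>The mean value inequality bounds the difference quotients by \<open>g\<close>, and
  dominated convergence along every null sequence gives the limit. Measurability of
  \<open>f' s0\<close> comes for free, as it is a pointwise limit of difference quotients.\<close>

lemma has_real_derivative_integral_dominated: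
  fixes f f' :: "real \<Rightarrow> 'a \<Rightarrow> real"
  assumes d: "0 < d"
    and int: "\<And>s. \<bar>s - s0\<bar> < d \<Longrightarrow> integrable M (f s)"
    and deriv: "\<And>s x. \<bar>s - s0\<bar> < d \<Longrightarrow> x \<in> space M \<Longrightarrow> ((\<lambda>s. f s x) has_real_derivative f' s x) (at s)"
    and bound: "\<And>s x. \<bar>s - s0\<bar> < d \<Longrightarrow> x \<in> space M \<Longrightarrow> \<bar>f' s x\<bar> \<le> g x"
    and g: "integrable M g"
  shows "((\<lambda>s. \<integral>x. f s x \<partial>M) has_real_derivative (\<integral>x. f' s0 x \<partial>M)) (at s0)"
  unfolding DERIV_def
proof (subst LIMSEQ_SEQ_conv[symmetric], intro allI impI)
  fix S :: "nat \<Rightarrow> real" assume S: "(\<forall>n. S n \<noteq> 0) \<and> S \<longlonglongrightarrow> 0"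
  then obtain N where N: "\<And>n. n \<ge> N \<Longrightarrow> \<bar>S n\<bar> < d"
    using LIMSEQ_D[of S 0 d] d by auto
  define T where "T n = S (n + N)" for n
  have T: "T n \<noteq> 0" "\<bar>T n\<bar> < d" for n using S N by (auto simp: T_def)
  have T0: "T \<longlonglongrightarrow> 0" unfolding T_def using S by (intro LIMSEQ_ignore_initial_segment) auto
  have lim: "(\<lambda>n. (f (s0 + T n) x - f s0 x) / T n) \<longlonglongrightarrow> f' s0 x" if x: "x \<in> space M" for x
  proof -
    have "((\<lambda>h. (f (s0 + h) x - f s0 x) / h) \<longlongrightarrow> f' s0 x) (at 0)"
      using deriv[of s0 x] d x unfolding DERIV_def by simp
    then show ?thesis using T T0 by (subst (asm) LIMSEQ_SEQ_conv[symmetric]) auto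
  qed
  have meas: "(\<lambda>x. (f (s0 + T n) x - f s0 x) / T n) \<in> borel_measurable M" for n
    using int[of "s0 + T n"] int[of s0] T d by (auto intro!: borel_measurable_divide borel_measurable_diff)
  have "(\<lambda>n. \<integral>x. (f (s0 + T n) x - f s0 x) / T n \<partial>M) \<longlonglongrightarrow> (\<integral>x. f' s0 x \<partial>M)"
  proof (rule integral_dominated_convergence[where w=g])
    show "f' s0 \<in> borel_measurable M"
      by (rule borel_measurable_LIMSEQ_real[OF lim meas])
    show "AE x in M. (\<lambda>n. (f (s0 + T n) x - f s0 x) / T n) \<longlonglongrightarrow> f' s0 x"
      using lim by (intro AE_I2)
    show "AE x in M. norm ((f (s0 + T n) x - f s0 x) / T n) \<le> g x" for n
    proof (intro AE_I2)
      fix x assume x: "x \<in> space M"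
      have "norm (f (s0 + T n) x - f s0 x) \<le> g x * norm ((s0 + T n) - s0)"
      proof (rule field_differentiable_bound[where S="ball s0 d" and f="\<lambda>s. f s x" and f'="\<lambda>s. f' s x"])
        show "((\<lambda>s. f s x) has_field_derivative f' z x) (at z within ball s0 d)" if "z \<in> ball s0 d" for z
          using that deriv[of z x] x by (rule_tac has_field_derivative_at_within) (simp_all add: dist_real_def abs_minus_commute)
        show "norm (f' z x) \<le> g x" if "z \<in> ball s0 d" for z
          using that bound[of z x] x by (simp add: dist_real_def abs_minus_commute)
        show "s0 + T n \<in> ball s0 d" using T(2)[of n] by (simp add: dist_real_def)
        show "s0 \<in> ball s0 d" using d by simp
      qed simp
      then show "norm ((f (s0 + T n) x - f s0 x) / T n) \<le> g x"
        using T by (simp add: divide_le_eq)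
    qed
  qed (use meas g in auto)
  also have "(\<lambda>n. \<integral>x. (f (s0 + T n) x - f s0 x) / T n \<partial>M) = (\<lambda>n.
      ((\<integral>x. f (s0 + T n) x \<partial>M) - (\<integral>x. f s0 x \<partial>M)) / T n)"
    using int[of "s0 + T _"] int[of s0] T d by (intro ext) simp
  finally have "(\<lambda>n. ((\<integral>x. f (s0 + S (n + N)) x \<partial>M) - (\<integral>x. f s0 x \<partial>M)) / S (n + N)) \<longlonglongrightarrow> (\<integral>x. f' s0 x \<partial>M)"
    by (simp add: T_def)
  then show "(\<lambda>n. ((\<integral>x. f (s0 + S n) x \<partial>M) - (\<integral>x. f s0 x \<partial>M)) / S n) \<longlonglongrightarrow> (\<integral>x. f' s0 x \<partial>M)"
    by (rule LIMSEQ_offset)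
qed

text \<open>Convexity of the power in tangent form: integrated with \<open>c\<close> the mean of
  \<open>x\<close>, it is Jensen's inequality.\<close>

lemma power_tangent:
  fixes x c :: real
  assumes "0 \<le> x" "0 \<le> c"
  shows "c ^ k + real k * c ^ (k - 1) * (x - c) \<le> x ^ k"
proof (induction k)
  case (Suc k)
  have "c ^ Suc k + real (Suc k) * c ^ k * (x - c)
      \<le> x * (c ^ k + real k * c ^ (k - 1) * (x - c))"
  proof (cases k)
    case (Suc j)
    have "x * (c ^ k + real k * c ^ (k - 1) * (x - c)) - (c ^ Suc k + real (Suc k) * c ^ k * (x - c))
        = real k * c ^ j * (x - c)\<^sup>2"
      using Suc by (simp add: algebra_simps power2_eq_square)
    then show ?thesis using assms by (smt (verit) mult_nonneg_nonneg of_nat_0_le_iff zero_le_power zero_le_power2)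
  qed simp
  also have "\<dots> \<le> x * x ^ k" using Suc assms by (intro mult_left_mono) auto
  finally show ?case by simp
qed simp

lemma continuous_on_herm: "continuous_on S (\<lambda>x. herm m t (f x))" if "continuous_on S f"
proof (induction m rule: less_induct)
  case (less m)
  show ?case
  proof (cases m)
    case (Suc k)
    then show ?thesis using less[of k] less[of "k - 1"] that
      unfolding Suc herm_Suc by (cases "t = 0") (auto intro!: continuous_intros)
  qed simp
qed

lemma borel_measurable_hpoly [measurable]: "hpoly \<alpha> t \<in> borel_measurable borel"
  unfolding hpoly_def by (intro borel_measurable_continuous_onI continuous_on_prod continuous_on_herm continuous_intros)

lemma borel_measurable_kern [measurable]: "kern \<alpha> t \<in> borel_measurable borel"
  unfolding kern_def by measurable

lemma kern_empty: "kern {#} t z = gaussian_density t z"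
  by (simp add: kern_def hpoly_def)

lemma nn_integral_gaussian_density:
  assumes t: "0 < t"
  shows "(\<integral>\<^sup>+z. ennreal (gaussian_density t (z :: real ^ 'n)) \<partial>lborel) = 1"
proof -
  have g: "gauss1 t = normal_density 0 (sqrt t)"
    using t by (auto simp: gauss1_def normal_density_def fun_eq_iff)
  have e: "ennreal (gaussian_density t z) = (\<Prod>b\<in>Basis. ennreal (gauss1 t (z \<bullet> b)))" for z :: "real ^ 'n"
  proof -
    have "(\<Prod>b\<in>Basis. gauss1 t (z \<bullet> b)) = (\<Prod>j\<in>UNIV. gauss1 t (z $ j))"
      by (rule prod.reindex_cong[of "\<lambda>j. axis j 1"])
        (auto simp: inj_on_def axis_eq_axis Basis_vec_def inner_axis)
    then show ?thesis
      using t by (simp add: gaussian_density_prod prod_ennreal gauss1_def)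
  qed
  have "(\<integral>\<^sup>+x. ennreal (gauss1 t x) \<partial>lborel) = 1"
    using t nn_integral_eq_integral[OF integrable_normal_density[of "sqrt t" 0]]
      integral_normal_density[of "sqrt t" 0] by (simp add: g normal_density_nonneg)
  then show ?thesis
    unfolding e by (subst nn_integral_lborel_prod) (auto simp: gauss1_def)
qed

text \<open>Stated for an initial law rather than a density: bounded kernels are then integrable
  against it at once.\<close>

locale heat_flow = prob_space \<mu> for \<mu> :: "(real ^ 'n) measure" +
  assumes sets_mu [measurable_cong]: "sets \<mu> = sets borel"
begin

lemma space_mu [simp]: "space \<mu> = UNIV"
  using sets_eq_imp_space_eq[OF sets_mu] by simp

definition D :: "'n multiset \<Rightarrow> real \<Rightarrow> real ^ 'n \<Rightarrow> real" where
  "D \<alpha> t y = (\<integral>x. kern \<alpha> t (y - x) \<partial>\<mu>)"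

abbreviation u :: "real \<Rightarrow> real ^ 'n \<Rightarrow> real" where
  "u \<equiv> D {#}"

lemma kern_bounded:
  assumes "0 < a" "a \<le> b"
  obtains C where "0 < C" "\<And>t (z :: real ^ 'n). a \<le> t \<Longrightarrow> t \<le> b \<Longrightarrow> \<bar>kern \<alpha> t z\<bar> \<le> C"
proof -
  obtain C where C: "0 < C" "\<And>t (z :: real ^ 'n). a \<le> t \<Longrightarrow> t \<le> b \<Longrightarrow>
    \<bar>hpoly \<alpha> t z\<bar> ^ 1 * gaussian_density t z \<le> C * gaussian_density (2 * b) z"
    by (rule kern_power_bound[OF assms, where k=1 and \<alpha>=\<alpha>]) blast
  have b: "0 < 2 * b" using assms by simp
  show ?thesis
  proof (rule that[of "C * (1 / (2 * pi * (2 * b)) powr (real CARD('n) / 2))"])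
    show "0 < C * (1 / (2 * pi * (2 * b)) powr (real CARD('n) / 2))" using C b by simp
    fix t and z :: "real ^ 'n" assume "a \<le> t" "t \<le> b"
    then have "\<bar>kern \<alpha> t z\<bar> \<le> C * gaussian_density (2 * b) z"
      using C(2)[of t z] gaussian_density_nonneg[of t z] by (simp add: kern_def abs_mult)
    also have "\<dots> \<le> C * (1 / (2 * pi * (2 * b)) powr (real CARD('n) / 2))"
      using C b by (intro mult_left_mono gaussian_density_le) auto
    finally show "\<bar>kern \<alpha> t z\<bar> \<le> C * (1 / (2 * pi * (2 * b)) powr (real CARD('n) / 2))" .
  qed
qed

lemma integrable_kern [simp, intro]:
  assumes "0 < t"
  shows "integrable \<mu> (\<lambda>x. kern \<alpha> t (y - x))"
proof -
  obtain C where "\<And>z :: real ^ 'n. \<bar>kern \<alpha> t z\<bar> \<le> C"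
    using kern_bounded[of t t] assms by (metis order_refl)
  then show ?thesis by (intro integrable_const_bound[of _ C]) auto
qed

lemma borel_measurable_D [measurable]: "D \<alpha> t \<in> borel_measurable borel"
  unfolding D_def by measurable

lemma has_derivative_D_space:
  assumes t: "0 < t"
  shows "((\<lambda>s. D \<alpha> t (y + s *\<^sub>R axis i 1)) has_real_derivative
     D (add_mset i \<alpha>) t (y + s *\<^sub>R axis i 1)) (at s)"
proof -
  obtain C where C: "\<And>z :: real ^ 'n. \<bar>kern (add_mset i \<alpha>) t z\<bar> \<le> C"
    using kern_bounded[of t t] t by (metis order_refl)
  show ?thesis unfolding D_def
  proof (rule has_real_derivative_integral_dominated[where g="\<lambda>_. C" and d=1])
    show "((\<lambda>s. kern \<alpha> t (y + s *\<^sub>R axis i 1 - x)) has_real_derivative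
       kern (add_mset i \<alpha>) t (y + s *\<^sub>R axis i 1 - x)) (at s)" for s x
      using has_derivative_kern_space[OF t, of \<alpha> "y - x" i s] by (simp add: algebra_simps)
  qed (use C t in auto)
qed

lemma has_derivative_D_time:
  assumes t: "0 < t"
  shows "((\<lambda>t. D \<alpha> t y) has_real_derivative
     (\<Sum>j\<in>UNIV. D (add_mset j (add_mset j \<alpha>)) t y) / 2) (at t)"
proof -
  have "\<exists>C. \<forall>s z. t / 2 \<le> s \<longrightarrow> s \<le> 2 * t \<longrightarrow> \<bar>kern (add_mset j (add_mset j \<alpha>)) s (z :: real ^ 'n)\<bar> \<le> C" for j
    by (rule kern_bounded[of "t / 2" "2 * t" "add_mset j (add_mset j \<alpha>)"]) (use t in auto)
  then obtain C where C: "\<And>j s z. t / 2 \<le> s \<Longrightarrow> s \<le> 2 * t \<Longrightarrow> \<bar>kern (add_mset j (add_mset j \<alpha>)) s (z :: real ^ 'n)\<bar> \<le> C j"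
    by metis
  have "((\<lambda>t. D \<alpha> t y) has_real_derivative
     (\<integral>x. (\<Sum>j\<in>UNIV. kern (add_mset j (add_mset j \<alpha>)) t (y - x)) / 2 \<partial>\<mu>)) (at t)"
    unfolding D_def
  proof (rule has_real_derivative_integral_dominated[where g="\<lambda>_. (\<Sum>j\<in>UNIV. C j) / 2" and d="t / 2"])
    fix s x assume s: "\<bar>s - t\<bar> < t / 2"
    then have s': "t / 2 \<le> s" "s \<le> 2 * t" unfolding abs_less_iff by linarith+
    show "integrable \<mu> (\<lambda>x. kern \<alpha> s (y - x))" using s' t by auto
    show "((\<lambda>s. kern \<alpha> s (y - x)) has_real_derivative
      (\<Sum>j\<in>UNIV. kern (add_mset j (add_mset j \<alpha>)) s (y - x)) / 2) (at s)"
      using s' t by (intro has_derivative_kern_time) auto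
    show "\<bar>(\<Sum>j\<in>UNIV. kern (add_mset j (add_mset j \<alpha>)) s (y - x)) / 2\<bar> \<le> (\<Sum>j\<in>UNIV. C j) / 2"
      using C[OF s'] by (auto intro!: order_trans[OF sum_abs] sum_mono)
  qed (use t in auto)
  also have "(\<integral>x. (\<Sum>j\<in>UNIV. kern (add_mset j (add_mset j \<alpha>)) t (y - x)) / 2 \<partial>\<mu>)
      = (\<Sum>j\<in>UNIV. D (add_mset j (add_mset j \<alpha>)) t y) / 2"
    using t by (simp add: D_def Bochner_Integration.integral_sum integrable_kern)
  finally show ?thesis .
qed

lemma u_altdef: "u t y = (\<integral>x. gaussian_density t (y - x) \<partial>\<mu>)"
  by (simp add: D_def kern_empty)

lemma integrable_gauss [simp, intro]: "0 < t \<Longrightarrow> integrable \<mu> (\<lambda>x. gaussian_density t (y - x))"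
  using integrable_kern[of t "{#}" y] by (simp add: kern_empty)

text \<open>A strictly positive function cannot have integral zero against a probability measure.
  This legitimises all later divisions by \<open>u\<close> and all logarithms.\<close>

lemma u_pos: "0 < t \<Longrightarrow> 0 < u t y"
proof -
  assume t: "0 < t"
  have "(\<integral>x. gaussian_density t (y - x) \<partial>\<mu>) \<noteq> 0"
  proof
    assume "(\<integral>x. gaussian_density t (y - x) \<partial>\<mu>) = 0"
    then have "AE x in \<mu>. gaussian_density t (y - x) = 0"
      using t by (subst (asm) integral_nonneg_eq_0_iff_AE) (auto simp: gaussian_density_nonneg)
    then have "AE x in \<mu>. False"
      by (rule eventually_mono) (simp add: gaussian_density_pos[OF t, THEN less_imp_neq, THEN not_sym])
    then show False by (simp add: AE_False)
  qed
  moreover have "(\<integral>x. gaussian_density t (y - x) \<partial>\<mu>) \<ge> 0"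
    by (intro integral_nonneg_AE AE_I2 gaussian_density_nonneg)
  ultimately show ?thesis by (simp add: u_altdef)
qed

lemma u_nonneg: "0 \<le> u t y"
  unfolding u_altdef by (intro integral_nonneg_AE AE_I2 gaussian_density_nonneg)

lemma u_le: "0 < t \<Longrightarrow> u t y \<le> 1 / (2 * pi * t) powr (real CARD('n) / 2)"
proof -
  assume t: "0 < t"
  have "(\<integral>x. gaussian_density t (y - x) \<partial>\<mu>) \<le> (\<integral>x. 1 / (2 * pi * t) powr (real CARD('n) / 2) \<partial>\<mu>)"
    using t by (intro integral_mono gaussian_density_le) auto
  then show ?thesis by (simp add: u_altdef prob_space[simplified])
qed

lemma u_mono_scaled:
  assumes "0 < a" "a \<le> b"
  shows "u a y \<le> (b / a) powr (real CARD('n) / 2) * u b y"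
proof -
  have "(\<integral>x. gaussian_density a (y - x) \<partial>\<mu>)
      \<le> (\<integral>x. (b / a) powr (real CARD('n) / 2) * gaussian_density b (y - x) \<partial>\<mu>)"
    using assms by (intro integral_mono gaussian_density_mono_scaled) auto
  then show ?thesis by (simp add: u_altdef)
qed

text \<open>Integrates \<open>gaussian_density_shift\<close>: going back to half the time lets
  values at different points be compared, at an explicit Gaussian price in their distance.\<close>

lemma u_harnack:
  assumes "0 < a"
  shows "exp (- (norm (y - y'))\<^sup>2 / a) * u (a / 2) y' \<le> 2 powr (real CARD('n) / 2) * u a y"
proof -
  have "(\<integral>x. exp (- (norm (y - y'))\<^sup>2 / a) * gaussian_density (a / 2) (y' - x) \<partial>\<mu>)
      \<le> (\<integral>x. 2 powr (real CARD('n) / 2) * gaussian_density a (y - x) \<partial>\<mu>)"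
  proof (rule integral_mono)
    show "exp (- (norm (y - y'))\<^sup>2 / a) * gaussian_density (a / 2) (y' - x)
         \<le> 2 powr (real CARD('n) / 2) * gaussian_density a (y - x)" for x
      using gaussian_density_shift[OF assms, of "y - y'" "y' - x"] by simp
  qed (use assms in auto)
  then show ?thesis by (simp add: u_altdef)
qed

text \<open>Tonelli and a translation separate the starting point from the noise, so that later the
  noise can be rescaled for each starting point.\<close>

lemma nn_integral_u_mult:
  assumes t: "0 < t" and [measurable]: "f \<in> borel_measurable borel"
  shows "(\<integral>\<^sup>+y. ennreal (u t y) * f y \<partial>lborel)
    = (\<integral>\<^sup>+x. (\<integral>\<^sup>+z. ennreal (gaussian_density t z) * f (x + z) \<partial>lborel) \<partial>\<mu>)"
proof -
  interpret p: pair_sigma_finite \<mu> "lborel :: (real ^ 'n) measure" ..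
  have "(\<integral>\<^sup>+y. ennreal (u t y) * f y \<partial>lborel)
     = (\<integral>\<^sup>+y. (\<integral>\<^sup>+x. ennreal (gaussian_density t (y - x)) * f y \<partial>\<mu>) \<partial>lborel)"
    using t by (simp add: u_altdef nn_integral_multc nn_integral_eq_integral gaussian_density_nonneg)
  also have "\<dots> = (\<integral>\<^sup>+x. (\<integral>\<^sup>+y. ennreal (gaussian_density t (y - x)) * f y \<partial>lborel) \<partial>\<mu>)"
    by (rule p.Fubini') measurable
  also have "\<dots> = (\<integral>\<^sup>+x. (\<integral>\<^sup>+z. ennreal (gaussian_density t z) * f (x + z) \<partial>lborel) \<partial>\<mu>)"
  proof (rule nn_integral_cong)
    fix x
    have "(\<integral>\<^sup>+y. ennreal (gaussian_density t (y - x)) * f y \<partial>lborel) =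
        (\<integral>\<^sup>+y. ennreal (gaussian_density t (y - x)) * f y \<partial>distr lborel borel ((+) x))"
      by (simp only: lborel_distr_plus)
    then show "(\<integral>\<^sup>+y. ennreal (gaussian_density t (y - x)) * f y \<partial>lborel) =
       (\<integral>\<^sup>+z. ennreal (gaussian_density t z) * f (x + z) \<partial>lborel)"
      by (subst (asm) nn_integral_distr) simp_all
  qed
  finally show ?thesis .
qed

lemma nn_integral_u: "0 < t \<Longrightarrow> (\<integral>\<^sup>+y. ennreal (u t y) \<partial>lborel) = 1"
  using nn_integral_u_mult[of t "\<lambda>_. 1"] by (simp add: nn_integral_gaussian_density emeasure_space_1[simplified])

lemma integrable_u: "0 < t \<Longrightarrow> integrable lborel (u t)"
  by (rule integrableI_nonneg) (auto simp: u_nonneg nn_integral_u)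

end

section \<open>Differentiating expectations\<close>

text \<open>The integral of a function is invariant under translation, so differentiating the
  translated integral shows that the integral of a partial derivative vanishes.\<close>

lemma integral_partial_derivative_eq_0:
  fixes F F' :: "real ^ 'n \<Rightarrow> real"
  assumes F: "integrable lborel F"
    and deriv: "\<And>y s. ((\<lambda>s. F (y + s *\<^sub>R axis i 1)) has_real_derivative F' (y + s *\<^sub>R axis i 1)) (at s)"
    and bound: "\<And>y s. \<bar>s\<bar> < 1 \<Longrightarrow> \<bar>F' (y + s *\<^sub>R axis i 1)\<bar> \<le> g y"
    and g: "integrable lborel g"
  shows "(\<integral>y. F' y \<partial>lborel) = 0"
proof -
  have F_meas: "F \<in> borel_measurable borel" using F by auto
  have int: "integrable lborel (\<lambda>y. F (y + w))" and eq: "(\<integral>y. F (y + w) \<partial>lborel) = (\<integral>y. F y \<partial>lborel)" for w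
  proof -
    have "integrable (distr lborel borel ((+) w)) F" "(\<integral>y. F y \<partial>distr lborel borel ((+) w)) = (\<integral>y. F y \<partial>lborel)"
      using F by (simp_all only: lborel_distr_plus)
    then show "integrable lborel (\<lambda>y. F (y + w))" "(\<integral>y. F (y + w) \<partial>lborel) = (\<integral>y. F y \<partial>lborel)"
      using F_meas by (simp_all add: integrable_distr_eq integral_distr add.commute)
  qed
  have "((\<lambda>s. \<integral>y. F (y + s *\<^sub>R axis i 1) \<partial>lborel) has_real_derivative
     (\<integral>y. F' (y + 0 *\<^sub>R axis i 1) \<partial>lborel)) (at 0)"
    by (rule has_real_derivative_integral_dominated[where g=g and d=1])
      (use int deriv bound g in auto)
  then have "((\<lambda>s. \<integral>y. F y \<partial>lborel) has_real_derivative (\<integral>y. F' y \<partial>lborel)) (at 0)"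
    by (simp add: eq)
  then show ?thesis using DERIV_unique DERIV_const by blast
qed

section \<open>Functions of moderate growth\<close>

context heat_flow
begin

text \<open>The dominating function \<open>C * u c\<close> is integrable, and up to constants it absorbs bounded
  translations and changes of \<open>c\<close>.\<close>

definition moderate :: "(real \<Rightarrow> real ^ 'n \<Rightarrow> real) \<Rightarrow> bool" where
  "moderate f \<longleftrightarrow> (\<forall>t>0. f t \<in> borel_measurable borel) \<and>
     (\<forall>k a b. 0 < a \<longrightarrow> a \<le> b \<longrightarrow> (\<exists>C c. 0 \<le> C \<and> 0 < c \<and>
        (\<forall>t y. a \<le> t \<longrightarrow> t \<le> b \<longrightarrow> u t y * \<bar>f t y\<bar> ^ k \<le> C * u c y)))"

definition q :: "'n multiset \<Rightarrow> real \<Rightarrow> real ^ 'n \<Rightarrow> real" where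
  "q \<alpha> t y = D \<alpha> t y / u t y"

lemma moderate_measurable: "moderate f \<Longrightarrow> 0 < t \<Longrightarrow> f t \<in> borel_measurable borel"
  by (simp add: moderate_def)

lemma moderateE:
  assumes "moderate f" "0 < a" "a \<le> b"
  obtains C c where "0 \<le> C" "0 < c" "\<And>t y. a \<le> t \<Longrightarrow> t \<le> b \<Longrightarrow> u t y * \<bar>f t y\<bar> ^ k \<le> C * u c y"
  using assms unfolding moderate_def by meson

lemma u_combine:
  assumes "0 < c" "0 < c'"
  obtains E where "0 \<le> E" "\<And>y. u c y \<le> E * u (max c c') y" "\<And>y. u c' y \<le> E * u (max c c') y"
proof (rule that[of "(max c c' / c) powr (real CARD('n) / 2) + (max c c' / c') powr (real CARD('n) / 2)"])
  show "u c y \<le> ((max c c' / c) powr (real CARD('n) / 2) + (max c c' / c') powr (real CARD('n) / 2)) * u (max c c') y" for y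
    using u_mono_scaled[of c "max c c'" y] assms u_nonneg[of "max c c'" y]
      mult_right_mono[of "(max c c' / c) powr (real CARD('n) / 2)" "(max c c' / c) powr (real CARD('n) / 2) + (max c c' / c') powr (real CARD('n) / 2)" "u (max c c') y"]
    by (auto intro: order_trans)
  show "u c' y \<le> ((max c c' / c) powr (real CARD('n) / 2) + (max c c' / c') powr (real CARD('n) / 2)) * u (max c c') y" for y
    using u_mono_scaled[of c' "max c c'" y] assms u_nonneg[of "max c c'" y]
      mult_right_mono[of "(max c c' / c') powr (real CARD('n) / 2)" "(max c c' / c) powr (real CARD('n) / 2) + (max c c' / c') powr (real CARD('n) / 2)" "u (max c c') y"]
    by (auto intro: order_trans)
qed auto

text \<open>One scheme for sums and products: the dominating times of \<open>f\<close> and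
  \<open>g\<close> are merged into their maximum, which costs only a constant.\<close>

lemma moderateI2:
  assumes f: "moderate f" and g: "moderate g"
    and meas: "\<And>t. 0 < t \<Longrightarrow> h t \<in> borel_measurable borel"
    and bound: "\<And>k. \<exists>A k1 k2. 0 \<le> A \<and> (\<forall>t y. 0 < t \<longrightarrow> \<bar>h t y\<bar> ^ k \<le> A * (\<bar>f t y\<bar> ^ k1 + \<bar>g t y\<bar> ^ k2))"
  shows "moderate h"
  unfolding moderate_def
proof (intro conjI allI impI meas)
  fix k :: nat and a b :: real assume ab: "0 < a" "a \<le> b"
  obtain A k1 k2 where A: "0 \<le> A" "\<And>t y. 0 < t \<Longrightarrow> \<bar>h t y\<bar> ^ k \<le> A * (\<bar>f t y\<bar> ^ k1 + \<bar>g t y\<bar> ^ k2)"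
    using bound by blast
  obtain C1 c1 where 1: "0 \<le> C1" "0 < c1" "\<And>t y. a \<le> t \<Longrightarrow> t \<le> b \<Longrightarrow> u t y * \<bar>f t y\<bar> ^ k1 \<le> C1 * u c1 y"
    by (rule moderateE[OF f ab]) blast
  obtain C2 c2 where 2: "0 \<le> C2" "0 < c2" "\<And>t y. a \<le> t \<Longrightarrow> t \<le> b \<Longrightarrow> u t y * \<bar>g t y\<bar> ^ k2 \<le> C2 * u c2 y"
    by (rule moderateE[OF g ab]) blast
  obtain E where E: "0 \<le> E" "\<And>y. u c1 y \<le> E * u (max c1 c2) y" "\<And>y. u c2 y \<le> E * u (max c1 c2) y"
    by (rule u_combine[OF 1(2) 2(2)]) blast
  show "\<exists>C c. 0 \<le> C \<and> 0 < c \<and> (\<forall>t y. a \<le> t \<longrightarrow> t \<le> b \<longrightarrow> u t y * \<bar>h t y\<bar> ^ k \<le> C * u c y)"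
  proof (intro exI conjI allI impI)
    show "0 \<le> A * (C1 * E + C2 * E)" using A 1 2 E by simp
    show "0 < max c1 c2" using 1 by simp
    fix t y assume t: "a \<le> t" "t \<le> b"
    have "u t y * \<bar>h t y\<bar> ^ k \<le> u t y * (A * (\<bar>f t y\<bar> ^ k1 + \<bar>g t y\<bar> ^ k2))"
      using A(2)[of t y] t ab by (intro mult_left_mono u_nonneg) auto
    also have "\<dots> = A * (u t y * \<bar>f t y\<bar> ^ k1 + u t y * \<bar>g t y\<bar> ^ k2)" by (simp add: algebra_simps)
    also have "\<dots> \<le> A * (C1 * u c1 y + C2 * u c2 y)"
      using A t by (intro mult_left_mono add_mono 1 2) auto
    also have "\<dots> \<le> A * (C1 * (E * u (max c1 c2) y) + C2 * (E * u (max c1 c2) y))"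
      using A 1 2 E by (intro mult_left_mono add_mono) auto
    finally show "u t y * \<bar>h t y\<bar> ^ k \<le> A * (C1 * E + C2 * E) * u (max c1 c2) y"
      by (simp add: algebra_simps)
  qed
qed

lemma moderate_add:
  assumes "moderate f" "moderate g"
  shows "moderate (\<lambda>t y. f t y + g t y)"
proof (rule moderateI2[OF assms])
  show "\<exists>A k1 k2. 0 \<le> A \<and> (\<forall>t y. 0 < t \<longrightarrow> \<bar>f t y + g t y\<bar> ^ k \<le> A * (\<bar>f t y\<bar> ^ k1 + \<bar>g t y\<bar> ^ k2))" for k
  proof (intro exI[of _ "(2 :: real) ^ k"] exI[of _ k] conjI allI impI)
    fix t y
    have "\<bar>f t y + g t y\<bar> ^ k \<le> (2 * max \<bar>f t y\<bar> \<bar>g t y\<bar>) ^ k"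
      by (intro power_mono) auto
    also have "\<dots> = 2 ^ k * max \<bar>f t y\<bar> \<bar>g t y\<bar> ^ k"
      by (simp add: power_mult_distrib)
    also have "\<dots> \<le> 2 ^ k * (\<bar>f t y\<bar> ^ k + \<bar>g t y\<bar> ^ k)"
      by (intro mult_left_mono) (auto simp: max_def)
    finally show "\<bar>f t y + g t y\<bar> ^ k \<le> 2 ^ k * (\<bar>f t y\<bar> ^ k + \<bar>g t y\<bar> ^ k)" .
  qed simp
  show "(\<lambda>y. f t y + g t y) \<in> borel_measurable borel" if "0 < t" for t
    using moderate_measurable[OF assms(1) that] moderate_measurable[OF assms(2) that] by (rule borel_measurable_add)
qed

text \<open>Uses |f g|^k \<le> |f|^(2k) + |g|^(2k). This doubling of the exponent is why
  \<open>moderate\<close> quantifies over all powers: a bound on the first power alone would not be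
  stable under products.\<close>

lemma moderate_mult:
  assumes "moderate f" "moderate g"
  shows "moderate (\<lambda>t y. f t y * g t y)"
proof (rule moderateI2[OF assms])
  show "\<exists>A k1 k2. 0 \<le> A \<and> (\<forall>t y. 0 < t \<longrightarrow> \<bar>f t y * g t y\<bar> ^ k \<le> A * (\<bar>f t y\<bar> ^ k1 + \<bar>g t y\<bar> ^ k2))" for k
  proof (intro exI[of _ "1 :: real"] exI[of _ "2 * k"] conjI allI impI)
    fix t y
    have "0 \<le> \<bar>f t y\<bar> ^ k * \<bar>g t y\<bar> ^ k" by simp
    then have "\<bar>f t y\<bar> ^ k * \<bar>g t y\<bar> ^ k \<le> (\<bar>f t y\<bar> ^ k)\<^sup>2 + (\<bar>g t y\<bar> ^ k)\<^sup>2"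
      using sum_squares_bound[of "\<bar>f t y\<bar> ^ k" "\<bar>g t y\<bar> ^ k"] by linarith
    then show "\<bar>f t y * g t y\<bar> ^ k \<le> 1 * (\<bar>f t y\<bar> ^ (2 * k) + \<bar>g t y\<bar> ^ (2 * k))"
      by (simp add: abs_mult power_mult_distrib power_mult[symmetric] mult.commute)
  qed simp
  show "(\<lambda>y. f t y * g t y) \<in> borel_measurable borel" if "0 < t" for t
    using moderate_measurable[OF assms(1) that] moderate_measurable[OF assms(2) that] by (rule borel_measurable_times)
qed

lemma moderate_const: "moderate (\<lambda>t y. c)"
  unfolding moderate_def
proof (intro conjI allI impI)
  fix k :: nat and a b :: real assume ab: "0 < a" "a \<le> b"
  show "\<exists>C c'. 0 \<le> C \<and> 0 < c' \<and> (\<forall>t y. a \<le> t \<longrightarrow> t \<le> b \<longrightarrow> u t y * \<bar>c\<bar> ^ k \<le> C * u c' y)"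
  proof (intro exI conjI allI impI)
    show "0 < b" using ab by simp
    show "0 \<le> (b / a) powr (real CARD('n) / 2) * \<bar>c\<bar> ^ k" using ab by simp
    fix t y assume t: "a \<le> t" "t \<le> b"
    have "u t y \<le> (b / t) powr (real CARD('n) / 2) * u b y"
      using t ab by (intro u_mono_scaled) auto
    also have "\<dots> \<le> (b / a) powr (real CARD('n) / 2) * u b y"
      using t ab by (intro mult_right_mono powr_mono2 u_nonneg frac_le) auto
    finally show "u t y * \<bar>c\<bar> ^ k \<le> (b / a) powr (real CARD('n) / 2) * \<bar>c\<bar> ^ k * u b y"
      using mult_right_mono[of "u t y" "(b / a) powr (real CARD('n) / 2) * u b y" "\<bar>c\<bar> ^ k"]
      by (simp add: mult_ac)
  qed
qed simp

lemma moderate_uminus: "moderate f \<Longrightarrow> moderate (\<lambda>t y. - f t y)"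
  using moderate_mult[OF moderate_const[of "-1"], of f] by simp

lemma moderate_diff: "moderate f \<Longrightarrow> moderate g \<Longrightarrow> moderate (\<lambda>t y. f t y - g t y)"
  using moderate_add[OF _ moderate_uminus, of f g] by simp

lemma moderate_divide: "moderate f \<Longrightarrow> moderate (\<lambda>t y. f t y / c)"
  using moderate_mult[OF _ moderate_const[of "inverse c"], of f] by (simp add: divide_inverse)

lemma moderate_power: "moderate f \<Longrightarrow> moderate (\<lambda>t y. f t y ^ m)"
  by (induction m) (auto intro: moderate_const moderate_mult)

lemma moderate_abs: "moderate f \<Longrightarrow> moderate (\<lambda>t y. \<bar>f t y\<bar>)"
  by (simp add: moderate_def borel_measurable_abs)

lemma moderate_sum: "(\<And>i. i \<in> I \<Longrightarrow> moderate (f i)) \<Longrightarrow> moderate (\<lambda>t y. \<Sum>i\<in>I. f i t y)"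
  by (induction I rule: infinite_finite_induct) (auto intro: moderate_const moderate_add)

text \<open>Jensen's inequality for the posterior law of the starting point given the end point.\<close>

lemma moderate_q: "moderate (q \<alpha>)"
  unfolding moderate_def
proof (intro conjI allI impI)
  show "q \<alpha> t \<in> borel_measurable borel" for t unfolding q_def by measurable
  fix k :: nat and a b :: real assume ab: "0 < a" "a \<le> b"
  obtain C where C: "0 < C" "\<And>t (z :: real ^ 'n). a \<le> t \<Longrightarrow> t \<le> b \<Longrightarrow>
      \<bar>hpoly \<alpha> t z\<bar> ^ k * gaussian_density t z \<le> C * gaussian_density (2 * b) z"
    by (rule kern_power_bound[OF ab]) blast
  show "\<exists>C c. 0 \<le> C \<and> 0 < c \<and> (\<forall>t y. a \<le> t \<longrightarrow> t \<le> b \<longrightarrow> u t y * \<bar>q \<alpha> t y\<bar> ^ k \<le> C * u c y)"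
  proof (intro exI conjI allI impI)
    show "0 \<le> C" "0 < 2 * b" using C ab by auto
    fix t y assume t: "a \<le> t" "t \<le> b"
    then have t0: "0 < t" using ab by simp
    define h g where "h x = \<bar>hpoly \<alpha> t (y - x)\<bar>" and "g x = gaussian_density t (y - x)" for x
    \<comment> \<open>The posterior mean of \<open>h\<close>, the point at which the tangent to the
      power is taken.\<close>
    define c where "c = (\<integral>x. h x * g x \<partial>\<mu>) / u t y"
    have u: "0 < u t y" using u_pos t0 by simp
    have [measurable]: "h \<in> borel_measurable borel" "g \<in> borel_measurable borel"
      unfolding h_def g_def by measurable
    have ig: "integrable \<mu> g" unfolding g_def using t0 by simp
    have ih: "integrable \<mu> (\<lambda>x. h x * g x)"
      using integrable_kern[OF t0, of \<alpha> y, THEN integrable_abs]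
      by (simp add: kern_def h_def g_def abs_mult gaussian_density_nonneg)
    have ihk: "integrable \<mu> (\<lambda>x. h x ^ k * g x)"
    proof (rule Bochner_Integration.integrable_bound)
      show "integrable \<mu> (\<lambda>x. C * gaussian_density (2 * b) (y - x))" using ab by auto
      show "AE x in \<mu>. norm (h x ^ k * g x) \<le> norm (C * gaussian_density (2 * b) (y - x))"
        using C t by (intro AE_I2) (auto simp: h_def g_def abs_mult gaussian_density_nonneg)
    qed measurable
    have c: "0 \<le> c" unfolding c_def
      using u by (intro divide_nonneg_pos Bochner_Integration.integral_nonneg) (auto simp: h_def g_def gaussian_density_nonneg)
    have gu: "(\<integral>x. g x \<partial>\<mu>) = u t y" by (simp add: g_def u_altdef)
    have "\<bar>D \<alpha> t y\<bar> \<le> (\<integral>x. h x * g x \<partial>\<mu>)"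
      unfolding D_def kern_def h_def g_def
      using integral_abs_bound[of \<mu> "\<lambda>x. hpoly \<alpha> t (y - x) * gaussian_density t (y - x)"]
      by (simp add: abs_mult gaussian_density_nonneg)
    then have qc: "\<bar>q \<alpha> t y\<bar> \<le> c" using u by (simp add: q_def c_def divide_right_mono)
    have "u t y * \<bar>q \<alpha> t y\<bar> ^ k \<le> u t y * c ^ k"
      using u qc by (intro mult_left_mono power_mono) auto
    \<comment> \<open>The added linear term is zero, because the integral of
      \<open>h x * g x\<close> equals \<open>c * u t y\<close>.\<close>
    also have "\<dots> = c ^ k * u t y + real k * c ^ (k - 1) * ((\<integral>x. h x * g x \<partial>\<mu>) - c * u t y)"
      using u by (simp add: c_def)
    also have "\<dots> = (\<integral>x. c ^ k * g x + real k * c ^ (k - 1) * (h x * g x - c * g x) \<partial>\<mu>)"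
      using ig ih by (simp add: gu)
    also have "\<dots> \<le> (\<integral>x. h x ^ k * g x \<partial>\<mu>)"
    proof (rule integral_mono)
      show "integrable \<mu> (\<lambda>x. c ^ k * g x + real k * c ^ (k - 1) * (h x * g x - c * g x))"
        using ig ih by simp
      show "c ^ k * g x + real k * c ^ (k - 1) * (h x * g x - c * g x) \<le> h x ^ k * g x" for x
        using mult_right_mono[OF power_tangent[of "h x" c k], of "g x"] c
        by (simp add: h_def g_def gaussian_density_nonneg algebra_simps)
    qed (fact ihk)
    also have "\<dots> \<le> (\<integral>x. C * gaussian_density (2 * b) (y - x) \<partial>\<mu>)"
      using C t ab by (intro integral_mono ihk) (auto simp: h_def g_def)
    also have "\<dots> = C * u (2 * b) y" by (simp add: u_altdef)
    finally show "u t y * \<bar>q \<alpha> t y\<bar> ^ k \<le> C * u (2 * b) y" .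
  qed
qed

lemmas moderate_intros = moderate_add moderate_mult moderate_const moderate_uminus moderate_diff
  moderate_divide moderate_power moderate_sum moderate_q

lemma integrable_moderate:
  assumes f: "moderate f" and t: "0 < t"
  shows "integrable lborel (\<lambda>y. u t y * f t y)"
proof -
  obtain C c where C: "0 \<le> C" "0 < c" "\<And>s y. t \<le> s \<Longrightarrow> s \<le> t \<Longrightarrow> u s y * \<bar>f s y\<bar> ^ 1 \<le> C * u c y"
    by (rule moderateE[OF f t order_refl]) blast
  note [measurable] = moderate_measurable[OF f t]
  show ?thesis
    by (rule Bochner_Integration.integrable_bound[OF integrable_mult_right[OF integrable_u[OF C(2)], of C]])
      (use C in \<open>auto simp: abs_mult u_nonneg\<close>)
qed

section \<open>Differentiating the quotients and expectations\<close>

lemma has_derivative_q_space: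
  assumes t: "0 < t"
  shows "((\<lambda>s. q \<alpha> t (y + s *\<^sub>R axis i 1)) has_real_derivative
     q (add_mset i \<alpha>) t (y + s *\<^sub>R axis i 1) - q \<alpha> t (y + s *\<^sub>R axis i 1) * q {#i#} t (y + s *\<^sub>R axis i 1)) (at s)"
proof -
  have u: "u t (y + s *\<^sub>R axis i 1) \<noteq> 0" using u_pos[OF t, of "y + s *\<^sub>R axis i 1"] by simp
  show ?thesis unfolding q_def
    using DERIV_divide[OF has_derivative_D_space[OF t, where \<alpha>=\<alpha> and y=y and i=i and s=s]
        has_derivative_D_space[OF t, where \<alpha>="{#}" and y=y and i=i and s=s] u] u
    by (simp add: diff_divide_distrib)
qed

lemma has_derivative_q_time:
  assumes t: "0 < t"
  shows "((\<lambda>t. q \<alpha> t y) has_real_derivative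
     (\<Sum>j\<in>UNIV. q (add_mset j (add_mset j \<alpha>)) t y - q \<alpha> t y * q {#j, j#} t y) / 2) (at t)"
proof -
  have u: "u t y \<noteq> 0" using u_pos[OF t, of y] by simp
  have "((\<lambda>t. D \<alpha> t y / u t y) has_real_derivative
     ((\<Sum>j\<in>UNIV. D (add_mset j (add_mset j \<alpha>)) t y) / 2 * u t y - D \<alpha> t y * ((\<Sum>j\<in>UNIV. D {#j, j#} t y) / 2)) /
       (u t y * u t y)) (at t)"
    by (rule DERIV_divide[OF has_derivative_D_time[OF t] has_derivative_D_time[OF t] u])
  also have "((\<Sum>j\<in>UNIV. D (add_mset j (add_mset j \<alpha>)) t y) / 2 * u t y - D \<alpha> t y * ((\<Sum>j\<in>UNIV. D {#j, j#} t y) / 2)) /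
       (u t y * u t y) = (\<Sum>j\<in>UNIV. q (add_mset j (add_mset j \<alpha>)) t y - q \<alpha> t y * q {#j, j#} t y) / 2"
  proof -
    have "(\<Sum>j\<in>UNIV. q (add_mset j (add_mset j \<alpha>)) t y - q \<alpha> t y * q {#j, j#} t y)
      = (\<Sum>j\<in>UNIV. D (add_mset j (add_mset j \<alpha>)) t y) / u t y - q \<alpha> t y * ((\<Sum>j\<in>UNIV. D {#j, j#} t y) / u t y)"
      by (simp add: q_def sum_subtractf sum_divide_distrib sum_distrib_left)
    then show ?thesis using u by (simp add: q_def diff_divide_distrib)
  qed
  finally show ?thesis by (simp add: q_def)
qed

text \<open>By the heat equation the time derivative of \<open>u\<close> is \<open>u\<close> times
  half the sum of the \<open>q {#j, j#}\<close>, so the derivative is again an expectation of a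
  moderate function and the step can be iterated.\<close>

theorem has_derivative_expectation_time:
  assumes f: "moderate f" and g: "moderate g" and t: "0 < t"
    and deriv: "\<And>t y. 0 < t \<Longrightarrow> ((\<lambda>t. f t y) has_real_derivative g t y) (at t)"
  shows "((\<lambda>t. \<integral>y. u t y * f t y \<partial>lborel) has_real_derivative
     (\<integral>y. u t y * ((\<Sum>j\<in>UNIV. q {#j, j#} t y) / 2 * f t y + g t y) \<partial>lborel)) (at t)"
proof -
  define h where "h t y = (\<Sum>j\<in>UNIV. q {#j, j#} t y) / 2 * f t y + g t y" for t y
  have h: "moderate h" unfolding h_def by (intro moderate_intros f g)
  obtain C c where C: "0 \<le> C" "0 < c" "\<And>s y. t / 2 \<le> s \<Longrightarrow> s \<le> 2 * t \<Longrightarrow> u s y * \<bar>h s y\<bar> ^ 1 \<le> C * u c y"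
    by (rule moderateE[OF h, of "t / 2" "2 * t" 1]) (use t in auto)
  show ?thesis
  proof (rule has_real_derivative_integral_dominated[where g="\<lambda>y. C * u c y" and d="t / 2"
        and f'="\<lambda>t y. u t y * ((\<Sum>j\<in>UNIV. q {#j, j#} t y) / 2 * f t y + g t y)"])
    fix s y assume "\<bar>s - t\<bar> < t / 2"
    then have s: "t / 2 \<le> s" "s \<le> 2 * t" unfolding abs_less_iff by linarith+
    then have s0: "0 < s" using t by linarith
    show "integrable lborel (\<lambda>y. u s y * f s y)" by (rule integrable_moderate[OF f s0])
    show "((\<lambda>s. u s y * f s y) has_real_derivative
       u s y * ((\<Sum>j\<in>UNIV. q {#j, j#} s y) / 2 * f s y + g s y)) (at s)"
    proof -
      define p p' where "p = u s y" and "p' = (\<Sum>j\<in>UNIV. D {#j, j#} s y)"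
      have "p * (p' / p / 2 * f s y + g s y) = p' / 2 * f s y + g s y * p"
        using u_pos[OF s0, of y] by (simp add: p_def distrib_left mult.commute)
      then show ?thesis unfolding q_def p_def p'_def sum_divide_distrib[symmetric]
        using DERIV_mult[OF has_derivative_D_time[OF s0, where \<alpha>="{#}" and y=y] deriv[OF s0, of y]] by simp
    qed
    show "\<bar>u s y * ((\<Sum>j\<in>UNIV. q {#j, j#} s y) / 2 * f s y + g s y)\<bar> \<le> C * u c y"
      using C(3)[OF s, of y] by (simp add: h_def abs_mult u_nonneg)
  qed (use t C integrable_u in auto)
qed

text \<open>The Harnack inequality at distance less than one: a translation is paid for with a
  constant and a doubled time.\<close>

lemma u_shift_le:
  assumes "0 < c" "\<bar>s\<bar> < 1"
  shows "u c (y + s *\<^sub>R axis i 1) \<le> exp (1 / (2 * c)) * 2 powr (real CARD('n) / 2) * u (2 * c) y"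
proof -
  have "s\<^sup>2 \<le> 1" using assms by (simp add: abs_square_le_1 less_imp_le)
  then have s: "exp (- (1 / (2 * c))) \<le> exp (- s\<^sup>2 / (2 * c))" using assms by (simp add: divide_right_mono)
  have "exp (- (1 / (2 * c))) * u c (y + s *\<^sub>R axis i 1) \<le> exp (- s\<^sup>2 / (2 * c)) * u c (y + s *\<^sub>R axis i 1)"
    by (intro mult_right_mono s u_nonneg)
  also have "\<dots> \<le> 2 powr (real CARD('n) / 2) * u (2 * c) y"
    using u_harnack[of "2 * c" y "y + s *\<^sub>R axis i 1"] assms by (simp add: norm_axis_1)
  finally have "exp (1 / (2 * c)) * (exp (- (1 / (2 * c))) * u c (y + s *\<^sub>R axis i 1))
      \<le> exp (1 / (2 * c)) * (2 powr (real CARD('n) / 2) * u (2 * c) y)"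
    by (intro mult_left_mono) auto
  then show ?thesis by (simp flip: exp_add mult.assoc)
qed

text \<open>The integrand is the partial derivative of \<open>u * f\<close>, because
  \<open>q {#i#}\<close> is the logarithmic derivative of \<open>u\<close>.\<close>

theorem expectation_divergence:
  assumes f: "moderate f" and g: "moderate g" and t: "0 < t"
    and deriv: "\<And>y s. ((\<lambda>s. f t (y + s *\<^sub>R axis i 1)) has_real_derivative g t (y + s *\<^sub>R axis i 1)) (at s)"
  shows "(\<integral>y. u t y * (q {#i#} t y * f t y + g t y) \<partial>lborel) = 0"
proof -
  define h where "h t y = q {#i#} t y * f t y + g t y" for t y
  have h: "moderate h" unfolding h_def by (intro moderate_intros f g)
  obtain C c where C: "0 \<le> C" "0 < c" "\<And>s y. t \<le> s \<Longrightarrow> s \<le> t \<Longrightarrow> u s y * \<bar>h s y\<bar> ^ 1 \<le> C * u c y"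
    by (rule moderateE[OF h t order_refl]) blast
  show ?thesis
  proof (rule integral_partial_derivative_eq_0[where F="\<lambda>y. u t y * f t y" and i=i and
        g="\<lambda>y. C * (exp (1 / (2 * c)) * 2 powr (real CARD('n) / 2) * u (2 * c) y)"])
    show "integrable lborel (\<lambda>y. u t y * f t y)" by (rule integrable_moderate[OF f t])
    show "integrable lborel (\<lambda>y. C * (exp (1 / (2 * c)) * 2 powr (real CARD('n) / 2) * u (2 * c) y))"
      using C by (intro integrable_mult_right integrable_u) auto
    fix y s
    show "((\<lambda>s. u t (y + s *\<^sub>R axis i 1) * f t (y + s *\<^sub>R axis i 1)) has_real_derivative
       u t (y + s *\<^sub>R axis i 1) * (q {#i#} t (y + s *\<^sub>R axis i 1) * f t (y + s *\<^sub>R axis i 1) + g t (y + s *\<^sub>R axis i 1))) (at s)"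
    proof -
      define p p' where "p = u t (y + s *\<^sub>R axis i 1)" and "p' = D {#i#} t (y + s *\<^sub>R axis i 1)"
      have "p * (p' / p * f t (y + s *\<^sub>R axis i 1) + g t (y + s *\<^sub>R axis i 1))
          = p' * f t (y + s *\<^sub>R axis i 1) + g t (y + s *\<^sub>R axis i 1) * p"
        using u_pos[OF t, of "y + s *\<^sub>R axis i 1"] by (simp add: p_def distrib_left mult.commute)
      then show ?thesis unfolding q_def p_def p'_def
        using DERIV_mult[OF has_derivative_D_space[OF t, where \<alpha>="{#}" and y=y and i=i and s=s] deriv[of y s]] by simp
    qed
    assume s: "\<bar>s\<bar> < 1"
    have "\<bar>u t (y + s *\<^sub>R axis i 1) * (q {#i#} t (y + s *\<^sub>R axis i 1) * f t (y + s *\<^sub>R axis i 1) + g t (y + s *\<^sub>R axis i 1))\<bar>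
        \<le> C * u c (y + s *\<^sub>R axis i 1)"
      using C(3)[OF order_refl order_refl, of "y + s *\<^sub>R axis i 1"]
      unfolding h_def abs_mult power_one_right by (simp only: abs_of_nonneg[OF u_nonneg])
    also have "\<dots> \<le> C * (exp (1 / (2 * c)) * 2 powr (real CARD('n) / 2) * u (2 * c) y)"
      using C s by (intro mult_left_mono u_shift_le) auto
    finally show "\<bar>u t (y + s *\<^sub>R axis i 1) * (q {#i#} t (y + s *\<^sub>R axis i 1) * f t (y + s *\<^sub>R axis i 1) + g t (y + s *\<^sub>R axis i 1))\<bar>
       \<le> C * (exp (1 / (2 * c)) * 2 powr (real CARD('n) / 2) * u (2 * c) y)" .
  qed
qed

end

section \<open>The dissipation identities\<close>

context heat_flow
begin

text \<open>Differentiation as a relation: the derivative of a composite tensor is assembled by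
  resolution with the rules and then brought to the desired form by \<open>pd_cong\<close>. The same
  holds for \<open>td\<close> and time derivatives.\<close>

definition pd :: "'n \<Rightarrow> (real \<Rightarrow> real ^ 'n \<Rightarrow> real) \<Rightarrow> (real \<Rightarrow> real ^ 'n \<Rightarrow> real) \<Rightarrow> bool" where
  "pd i f g \<longleftrightarrow> (\<forall>t>0. \<forall>y s. ((\<lambda>s. f t (y + s *\<^sub>R axis i 1)) has_real_derivative g t (y + s *\<^sub>R axis i 1)) (at s))"

definition td :: "(real \<Rightarrow> real ^ 'n \<Rightarrow> real) \<Rightarrow> (real \<Rightarrow> real ^ 'n \<Rightarrow> real) \<Rightarrow> bool" where
  "td f g \<longleftrightarrow> (\<forall>t>0. \<forall>y. ((\<lambda>t. f t y) has_real_derivative g t y) (at t))"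

lemma pd_cong: "pd i f g \<Longrightarrow> (\<And>t y. g t y = h t y) \<Longrightarrow> pd i f h"
  by (simp add: pd_def)

lemma td_cong: "td f g \<Longrightarrow> (\<And>t y. g t y = h t y) \<Longrightarrow> td f h"
  by (simp add: td_def)

lemma pd_const: "pd i (\<lambda>t y. c) (\<lambda>t y. 0)"
  by (simp add: pd_def)

lemma pd_add: "pd i f f' \<Longrightarrow> pd i g g' \<Longrightarrow> pd i (\<lambda>t y. f t y + g t y) (\<lambda>t y. f' t y + g' t y)"
  unfolding pd_def by (auto intro!: DERIV_add)

lemma pd_diff: "pd i f f' \<Longrightarrow> pd i g g' \<Longrightarrow> pd i (\<lambda>t y. f t y - g t y) (\<lambda>t y. f' t y - g' t y)"
  unfolding pd_def by (auto intro!: DERIV_diff)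

lemma pd_mult: "pd i f f' \<Longrightarrow> pd i g g' \<Longrightarrow> pd i (\<lambda>t y. f t y * g t y) (\<lambda>t y. f' t y * g t y + f t y * g' t y)"
  unfolding pd_def by (auto intro!: DERIV_mult' simp: add.commute)

lemma pd_sum: "(\<And>j. j \<in> J \<Longrightarrow> pd i (f j) (f' j)) \<Longrightarrow> pd i (\<lambda>t y. \<Sum>j\<in>J. f j t y) (\<lambda>t y. \<Sum>j\<in>J. f' j t y)"
  unfolding pd_def by (auto intro!: DERIV_sum)

lemma td_diff: "td f f' \<Longrightarrow> td g g' \<Longrightarrow> td (\<lambda>t y. f t y - g t y) (\<lambda>t y. f' t y - g' t y)"
  unfolding td_def by (auto intro!: DERIV_diff)

lemma td_mult: "td f f' \<Longrightarrow> td g g' \<Longrightarrow> td (\<lambda>t y. f t y * g t y) (\<lambda>t y. f' t y * g t y + f t y * g' t y)"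
  unfolding td_def by (auto intro!: DERIV_mult' simp: add.commute)

lemma td_sum: "(\<And>j. j \<in> J \<Longrightarrow> td (f j) (f' j)) \<Longrightarrow> td (\<lambda>t y. \<Sum>j\<in>J. f j t y) (\<lambda>t y. \<Sum>j\<in>J. f' j t y)"
  unfolding td_def by (auto intro!: DERIV_sum)

lemma pd_q: "pd i (q \<alpha>) (\<lambda>t y. q (add_mset i \<alpha>) t y - q \<alpha> t y * q {#i#} t y)"
  unfolding pd_def using has_derivative_q_space by blast

lemma td_q: "td (q \<alpha>) (\<lambda>t y. (\<Sum>j\<in>UNIV. q (add_mset j (add_mset j \<alpha>)) t y - q \<alpha> t y * q {#j, j#} t y) / 2)"
  unfolding td_def using has_derivative_q_time by blast

text \<open>The partial derivatives of \<open>ln u\<close> up to order four.\<close>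

definition v :: "'n \<Rightarrow> real \<Rightarrow> real ^ 'n \<Rightarrow> real" where
  "v i = q {#i#}"

definition A :: "'n \<Rightarrow> 'n \<Rightarrow> real \<Rightarrow> real ^ 'n \<Rightarrow> real" where
  "A i j t y = q {#i, j#} t y - v i t y * v j t y"

definition B :: "'n \<Rightarrow> 'n \<Rightarrow> 'n \<Rightarrow> real \<Rightarrow> real ^ 'n \<Rightarrow> real" where
  "B i j k t y = q {#i, j, k#} t y - v i t y * q {#j, k#} t y - v j t y * q {#i, k#} t y
     - v k t y * q {#i, j#} t y + 2 * v i t y * v j t y * v k t y"

text \<open>The moment-cumulant formula with the \<open>q\<close>'s as moments: a partition into m
  blocks has coefficient (-1)^(m-1) (m-1)!. In this form \<open>moderate\<close> is immediate, and
  so are the symmetries in the indices.\<close>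

definition E :: "'n \<Rightarrow> 'n \<Rightarrow> 'n \<Rightarrow> 'n \<Rightarrow> real \<Rightarrow> real ^ 'n \<Rightarrow> real" where
  "E i j k l t y = q {#i, j, k, l#} t y
     - v i t y * q {#j, k, l#} t y - v j t y * q {#i, k, l#} t y
     - v k t y * q {#i, j, l#} t y - v l t y * q {#i, j, k#} t y
     - q {#i, j#} t y * q {#k, l#} t y - q {#i, k#} t y * q {#j, l#} t y - q {#i, l#} t y * q {#j, k#} t y
     + 2 * (v i t y * v j t y * q {#k, l#} t y + v i t y * v k t y * q {#j, l#} t y
       + v i t y * v l t y * q {#j, k#} t y + v j t y * v k t y * q {#i, l#} t y
       + v j t y * v l t y * q {#i, k#} t y + v k t y * v l t y * q {#i, j#} t y)
     - 6 * v i t y * v j t y * v k t y * v l t y"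

lemma A_sym: "A i j t y = A j i t y"
  by (simp add: A_def add_mset_commute)

lemma B_sym: "B i j k t y = B j i k t y" "B i j k t y = B i k j t y"
  by (simp_all add: B_def add_mset_commute)

lemma E_sym: "E i j k l t y = E j i k l t y" "E i j k l t y = E i k j l t y" "E i j k l t y = E i j l k t y"
  by (simp_all add: E_def add_mset_commute)

lemma pd_v: "pd i (v j) (A j i)"
  unfolding v_def by (rule pd_cong[OF pd_q]) (simp add: A_def v_def add_mset_commute)

lemma pd_A: "pd k (A i j) (B i j k)"
  unfolding A_def[abs_def]
  by (rule pd_cong, (rule pd_diff pd_mult pd_q pd_v)+)
    (simp add: A_def B_def v_def add_mset_commute algebra_simps)

lemma pd_B: "pd l (B i j k) (E i j k l)"
  unfolding B_def[abs_def]
  by (rule pd_cong, (rule pd_diff pd_add pd_mult pd_q pd_v pd_const)+)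
    (simp add: A_def E_def v_def add_mset_commute algebra_simps)

lemma q2: "q {#i, j#} t y = A i j t y + v i t y * v j t y"
  by (simp add: A_def)

text \<open>The time derivative of ln u is half of its Laplacian plus half of its squared gradient;
  this is one spatial derivative of that equation.\<close>

lemma td_v: "td (v i) (\<lambda>t y. \<Sum>j\<in>UNIV. B i j j t y / 2 + v j t y * A i j t y)"
  unfolding v_def
  by (rule td_cong[OF td_q])
    (simp add: sum_divide_distrib A_def B_def v_def add_mset_commute field_simps)

text \<open>Two spatial derivatives of the same equation for ln u; verified by expansion into the
  \<open>q\<close>'s.\<close>

lemma td_A: "td (A i j) (\<lambda>t y. \<Sum>k\<in>UNIV. E i j k k t y / 2 + A i k t y * A j k t y + v k t y * B i j k t y)"
proof -
  have "td (\<lambda>t y. q {#i, j#} t y - q {#i#} t y * q {#j#} t y) (\<lambda>t y. 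
     (\<Sum>k\<in>UNIV. q {#k, k, i, j#} t y - q {#i, j#} t y * q {#k, k#} t y) / 2
     - ((\<Sum>k\<in>UNIV. q {#k, k, i#} t y - q {#i#} t y * q {#k, k#} t y) / 2 * q {#j#} t y
       + q {#i#} t y * ((\<Sum>k\<in>UNIV. q {#k, k, j#} t y - q {#j#} t y * q {#k, k#} t y) / 2)))"
    by (intro td_diff td_mult td_q)
  then show ?thesis unfolding A_def[abs_def] v_def
    apply (rule td_cong)
    unfolding sum_divide_distrib sum_distrib_left sum_distrib_right sum_subtractf[symmetric] sum.distrib[symmetric]
    by (rule sum.cong) (simp_all add: B_def E_def v_def add_mset_commute field_simps)
qed

lemma moderate_v: "moderate (v i)"
  unfolding v_def by (rule moderate_q)

lemma moderate_A: "moderate (A i j)"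
  unfolding A_def[abs_def] by (intro moderate_intros moderate_v)

lemma moderate_B: "moderate (B i j k)"
  unfolding B_def[abs_def] by (intro moderate_intros moderate_v)

lemma moderate_E: "moderate (E i j k l)"
  unfolding E_def[abs_def] by (intro moderate_intros moderate_v)

section \<open>Contractions, named by their factors; \<open>a\<close> is the Laplacian of ln u and
  \<open>b\<close> its gradient\<close>

definition a where "a t y = (\<Sum>i\<in>UNIV. A i i t y)"
definition r where "r t y = (\<Sum>i\<in>UNIV. v i t y * v i t y)"
definition w where "w i t y = (\<Sum>j\<in>UNIV. A i j t y * v j t y)"
definition b where "b i t y = (\<Sum>j\<in>UNIV. B i j j t y)"
definition vw where "vw t y = (\<Sum>i\<in>UNIV. v i t y * w i t y)"
definition vb where "vb t y = (\<Sum>i\<in>UNIV. v i t y * b i t y)"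
definition ww where "ww t y = (\<Sum>i\<in>UNIV. w i t y * w i t y)"
definition bw where "bw t y = (\<Sum>i\<in>UNIV. b i t y * w i t y)"
definition bb where "bb t y = (\<Sum>i\<in>UNIV. b i t y * b i t y)"
definition AA where "AA t y = (\<Sum>i\<in>UNIV. \<Sum>j\<in>UNIV. A i j t y * A i j t y)"
definition BA where "BA i t y = (\<Sum>j\<in>UNIV. \<Sum>k\<in>UNIV. B i j k t y * A j k t y)"
definition BAv where "BAv t y = (\<Sum>i\<in>UNIV. v i t y * BA i t y)"
definition BB where "BB t y = (\<Sum>i\<in>UNIV. \<Sum>j\<in>UNIV. \<Sum>k\<in>UNIV. B i j k t y * B i j k t y)"
definition Bvv where "Bvv i t y = (\<Sum>j\<in>UNIV. \<Sum>k\<in>UNIV. B i j k t y * (v j t y * v k t y))"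
definition Bvvv where "Bvvv t y = (\<Sum>i\<in>UNIV. v i t y * Bvv i t y)"
definition AAA where "AAA t y = (\<Sum>i\<in>UNIV. \<Sum>j\<in>UNIV. \<Sum>k\<in>UNIV. A i j t y * (A j k t y * A k i t y))"

lemma moderate_a: "moderate a"
  unfolding a_def[abs_def] by (intro moderate_intros moderate_A)
lemma moderate_r: "moderate r"
  unfolding r_def[abs_def] by (intro moderate_intros moderate_v)
lemma moderate_w: "moderate (w i)"
  unfolding w_def[abs_def] by (intro moderate_intros moderate_v moderate_A)
lemma moderate_b: "moderate (b i)"
  unfolding b_def[abs_def] by (intro moderate_intros moderate_B)
lemma moderate_vw: "moderate vw"
  unfolding vw_def[abs_def] by (intro moderate_intros moderate_v moderate_w)
lemma moderate_vb: "moderate vb"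
  unfolding vb_def[abs_def] by (intro moderate_intros moderate_v moderate_b)
lemma moderate_ww: "moderate ww"
  unfolding ww_def[abs_def] by (intro moderate_intros moderate_w)
lemma moderate_bw: "moderate bw"
  unfolding bw_def[abs_def] by (intro moderate_intros moderate_b moderate_w)
lemma moderate_bb: "moderate bb"
  unfolding bb_def[abs_def] by (intro moderate_intros moderate_b)
lemma moderate_AA: "moderate AA"
  unfolding AA_def[abs_def] by (intro moderate_intros moderate_A)
lemma moderate_BA: "moderate (BA i)"
  unfolding BA_def[abs_def] by (intro moderate_intros moderate_A moderate_B)
lemma moderate_BAv: "moderate BAv"
  unfolding BAv_def[abs_def] by (intro moderate_intros moderate_v moderate_BA)
lemma moderate_BB: "moderate BB"
  unfolding BB_def[abs_def] by (intro moderate_intros moderate_B)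
lemma moderate_Bvv: "moderate (Bvv i)"
  unfolding Bvv_def[abs_def] by (intro moderate_intros moderate_v moderate_B)
lemma moderate_Bvvv: "moderate Bvvv"
  unfolding Bvvv_def[abs_def] by (intro moderate_intros moderate_v moderate_Bvv)
lemma moderate_AAA: "moderate AAA"
  unfolding AAA_def[abs_def] by (intro moderate_intros moderate_A)

lemmas moderate_tensors = moderate_intros moderate_v moderate_A moderate_B moderate_E moderate_a moderate_r
  moderate_w moderate_b moderate_vw moderate_vb moderate_ww moderate_bw moderate_bb moderate_AA moderate_BA
  moderate_BAv moderate_BB moderate_Bvv moderate_Bvvv moderate_AAA

lemma B_trace: "(\<Sum>j\<in>UNIV. B j j i t y) = b i t y" "(\<Sum>j\<in>UNIV. B j i j t y) = b i t y"
  unfolding b_def by (metis (no_types, lifting) B_sym sum.cong)+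

lemma pd_a: "pd i a (b i)"
  unfolding a_def[abs_def]
  by (rule pd_cong, (rule pd_sum pd_A)+) (simp add: B_trace)

lemma pd_r: "pd i r (\<lambda>t y. 2 * w i t y)"
  unfolding r_def[abs_def]
  by (rule pd_cong, (rule pd_sum pd_mult pd_v)+)
    (simp add: w_def sum_distrib_left A_sym[of _ i] mult_ac)

lemma pd_w: "pd i (w k) (\<lambda>t y. \<Sum>j\<in>UNIV. B k j i t y * v j t y + A k j t y * A j i t y)"
  unfolding w_def[abs_def]
  by (rule pd_sum pd_mult pd_A pd_v)+

lemma pd_AA: "pd i AA (\<lambda>t y. 2 * BA i t y)"
  unfolding AA_def[abs_def]
  by (rule pd_cong, (rule pd_sum pd_mult pd_A)+)
    (simp add: BA_def sum_distrib_left B_sym(1)[of i] B_sym(2)[of _ i] mult_ac)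

lemma pd_b: "pd i (b k) (\<lambda>t y. \<Sum>j\<in>UNIV. E k j j i t y)"
  unfolding b_def[abs_def] by (rule pd_sum pd_B)+

lemma pd_vb: "pd i vb (\<lambda>t y. \<Sum>k\<in>UNIV. A k i t y * b k t y + v k t y * (\<Sum>j\<in>UNIV. E k j j i t y))"
  unfolding vb_def[abs_def] by (rule pd_sum pd_mult pd_v pd_b)+

lemma pd_vw: "pd i vw (\<lambda>t y. 2 * (\<Sum>k\<in>UNIV. A i k t y * w k t y) + Bvv i t y)"
proof (rule pd_cong)
  show "pd i vw (\<lambda>t y. \<Sum>k\<in>UNIV. A k i t y * w k t y + v k t y * (\<Sum>j\<in>UNIV. B k j i t y * v j t y + A k j t y * A j i t y))"
    unfolding vw_def[abs_def] by (rule pd_sum pd_mult pd_v pd_w)+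
  fix t y
  have "(\<Sum>k\<in>UNIV. v k t y * (\<Sum>j\<in>UNIV. A k j t y * A j i t y)) = (\<Sum>j\<in>UNIV. \<Sum>k\<in>UNIV. v k t y * (A k j t y * A j i t y))"
    unfolding sum_distrib_left by (rule sum.swap)
  also have "\<dots> = (\<Sum>k\<in>UNIV. A i k t y * w k t y)"
    by (simp add: w_def sum_distrib_left A_sym[of _ i] mult_ac) (simp add: A_sym)
  finally have 1: "(\<Sum>k\<in>UNIV. v k t y * (\<Sum>j\<in>UNIV. A k j t y * A j i t y)) = (\<Sum>k\<in>UNIV. A i k t y * w k t y)" .
  have 2: "(\<Sum>k\<in>UNIV. v k t y * (\<Sum>j\<in>UNIV. B k j i t y * v j t y)) = Bvv i t y"
    unfolding Bvv_def sum_distrib_left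
    by (intro sum.cong refl) (metis (no_types) B_sym mult.left_commute mult.commute)
  show "(\<Sum>k\<in>UNIV. A k i t y * w k t y + v k t y * (\<Sum>j\<in>UNIV. B k j i t y * v j t y + A k j t y * A j i t y))
    = 2 * (\<Sum>k\<in>UNIV. A i k t y * w k t y) + Bvv i t y"
    unfolding sum.distrib distrib_left 1 2 by (simp add: A_sym[of _ i])
qed

section \<open>Null expectations from divergences\<close>

definition ev :: "(real \<Rightarrow> real ^ 'n \<Rightarrow> real) \<Rightarrow> real \<Rightarrow> real" where
  "ev f t = (\<integral>y. u t y * f t y \<partial>lborel)"

lemma ev_add: "moderate f \<Longrightarrow> moderate g \<Longrightarrow> 0 < t \<Longrightarrow> ev (\<lambda>t y. f t y + g t y) t = ev f t + ev g t"
  using integrable_moderate by (simp add: ev_def distrib_left)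

lemma ev_cmult: "ev (\<lambda>t y. c * f t y) t = c * ev f t"
  unfolding ev_def by (simp add: mult.left_commute[of _ c])

lemma ev_sum:
  assumes "\<And>i. i \<in> I \<Longrightarrow> moderate (f i)" "0 < t"
  shows "ev (\<lambda>t y. \<Sum>i\<in>I. f i t y) t = (\<Sum>i\<in>I. ev (f i) t)"
  using assms integrable_moderate by (simp add: ev_def sum_distrib_left Bochner_Integration.integral_sum)

lemma ev_null:
  assumes "moderate f" "moderate g" "0 < t" "ev g t = 0" "\<And>y. h t y = f t y + c * g t y"
  shows "ev h t = ev f t"
proof -
  have "ev h t = ev (\<lambda>t y. f t y + c * g t y) t" using assms by (simp add: ev_def)
  also have "\<dots> = ev f t" using assms by (subst ev_add) (auto simp: ev_cmult intro!: moderate_intros)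
  finally show ?thesis .
qed

lemma ev_div:
  assumes "\<And>i. moderate (F i)" "\<And>i. moderate (G i)" "\<And>i. pd i (F i) (G i)" "0 < t"
  shows "ev (\<lambda>t y. \<Sum>i\<in>UNIV. v i t y * F i t y + G i t y) t = 0"
proof -
  have "ev (\<lambda>t y. v i t y * F i t y + G i t y) t = 0" for i
    unfolding ev_def v_def
    using assms by (intro expectation_divergence) (auto simp: pd_def)
  then show ?thesis using assms by (subst ev_sum) (auto intro!: moderate_tensors)
qed

text \<open>The product rule for the field \<open>\<phi> X\<close>. With \<open>X\<close> equal to
  \<open>v\<close> or \<open>w\<close> and \<open>\<phi>\<close> one of a few scalars it covers most
  of the null identities below.\<close>

lemma ev_div_scaled:
  assumes "\<And>i. moderate (X i)" "\<And>i. moderate (X' i)" "moderate \<phi>" "\<And>i. moderate (g i)"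
    and "\<And>i. pd i (X i) (X' i)" "\<And>i. pd i \<phi> (g i)" "0 < t"
    and "\<And>y. h t y = \<phi> t y * (\<Sum>i\<in>UNIV. v i t y * X i t y) + (\<Sum>i\<in>UNIV. g i t y * X i t y) + \<phi> t y * (\<Sum>i\<in>UNIV. X' i t y)"
  shows "ev h t = 0"
proof -
  have "ev (\<lambda>t y. \<Sum>i\<in>UNIV. v i t y * (\<phi> t y * X i t y) + (g i t y * X i t y + \<phi> t y * X' i t y)) t = 0"
    using assms by (intro ev_div) (auto intro!: moderate_tensors pd_mult)
  then show ?thesis
    by (simp add: ev_def assms(8) sum.distrib sum_distrib_left mult.left_commute add.assoc)
qed

lemma w_v: "(\<Sum>i\<in>UNIV. w i t y * v i t y) = vw t y"
  by (simp add: vw_def mult.commute)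

lemma b_v: "(\<Sum>i\<in>UNIV. b i t y * v i t y) = vb t y"
  by (simp add: vb_def mult.commute)

lemma div_w: "(\<Sum>i\<in>UNIV. \<Sum>j\<in>UNIV. B i j i t y * v j t y + A i j t y * A j i t y) = vb t y + AA t y"
proof -
  have "(\<Sum>i\<in>UNIV. \<Sum>j\<in>UNIV. B i j i t y * v j t y) = (\<Sum>j\<in>UNIV. \<Sum>i\<in>UNIV. B i j i t y * v j t y)"
    by (rule sum.swap)
  also have "\<dots> = vb t y"
    by (simp add: sum_distrib_right[symmetric] B_trace b_v)
  moreover have "(\<Sum>i\<in>UNIV. \<Sum>j\<in>UNIV. A i j t y * A j i t y) = AA t y"
    unfolding AA_def by (intro sum.cong refl) (simp add: A_sym)
  ultimately show ?thesis by (simp add: sum.distrib)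
qed

lemma Aw_v: "(\<Sum>i\<in>UNIV. (\<Sum>k\<in>UNIV. A i k t y * w k t y) * v i t y) = ww t y"
proof -
  have "(\<Sum>i\<in>UNIV. (\<Sum>k\<in>UNIV. A i k t y * w k t y) * v i t y) = (\<Sum>k\<in>UNIV. \<Sum>i\<in>UNIV. A i k t y * w k t y * v i t y)"
    unfolding sum_distrib_right by (rule sum.swap)
  also have "\<dots> = ww t y"
    unfolding ww_def by (intro sum.cong refl) (simp add: w_def[of _ t y] A_sym[of _ k for k] sum_distrib_left sum_distrib_right mult_ac)
  finally show ?thesis .
qed

text \<open>Together with \<open>ev_w\<close> this yields the second derivative of the
  entropy.\<close>

lemma ev_rv: "0 < t \<Longrightarrow> ev (\<lambda>t y. r t y * r t y + 2 * vw t y + r t y * a t y) t = 0"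
  by (rule ev_div_scaled[where X=v, OF moderate_v moderate_A moderate_r _ pd_v pd_r])
    (auto intro!: moderate_tensors simp: r_def[symmetric] a_def[symmetric] w_v sum_distrib_left[symmetric] mult.assoc)

lemma ev_w: "0 < t \<Longrightarrow> ev (\<lambda>t y. vw t y + vb t y + AA t y) t = 0"
  by (rule ev_div_scaled[where X=w, OF moderate_w _ moderate_const[of 1] moderate_const[of 0] pd_w pd_const])
    (auto intro!: moderate_tensors simp: vw_def[symmetric] div_w)

lemma ev_AAv: "0 < t \<Longrightarrow> ev (\<lambda>t y. AA t y * r t y + 2 * BAv t y + AA t y * a t y) t = 0"
  by (rule ev_div_scaled[where X=v, OF moderate_v moderate_A moderate_AA _ pd_v pd_AA])
    (auto intro!: moderate_tensors simp: r_def[symmetric] a_def[symmetric] BAv_def sum_distrib_left mult_ac)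

lemma ev_aw: "0 < t \<Longrightarrow> ev (\<lambda>t y. a t y * vw t y + bw t y + a t y * (vb t y + AA t y)) t = 0"
  by (rule ev_div_scaled[where X=w, OF moderate_w _ moderate_a moderate_b pd_w pd_a])
    (auto intro!: moderate_tensors simp: vw_def[symmetric] bw_def[symmetric] div_w)

lemma ev_vwv: "0 < t \<Longrightarrow> ev (\<lambda>t y. vw t y * r t y + (2 * ww t y + Bvvv t y) + vw t y * a t y) t = 0"
proof -
  assume t: "0 < t"
  have e: "(\<Sum>i\<in>UNIV. (2 * (\<Sum>k\<in>UNIV. A i k t y * w k t y) + Bvv i t y) * v i t y) = 2 * ww t y + Bvvv t y" for y
  proof -
    have "(\<Sum>i\<in>UNIV. (2 * z i + z' i) * x i) = 2 * (\<Sum>i\<in>UNIV. z i * x i) + (\<Sum>i\<in>UNIV. x i * z' i)" for z z' x :: "'n \<Rightarrow> real"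
      by (simp add: algebra_simps sum.distrib sum_distrib_left)
    then show ?thesis unfolding Aw_v[symmetric] Bvvv_def .
  qed
  show ?thesis
    by (rule ev_div_scaled[where X=v, OF moderate_v moderate_A moderate_vw _ pd_v pd_vw t])
      (intro moderate_tensors, unfold e, simp add: r_def[symmetric] a_def[symmetric])
qed

lemma ev_rw: "0 < t \<Longrightarrow> ev (\<lambda>t y. r t y * vw t y + 2 * ww t y + r t y * (vb t y + AA t y)) t = 0"
  by (rule ev_div_scaled[where X=w, OF moderate_w _ moderate_r _ pd_w pd_r])
    (auto intro!: moderate_tensors simp: vw_def[symmetric] div_w mult.assoc sum_distrib_left[symmetric] ww_def[symmetric])

lemma ev_arv: "0 < t \<Longrightarrow> ev (\<lambda>t y. a t y * r t y * r t y + (r t y * vb t y + 2 * (a t y * vw t y)) + a t y * r t y * a t y) t = 0"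
proof -
  assume t: "0 < t"
  have e: "(\<Sum>i\<in>UNIV. (b i t y * r t y + a t y * (2 * w i t y)) * v i t y) = r t y * vb t y + 2 * (a t y * vw t y)" for y
    by (simp add: vb_def vw_def sum.distrib sum_distrib_left algebra_simps)
  show ?thesis
    by (rule ev_div_scaled[where X=v, OF moderate_v moderate_A moderate_mult[OF moderate_a moderate_r] _ pd_v pd_mult[OF pd_a pd_r] t])
      (intro moderate_tensors, unfold e, simp add: r_def[symmetric] a_def[symmetric])
qed

lemma ev_rrv: "0 < t \<Longrightarrow> ev (\<lambda>t y. r t y * r t y * r t y + 4 * (r t y * vw t y) + r t y * r t y * a t y) t = 0"
proof -
  assume t: "0 < t"
  have e: "(\<Sum>i\<in>UNIV. (2 * w i t y * r t y + r t y * (2 * w i t y)) * v i t y) = 4 * (r t y * vw t y)" for y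
    by (simp add: vw_def sum_distrib_left algebra_simps)
  show ?thesis
    by (rule ev_div_scaled[where X=v, OF moderate_v moderate_A moderate_mult[OF moderate_r moderate_r] _ pd_v pd_mult[OF pd_r pd_r] t])
      (intro moderate_tensors, unfold e, simp add: r_def[symmetric] a_def[symmetric])
qed

lemma pd_BA: "pd l (BA i) (\<lambda>t y. \<Sum>j\<in>UNIV. \<Sum>k\<in>UNIV. E i j k l t y * A j k t y + B i j k t y * B j k l t y)"
  unfolding BA_def[abs_def] by (rule pd_sum pd_mult pd_A pd_B)+

definition EA where "EA t y = (\<Sum>i\<in>UNIV. \<Sum>j\<in>UNIV. \<Sum>k\<in>UNIV. E i i j k t y * A j k t y)"

lemma moderate_EA: "moderate EA"
  unfolding EA_def[abs_def] by (intro moderate_tensors)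

lemma ev_BA: "0 < t \<Longrightarrow> ev (\<lambda>t y. BAv t y + (EA t y + BB t y)) t = 0"
proof -
  assume t: "0 < t"
  have e: "BAv t y + (EA t y + BB t y) = (\<Sum>i\<in>UNIV. v i t y * BA i t y + 
     (\<Sum>j\<in>UNIV. \<Sum>k\<in>UNIV. E i j k i t y * A j k t y + B i j k t y * B j k i t y))" for t y
  proof -
    have "(\<Sum>i\<in>UNIV. \<Sum>j\<in>UNIV. \<Sum>k\<in>UNIV. E i j k i t y * A j k t y) = EA t y"
      unfolding EA_def by (intro sum.cong refl) (metis E_sym)
    moreover have "(\<Sum>i\<in>UNIV. \<Sum>j\<in>UNIV. \<Sum>k\<in>UNIV. B i j k t y * B j k i t y) = BB t y"
      unfolding BB_def by (intro sum.cong refl) (metis B_sym)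
    ultimately show ?thesis by (simp add: BAv_def sum.distrib)
  qed
  show ?thesis unfolding e
    by (rule ev_div[OF moderate_BA _ pd_BA t]) (intro moderate_tensors)
qed

text \<open>The field \<open>A b\<close> produces the same fourth-order term \<open>EA\<close> as
  \<open>ev_BA\<close>. Taken with opposite weights, the two trade \<open>BB\<close> for the square
  \<open>bb\<close> of its trace without any fourth derivative.\<close>

lemma ev_Ab: "0 < t \<Longrightarrow> ev (\<lambda>t y. bw t y + (bb t y + EA t y)) t = 0"
proof -
  assume t: "0 < t"
  have e: "bw t y + (bb t y + EA t y) = (\<Sum>i\<in>UNIV. v i t y * (\<Sum>j\<in>UNIV. A i j t y * b j t y) +
     (\<Sum>j\<in>UNIV. B i j i t y * b j t y + A i j t y * (\<Sum>k\<in>UNIV. E j k k i t y)))" for t y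
  proof -
    have "(\<Sum>i\<in>UNIV. v i t y * (\<Sum>j\<in>UNIV. A i j t y * b j t y)) = (\<Sum>j\<in>UNIV. \<Sum>i\<in>UNIV. v i t y * (A i j t y * b j t y))"
      unfolding sum_distrib_left by (rule sum.swap)
    also have "\<dots> = bw t y"
      unfolding bw_def w_def sum_distrib_left by (intro sum.cong refl) (simp add: A_sym mult_ac)
    finally have 1: "(\<Sum>i\<in>UNIV. v i t y * (\<Sum>j\<in>UNIV. A i j t y * b j t y)) = bw t y" .
    have "(\<Sum>i\<in>UNIV. \<Sum>j\<in>UNIV. B i j i t y * b j t y) = (\<Sum>j\<in>UNIV. \<Sum>i\<in>UNIV. B i j i t y * b j t y)"
      by (rule sum.swap)
    also have "\<dots> = bb t y"
      unfolding bb_def by (simp add: sum_distrib_right[symmetric] B_trace)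
    finally have 2: "(\<Sum>i\<in>UNIV. \<Sum>j\<in>UNIV. B i j i t y * b j t y) = bb t y" .
    have "EA t y = (\<Sum>j\<in>UNIV. \<Sum>k\<in>UNIV. \<Sum>i\<in>UNIV. E i i j k t y * A j k t y)"
      unfolding EA_def by (subst sum.swap) (intro sum.cong refl sum.swap)
    also have "\<dots> = (\<Sum>j\<in>UNIV. \<Sum>k\<in>UNIV. A j k t y * (\<Sum>i\<in>UNIV. E k i i j t y))"
      unfolding sum_distrib_left by (intro sum.cong refl) (metis E_sym mult.commute)
    finally show ?thesis using 1 2 by (simp add: sum.distrib)
  qed
  show ?thesis unfolding e
    by (rule ev_div[OF _ _ _ t]) (intro moderate_tensors pd_sum pd_mult pd_A pd_b)+
qed

definition Evv where "Evv t y = (\<Sum>i\<in>UNIV. \<Sum>j\<in>UNIV. \<Sum>k\<in>UNIV. E i i j k t y * (v j t y * v k t y))"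

lemma moderate_Evv: "moderate Evv"
  unfolding Evv_def[abs_def] by (intro moderate_tensors)

lemma ev_Bvv: "0 < t \<Longrightarrow> ev (\<lambda>t y. Bvvv t y + (Evv t y + 2 * BAv t y)) t = 0"
proof -
  assume t: "0 < t"
  have e: "Bvvv t y + (Evv t y + 2 * BAv t y) = (\<Sum>i\<in>UNIV. v i t y * Bvv i t y +
     (\<Sum>j\<in>UNIV. \<Sum>k\<in>UNIV. E i j k i t y * (v j t y * v k t y) + B i j k t y * (A j i t y * v k t y + v j t y * A k i t y)))" for t y
  proof -
    have 1: "(\<Sum>i\<in>UNIV. \<Sum>j\<in>UNIV. \<Sum>k\<in>UNIV. E i j k i t y * (v j t y * v k t y)) = Evv t y"
      unfolding Evv_def by (intro sum.cong refl) (metis E_sym)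
    have 2: "(\<Sum>i\<in>UNIV. \<Sum>j\<in>UNIV. \<Sum>k\<in>UNIV. B i j k t y * (A j i t y * v k t y)) = BAv t y"
    proof -
      have "(\<Sum>i\<in>UNIV. \<Sum>j\<in>UNIV. \<Sum>k\<in>UNIV. B i j k t y * (A j i t y * v k t y))
        = (\<Sum>i\<in>UNIV. \<Sum>k\<in>UNIV. \<Sum>j\<in>UNIV. B i j k t y * (A j i t y * v k t y))"
        by (intro sum.cong refl sum.swap)
      also have "\<dots> = (\<Sum>k\<in>UNIV. \<Sum>i\<in>UNIV. \<Sum>j\<in>UNIV. B i j k t y * (A j i t y * v k t y))"
        by (rule sum.swap)
      also have "\<dots> = BAv t y"
        unfolding BAv_def BA_def sum_distrib_left
        by (intro sum.cong refl) (metis B_sym A_sym mult.left_commute mult.commute)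
      finally show ?thesis .
    qed
    have 3: "(\<Sum>i\<in>UNIV. \<Sum>j\<in>UNIV. \<Sum>k\<in>UNIV. B i j k t y * (v j t y * A k i t y)) = BAv t y"
    proof -
      have "(\<Sum>i\<in>UNIV. \<Sum>j\<in>UNIV. \<Sum>k\<in>UNIV. B i j k t y * (v j t y * A k i t y)) 
        = (\<Sum>j\<in>UNIV. \<Sum>i\<in>UNIV. \<Sum>k\<in>UNIV. B i j k t y * (v j t y * A k i t y))"
        by (rule sum.swap)
      also have "\<dots> = BAv t y"
        unfolding BAv_def BA_def sum_distrib_left
        by (intro sum.cong refl) (metis B_sym A_sym mult.left_commute mult.commute)
      finally show ?thesis .
    qed
    show ?thesis using 1 2 3 by (simp add: sum.distrib distrib_left Bvvv_def)
  qed
  have pd: "pd i (Bvv i) (\<lambda>t y. \<Sum>j\<in>UNIV. \<Sum>k\<in>UNIV. E i j k i t y * (v j t y * v k t y)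
      + B i j k t y * (A j i t y * v k t y + v j t y * A k i t y))" for i
    unfolding Bvv_def[abs_def] by (intro pd_sum pd_mult pd_B pd_v)
  show ?thesis unfolding e
    by (rule ev_div[OF moderate_Bvv _ pd t]) (intro moderate_tensors)
qed

text \<open>Shares \<open>Evv\<close> with \<open>ev_Bvv\<close>, so the difference of the two
  identities is free of fourth derivatives.\<close>

lemma ev_vbv: "0 < t \<Longrightarrow> ev (\<lambda>t y. vb t y * r t y + (bw t y + Evv t y) + vb t y * a t y) t = 0"
proof -
  assume t: "0 < t"
  have e: "(\<Sum>i\<in>UNIV. (\<Sum>k\<in>UNIV. A k i t y * b k t y + v k t y * (\<Sum>j\<in>UNIV. E k j j i t y)) * v i t y)
      = bw t y + Evv t y" for y
  proof -
    have "(\<Sum>i\<in>UNIV. \<Sum>k\<in>UNIV. A k i t y * b k t y * v i t y) = (\<Sum>k\<in>UNIV. \<Sum>i\<in>UNIV. A k i t y * b k t y * v i t y)"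
      by (rule sum.swap)
    also have "\<dots> = bw t y"
      by (simp add: bw_def w_def sum_distrib_left mult_ac)
    finally have 1: "(\<Sum>i\<in>UNIV. \<Sum>k\<in>UNIV. A k i t y * b k t y * v i t y) = bw t y" .
    have "Evv t y = (\<Sum>j\<in>UNIV. \<Sum>k\<in>UNIV. \<Sum>i\<in>UNIV. E i i j k t y * (v j t y * v k t y))"
      unfolding Evv_def by (subst sum.swap) (intro sum.cong refl sum.swap)
    also have "\<dots> = (\<Sum>j\<in>UNIV. \<Sum>k\<in>UNIV. v k t y * (\<Sum>i\<in>UNIV. E k i i j t y) * v j t y)"
      unfolding sum_distrib_left sum_distrib_right
      by (intro sum.cong refl) (metis E_sym mult.left_commute mult.commute)
    finally show ?thesis using 1 by (simp add: distrib_right sum.distrib sum_distrib_right)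
  qed
  show ?thesis
    by (rule ev_div_scaled[where X=v, OF moderate_v moderate_A moderate_vb _ pd_v pd_vb t])
      (intro moderate_tensors, unfold e, simp add: r_def[symmetric] a_def[symmetric])
qed

text \<open>The one null identity that contains \<open>AAA\<close>. It is what removes the cubic
  trace, which has no sign of its own, from the third derivative.\<close>

lemma ev_Aw: "0 < t \<Longrightarrow> ev (\<lambda>t y. ww t y + (bw t y + (BAv t y + AAA t y))) t = 0"
proof -
  assume t: "0 < t"
  have e: "ww t y + (bw t y + (BAv t y + AAA t y)) = (\<Sum>i\<in>UNIV. v i t y * (\<Sum>k\<in>UNIV. A i k t y * w k t y) +
     (\<Sum>k\<in>UNIV. B i k i t y * w k t y + A i k t y * (\<Sum>j\<in>UNIV. B k j i t y * v j t y + A k j t y * A j i t y)))" for t y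
  proof -
    have 1: "(\<Sum>i\<in>UNIV. v i t y * (\<Sum>k\<in>UNIV. A i k t y * w k t y)) = ww t y"
      using Aw_v[where t=t and y=y] by (simp add: mult.commute)
    have "(\<Sum>i\<in>UNIV. \<Sum>k\<in>UNIV. B i k i t y * w k t y) = (\<Sum>k\<in>UNIV. \<Sum>i\<in>UNIV. B i k i t y * w k t y)"
      by (rule sum.swap)
    also have "\<dots> = bw t y"
      unfolding bw_def by (simp add: sum_distrib_right[symmetric] B_trace)
    finally have 2: "(\<Sum>i\<in>UNIV. \<Sum>k\<in>UNIV. B i k i t y * w k t y) = bw t y" .
    have "(\<Sum>i\<in>UNIV. \<Sum>k\<in>UNIV. \<Sum>j\<in>UNIV. A i k t y * (B k j i t y * v j t y))
       = (\<Sum>i\<in>UNIV. \<Sum>j\<in>UNIV. \<Sum>k\<in>UNIV. A i k t y * (B k j i t y * v j t y))"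
      by (intro sum.cong refl sum.swap)
    also have "\<dots> = (\<Sum>j\<in>UNIV. \<Sum>i\<in>UNIV. \<Sum>k\<in>UNIV. A i k t y * (B k j i t y * v j t y))"
      by (rule sum.swap)
    also have "\<dots> = BAv t y"
      unfolding BAv_def BA_def sum_distrib_left
      by (intro sum.cong refl) (metis B_sym A_sym mult.left_commute mult.commute)
    finally have 3: "(\<Sum>i\<in>UNIV. \<Sum>k\<in>UNIV. \<Sum>j\<in>UNIV. A i k t y * (B k j i t y * v j t y)) = BAv t y" .
    show ?thesis using 1 2 3 by (simp add: sum.distrib distrib_left sum_distrib_left AAA_def)
  qed
  have pd: "pd i (\<lambda>t y. \<Sum>k\<in>UNIV. A i k t y * w k t y) (\<lambda>t y. \<Sum>k\<in>UNIV. B i k i t y * w k t y + A i k t y * (\<Sum>j\<in>UNIV. B k j i t y * v j t y + A k j t y * A j i t y))" for i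
    by (intro pd_sum pd_mult pd_A pd_w)
  show ?thesis unfolding e
    by (rule ev_div[OF _ _ pd t]) (intro moderate_tensors)+
qed

lemma sum_q2: "(\<Sum>j\<in>UNIV. q {#j, j#} t y) = a t y + r t y"
  by (simp add: q2 sum.distrib a_def r_def)

section \<open>Two time derivatives of the Fisher information\<close>

lemma has_derivative_ev:
  assumes "moderate f" "moderate g" "td f g" "0 < t"
  shows "(ev f has_real_derivative ev (\<lambda>t y. (a t y + r t y) / 2 * f t y + g t y) t) (at t)"
  using has_derivative_expectation_time[of f g t] assms
  unfolding ev_def[abs_def] td_def sum_q2 by blast

text \<open>Half of \<open>ev_rv\<close> absorbs the term that stems from the moving weight and
  leaves \<open>vb + vw\<close>, which \<open>ev_w\<close> replaces by \<open>- AA\<close>.\<close>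

lemma has_derivative_ev_r:
  assumes t: "0 < t"
  shows "(ev r has_real_derivative - ev AA t) (at t)"
proof -
  have "td r (\<lambda>t y. vb t y + 2 * vw t y)"
    unfolding r_def[abs_def]
  proof (rule td_cong, (rule td_sum td_mult td_v)+)
    fix t y
    have g: "(\<Sum>i\<in>UNIV. f i * h i + h i * f i) = 2 * (\<Sum>i\<in>UNIV. h i * f i)" for f h :: "'n \<Rightarrow> real"
      by (simp add: sum_distrib_left mult.commute)
    have e: "(\<Sum>i\<in>UNIV. v i t y * (\<Sum>j\<in>UNIV. B i j j t y / 2 + v j t y * A i j t y)) = vb t y / 2 + vw t y"
      by (simp add: vb_def b_def vw_def w_def sum.distrib distrib_left sum_divide_distrib[symmetric] mult.commute)
    show "(\<Sum>i\<in>UNIV. (\<Sum>j\<in>UNIV. B i j j t y / 2 + v j t y * A i j t y) * v i t y +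
        v i t y * (\<Sum>j\<in>UNIV. B i j j t y / 2 + v j t y * A i j t y)) = vb t y + 2 * vw t y"
      unfolding g e by simp
  qed
  then have d: "(ev r has_real_derivative ev (\<lambda>t y. (a t y + r t y) / 2 * r t y + (vb t y + 2 * vw t y)) t) (at t)"
    by (intro has_derivative_ev t) (intro moderate_tensors)+
  have "ev (\<lambda>t y. (a t y + r t y) / 2 * r t y + (vb t y + 2 * vw t y)) t
     = ev (\<lambda>t y. - AA t y + (vw t y + vb t y + AA t y)) t"
    by (rule ev_null[OF _ _ t ev_rv[OF t], of _ _ "1 / 2"]) (intro moderate_tensors | simp add: field_simps)+
  also have "\<dots> = ev (\<lambda>t y. - AA t y) t"
    by (rule ev_null[OF _ _ t ev_w[OF t], of _ _ 1]) (intro moderate_tensors | simp)+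
  also have "\<dots> = - ev AA t" using ev_cmult[of "-1" AA] by simp
  finally show ?thesis using d by simp
qed

text \<open>Half of \<open>ev_AAv\<close> absorbs the term from the moving weight and leaves
  \<open>EA + BAv + 2 AAA\<close>; \<open>ev_BA\<close> then turns \<open>EA + BAv\<close> into
  \<open>- BB\<close>.\<close>

lemma has_derivative_ev_AA:
  assumes t: "0 < t"
  shows "(ev AA has_real_derivative 2 * ev AAA t - ev BB t) (at t)"
proof -
  have "td AA (\<lambda>t y. EA t y + 2 * AAA t y + 2 * BAv t y)"
    unfolding AA_def[abs_def]
  proof (rule td_cong, (rule td_sum td_mult td_A)+)
    fix t y
    have 1: "(\<Sum>i\<in>UNIV. \<Sum>j\<in>UNIV. \<Sum>k\<in>UNIV. A i j t y * E i j k k t y) = EA t y"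
    proof -
      have "EA t y = (\<Sum>j\<in>UNIV. \<Sum>k\<in>UNIV. \<Sum>i\<in>UNIV. E i i j k t y * A j k t y)"
        unfolding EA_def by (subst sum.swap) (intro sum.cong refl sum.swap)
      also have "\<dots> = (\<Sum>i\<in>UNIV. \<Sum>j\<in>UNIV. \<Sum>k\<in>UNIV. A i j t y * E i j k k t y)"
        by (intro sum.cong refl) (metis E_sym mult.commute)
      finally show ?thesis by simp
    qed
    have 2: "(\<Sum>i\<in>UNIV. \<Sum>j\<in>UNIV. \<Sum>k\<in>UNIV. A i j t y * (A i k t y * A j k t y)) = AAA t y"
      unfolding AAA_def by (intro sum.cong refl) (metis A_sym mult.commute)
    have 3: "(\<Sum>i\<in>UNIV. \<Sum>j\<in>UNIV. \<Sum>k\<in>UNIV. A i j t y * (v k t y * B i j k t y)) = BAv t y"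
    proof -
      have "(\<Sum>i\<in>UNIV. \<Sum>j\<in>UNIV. \<Sum>k\<in>UNIV. A i j t y * (v k t y * B i j k t y))
        = (\<Sum>i\<in>UNIV. \<Sum>k\<in>UNIV. \<Sum>j\<in>UNIV. A i j t y * (v k t y * B i j k t y))"
        by (intro sum.cong refl sum.swap)
      also have "\<dots> = (\<Sum>k\<in>UNIV. \<Sum>i\<in>UNIV. \<Sum>j\<in>UNIV. A i j t y * (v k t y * B i j k t y))"
        by (rule sum.swap)
      also have "\<dots> = BAv t y"
        unfolding BAv_def BA_def sum_distrib_left
        by (intro sum.cong refl) (metis B_sym A_sym mult.left_commute mult.commute)
      finally show ?thesis .
    qed
    have g: "(\<Sum>i\<in>UNIV. f i * h i + h i * f i) = 2 * (\<Sum>i\<in>UNIV. h i * f i)" for f h :: "'n \<Rightarrow> real"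
      by (simp add: sum_distrib_left mult.commute)
    have e: "(\<Sum>i\<in>UNIV. \<Sum>j\<in>UNIV. A i j t y * (\<Sum>k\<in>UNIV. E i j k k t y / 2 + A i k t y * A j k t y + v k t y * B i j k t y))
       = EA t y / 2 + AAA t y + BAv t y"
      unfolding 1[symmetric] 2[symmetric] 3[symmetric]
      by (simp add: sum_distrib_left distrib_left sum.distrib sum_divide_distrib)
    show "(\<Sum>i\<in>UNIV. \<Sum>j\<in>UNIV.
       (\<Sum>k\<in>UNIV. E i j k k t y / 2 + A i k t y * A j k t y + v k t y * B i j k t y) * A i j t y +
       A i j t y * (\<Sum>k\<in>UNIV. E i j k k t y / 2 + A i k t y * A j k t y + v k t y * B i j k t y))
       = EA t y + 2 * AAA t y + 2 * BAv t y"
      unfolding g sum_distrib_left[symmetric] e by simp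
  qed
  then have d: "(ev AA has_real_derivative ev (\<lambda>t y. (a t y + r t y) / 2 * AA t y + (EA t y + 2 * AAA t y + 2 * BAv t y)) t) (at t)"
    by (intro has_derivative_ev t) (intro moderate_tensors moderate_EA)+
  have "ev (\<lambda>t y. (a t y + r t y) / 2 * AA t y + (EA t y + 2 * AAA t y + 2 * BAv t y)) t
     = ev (\<lambda>t y. (2 * AAA t y + (- 1) * BB t y) + (BAv t y + (EA t y + BB t y))) t"
    by (rule ev_null[OF _ _ t ev_AAv[OF t], of _ _ "1 / 2"]) (intro moderate_tensors moderate_EA | simp add: field_simps)+
  also have "\<dots> = ev (\<lambda>t y. 2 * AAA t y + (- 1) * BB t y) t"
    by (rule ev_null[OF _ _ t ev_BA[OF t], of _ _ 1]) (intro moderate_tensors moderate_EA | simp)+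
  also have "\<dots> = 2 * ev AAA t - ev BB t"
    using ev_cmult[of "- 1" BB] t by (subst ev_add) (auto intro!: moderate_tensors simp: ev_cmult)
  finally show ?thesis using d by simp
qed

end

section \<open>Trace inequalities for tensors of order three\<close>

definition inner3 :: "('n::finite \<Rightarrow> 'n \<Rightarrow> 'n \<Rightarrow> real) \<Rightarrow> ('n \<Rightarrow> 'n \<Rightarrow> 'n \<Rightarrow> real) \<Rightarrow> real" where
  "inner3 X Y = (\<Sum>i\<in>UNIV. \<Sum>j\<in>UNIV. \<Sum>k\<in>UNIV. X i j k * Y i j k)"

lemma inner3_nonneg: "0 \<le> inner3 X X"
  unfolding inner3_def by (intro sum_nonneg) auto

lemma inner3_combine:
  "inner3 (\<lambda>i j k. X i j k + \<beta> * Y i j k + \<gamma> * Z i j k) (\<lambda>i j k. X i j k + \<beta> * Y i j k + \<gamma> * Z i j k)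
   = inner3 X X + \<beta>\<^sup>2 * inner3 Y Y + \<gamma>\<^sup>2 * inner3 Z Z + 2 * \<beta> * inner3 X Y + 2 * \<gamma> * inner3 X Z + 2 * \<beta> * \<gamma> * inner3 Y Z"
  unfolding inner3_def
  by (simp add: sum_distrib_left flip: sum.distrib) (simp add: algebra_simps power2_eq_square)

lemma inner3_add:
  "inner3 (\<lambda>i j k. X i j k + \<beta> * Y i j k) (\<lambda>i j k. X i j k + \<beta> * Y i j k)
   = inner3 X X + \<beta>\<^sup>2 * inner3 Y Y + 2 * \<beta> * inner3 X Y"
  using inner3_combine[of X \<beta> Y 0 Y] by simp

text \<open>Subtract from \<open>S\<close> a multiple of the symmetric tensor \<open>T\<close> built
  from the trace vector \<open>s\<close>. The product of \<open>S\<close> and \<open>T\<close> is 3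
  |s|^2 and |T|^2 is 3 (n + 2) |s|^2, so the optimal multiple is 1 / (n + 2) and the optimal
  constant 3 / (n + 2), which is 1/2 in dimension 4.\<close>

lemma symmetric_trace_bound:
  fixes S :: "'n::finite \<Rightarrow> 'n \<Rightarrow> 'n \<Rightarrow> real"
  assumes n: "CARD('n) \<le> 4"
    and sym: "\<And>i j k. S i j k = S j i k" "\<And>i j k. S i j k = S i k j"
  shows "(\<Sum>k\<in>UNIV. (\<Sum>i\<in>UNIV. S i i k)\<^sup>2) / 2 \<le> inner3 S S"
proof -
  define s where "s k = (\<Sum>i\<in>UNIV. S i i k)" for k
  define N where "N = (\<Sum>k\<in>UNIV. s k * s k)"
  define T where "T i j k = (if i = j then s k else 0) + (if j = k then s i else 0) + (if i = k then s j else 0)" for i j k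
  have s': "(\<Sum>i\<in>UNIV. S i k i) = s k" "(\<Sum>i\<in>UNIV. S k i i) = s k" for k
    unfolding s_def using sym by metis+
  have ST: "inner3 S T = 3 * N"
  proof -
    have 1: "(\<Sum>i\<in>UNIV. \<Sum>j\<in>UNIV. \<Sum>k\<in>UNIV. S i j k * (if i = j then s k else 0)) = N"
    proof -
      have "(\<Sum>i\<in>UNIV. \<Sum>j\<in>UNIV. \<Sum>k\<in>UNIV. S i j k * (if i = j then s k else 0))
        = (\<Sum>i\<in>UNIV. \<Sum>k\<in>UNIV. \<Sum>j\<in>UNIV. S i j k * (if i = j then s k else 0))"
        by (intro sum.cong refl sum.swap)
      also have "\<dots> = (\<Sum>i\<in>UNIV. \<Sum>k\<in>UNIV. S i i k * s k)"
        by (simp add: if_distrib[of "\<lambda>x. _ * x"] cong: if_cong)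
      also have "\<dots> = (\<Sum>k\<in>UNIV. \<Sum>i\<in>UNIV. S i i k * s k)" by (rule sum.swap)
      also have "\<dots> = N" by (simp add: N_def s_def sum_distrib_right)
      finally show ?thesis .
    qed
    have 2: "(\<Sum>i\<in>UNIV. \<Sum>j\<in>UNIV. \<Sum>k\<in>UNIV. S i j k * (if j = k then s i else 0)) = N"
    proof -
      have "(\<Sum>i\<in>UNIV. \<Sum>j\<in>UNIV. \<Sum>k\<in>UNIV. S i j k * (if j = k then s i else 0)) = (\<Sum>i\<in>UNIV. \<Sum>j\<in>UNIV. S i j j * s i)"
        by (simp add: if_distrib[of "\<lambda>x. _ * x"] cong: if_cong)
      also have "\<dots> = N" by (simp add: N_def sum_distrib_right[symmetric] s')
      finally show ?thesis .
    qed
    have 3: "(\<Sum>i\<in>UNIV. \<Sum>j\<in>UNIV. \<Sum>k\<in>UNIV. S i j k * (if i = k then s j else 0)) = N"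
    proof -
      have "(\<Sum>i\<in>UNIV. \<Sum>j\<in>UNIV. \<Sum>k\<in>UNIV. S i j k * (if i = k then s j else 0)) = (\<Sum>i\<in>UNIV. \<Sum>j\<in>UNIV. S i j i * s j)"
        by (simp add: if_distrib[of "\<lambda>x. _ * x"] cong: if_cong)
      also have "\<dots> = (\<Sum>j\<in>UNIV. \<Sum>i\<in>UNIV. S i j i * s j)" by (rule sum.swap)
      also have "\<dots> = N" by (simp add: N_def sum_distrib_right[symmetric] s')
      finally show ?thesis .
    qed
    show ?thesis unfolding inner3_def T_def distrib_left sum.distrib 1 2 3 by simp
  qed
  have TT: "inner3 T T = 3 * (real CARD('n) + 2) * N"
  proof -
    \<comment> \<open>Only one factor is expanded, so that each conditional collapses a sum onto a
      trace of the other factor.\<close>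
    have T2: "T i j k * T i j k = (if i = j then s k * T i j k else 0) + (if j = k then s i * T i j k else 0) + (if i = k then s j * T i j k else 0)" for i j k
      by (simp add: T_def distrib_right)
    have tr: "(\<Sum>i\<in>UNIV. T i i k) = (real CARD('n) + 2) * s k" "(\<Sum>i\<in>UNIV. T k i i) = (real CARD('n) + 2) * s k" "(\<Sum>i\<in>UNIV. T i k i) = (real CARD('n) + 2) * s k" for k
      unfolding T_def sum.distrib by (simp_all add: distrib_right)
    have 1: "(\<Sum>i\<in>UNIV. \<Sum>j\<in>UNIV. \<Sum>k\<in>UNIV. if i = j then s k * T i j k else 0) = (real CARD('n) + 2) * N"
    proof -
      have "(\<Sum>i\<in>UNIV. \<Sum>j\<in>UNIV. \<Sum>k\<in>UNIV. if i = j then s k * T i j k else 0)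
        = (\<Sum>i\<in>UNIV. \<Sum>k\<in>UNIV. \<Sum>j\<in>UNIV. if i = j then s k * T i j k else 0)"
        by (intro sum.cong refl sum.swap)
      also have "\<dots> = (\<Sum>i\<in>UNIV. \<Sum>k\<in>UNIV. s k * T i i k)" by simp
      also have "\<dots> = (\<Sum>k\<in>UNIV. \<Sum>i\<in>UNIV. s k * T i i k)" by (rule sum.swap)
      also have "\<dots> = (real CARD('n) + 2) * N"
        by (simp add: sum_distrib_left[symmetric] tr N_def mult_ac) (simp add: sum_distrib_left mult_ac)
      finally show ?thesis .
    qed
    have 2: "(\<Sum>i\<in>UNIV. \<Sum>j\<in>UNIV. \<Sum>k\<in>UNIV. if j = k then s i * T i j k else 0) = (real CARD('n) + 2) * N"
      by (simp add: sum_distrib_left[symmetric] tr N_def mult_ac) (simp add: sum_distrib_left mult_ac)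
    have 3: "(\<Sum>i\<in>UNIV. \<Sum>j\<in>UNIV. \<Sum>k\<in>UNIV. if i = k then s j * T i j k else 0) = (real CARD('n) + 2) * N"
    proof -
      have "(\<Sum>i\<in>UNIV. \<Sum>j\<in>UNIV. \<Sum>k\<in>UNIV. if i = k then s j * T i j k else 0) = (\<Sum>i\<in>UNIV. \<Sum>j\<in>UNIV. s j * T i j i)" by simp
      also have "\<dots> = (\<Sum>j\<in>UNIV. \<Sum>i\<in>UNIV. s j * T i j i)" by (rule sum.swap)
      also have "\<dots> = (real CARD('n) + 2) * N"
        by (simp add: sum_distrib_left[symmetric] tr N_def mult_ac) (simp add: sum_distrib_left mult_ac)
      finally show ?thesis .
    qed
    show ?thesis unfolding inner3_def T2 sum.distrib 1 2 3 by simp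
  qed
  have N: "0 \<le> N" unfolding N_def by (intro sum_nonneg) auto
  \<comment> \<open>The multiple is optimal for n = 4; for smaller n the term in |T|^2 only gets
    smaller.\<close>
  have "0 \<le> inner3 S S + (- 1 / 6)\<^sup>2 * inner3 T T + 2 * (- 1 / 6) * inner3 S T"
    unfolding inner3_add[symmetric] by (rule inner3_nonneg)
  also have "\<dots> = inner3 S S - N + (real CARD('n) + 2) * N / 12"
    unfolding ST TT by (simp add: power2_eq_square)
  also have "\<dots> \<le> inner3 S S - N + 6 * N / 12"
    using n N by (intro add_left_mono divide_right_mono mult_right_mono) auto
  finally show ?thesis by (simp add: N_def s_def power2_eq_square)
qed

text \<open>The same projection for tensors antisymmetric in the outer indices: the product of
  \<open>R\<close> and \<open>T\<close> is 2 |s|^2 and |T|^2 is 2 (n - 1) |s|^2. At n = 4 the best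
  multiple is 1/3 and the constant 2 / (n - 1) is 2/3.\<close>

lemma antisymmetric_trace_bound:
  fixes R :: "'n::finite \<Rightarrow> 'n \<Rightarrow> 'n \<Rightarrow> real"
  assumes n: "CARD('n) \<le> 4" and anti: "\<And>i j k. R i j k = - R k j i"
  shows "2 / 3 * (\<Sum>k\<in>UNIV. (\<Sum>i\<in>UNIV. R i i k)\<^sup>2) \<le> inner3 R R"
proof -
  define s where "s k = (\<Sum>i\<in>UNIV. R i i k)" for k
  define N where "N = (\<Sum>k\<in>UNIV. s k * s k)"
  define T where "T i j k = (if i = j then s k else 0) - (if j = k then s i else 0)" for i j k
  have s': "(\<Sum>i\<in>UNIV. R k i i) = - s k" for k
    unfolding s_def sum_negf[symmetric] by (intro sum.cong refl) (rule anti)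
  have swp: "(\<Sum>i\<in>UNIV. \<Sum>j\<in>UNIV. \<Sum>k\<in>UNIV. if i = j then f i j k else 0) = (\<Sum>k\<in>UNIV. \<Sum>i\<in>UNIV. f i i k)" for f :: "'n \<Rightarrow> 'n \<Rightarrow> 'n \<Rightarrow> real"
  proof -
    have "(\<Sum>i\<in>UNIV. \<Sum>j\<in>UNIV. \<Sum>k\<in>UNIV. if i = j then f i j k else 0) = (\<Sum>i\<in>UNIV. \<Sum>k\<in>UNIV. \<Sum>j\<in>UNIV. if i = j then f i j k else 0)"
      by (intro sum.cong refl sum.swap)
    also have "\<dots> = (\<Sum>i\<in>UNIV. \<Sum>k\<in>UNIV. f i i k)" by simp
    also have "\<dots> = (\<Sum>k\<in>UNIV. \<Sum>i\<in>UNIV. f i i k)" by (rule sum.swap)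
    finally show ?thesis .
  qed
  have RT: "inner3 R T = 2 * N"
  proof -
    have e: "R i j k * T i j k = (if i = j then R i j k * s k else 0) - (if j = k then R i j k * s i else 0)" for i j k
      by (simp add: T_def right_diff_distrib)
    have "inner3 R T = (\<Sum>k\<in>UNIV. (\<Sum>i\<in>UNIV. R i i k) * s k) - (\<Sum>i\<in>UNIV. (\<Sum>j\<in>UNIV. R i j j) * s i)"
      unfolding inner3_def e sum_subtractf swp sum_distrib_right by simp
    also have "\<dots> = 2 * N" unfolding s' s_def[symmetric] N_def by (simp add: sum_negf)
    finally show ?thesis .
  qed
  have TT: "inner3 T T = 2 * (real CARD('n) - 1) * N"
  proof -
    have e: "T i j k * T i j k = (if i = j then s k * T i j k else 0) - (if j = k then s i * T i j k else 0)" for i j k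
      by (simp add: T_def left_diff_distrib)
    have tr: "(\<Sum>i\<in>UNIV. T i i k) = (real CARD('n) - 1) * s k" "(\<Sum>i\<in>UNIV. T k i i) = - (real CARD('n) - 1) * s k" for k
      unfolding T_def sum_subtractf by (simp_all add: left_diff_distrib)
    have "inner3 T T = (\<Sum>k\<in>UNIV. s k * (\<Sum>i\<in>UNIV. T i i k)) - (\<Sum>i\<in>UNIV. s i * (\<Sum>j\<in>UNIV. T i j j))"
      unfolding inner3_def e sum_subtractf swp sum_distrib_left by simp
    also have "\<dots> = (\<Sum>k\<in>UNIV. s k * ((real CARD('n) - 1) * s k)) - (\<Sum>i\<in>UNIV. s i * (- (real CARD('n) - 1) * s i))"
      unfolding tr ..
    also have "\<dots> = 2 * (real CARD('n) - 1) * N"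
      unfolding N_def sum_subtractf[symmetric] sum_distrib_left by (intro sum.cong refl) (simp add: algebra_simps)
    finally show ?thesis .
  qed
  have N: "0 \<le> N" unfolding N_def by (intro sum_nonneg) auto
  have "0 \<le> inner3 R R + (- 1 / 3)\<^sup>2 * inner3 T T + 2 * (- 1 / 3) * inner3 R T"
    unfolding inner3_add[symmetric] by (rule inner3_nonneg)
  also have "\<dots> = inner3 R R - 4 / 3 * N + 2 / 9 * ((real CARD('n) - 1) * N)"
    unfolding RT TT by (simp add: power2_eq_square)
  also have "\<dots> \<le> inner3 R R - 4 / 3 * N + 2 / 9 * (3 * N)"
    using n N by (intro add_left_mono mult_left_mono mult_right_mono) auto
  finally show ?thesis by (simp add: N_def s_def power2_eq_square)
qed

section \<open>The sum-of-squares certificate\<close>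

lemma inner3_add_right: "inner3 X (\<lambda>i j k. Y i j k + Z i j k) = inner3 X Y + inner3 X Z"
  by (simp add: inner3_def distrib_left sum.distrib)

lemma inner3_add_left: "inner3 (\<lambda>i j k. Y i j k + Z i j k) X = inner3 Y X + inner3 Z X"
  by (simp add: inner3_def distrib_right sum.distrib)

lemma inner3_commute: "inner3 X Y = inner3 Y X"
  by (simp add: inner3_def mult.commute)

lemma inner3_swap12: "inner3 X Y = inner3 (\<lambda>i j k. X j i k) (\<lambda>i j k. Y j i k)"
  unfolding inner3_def by (rule sum.swap)

lemma inner3_swap23: "inner3 X Y = inner3 (\<lambda>i j k. X i k j) (\<lambda>i j k. Y i k j)"
  unfolding inner3_def by (intro sum.cong refl sum.swap)

text \<open>Applies when \<open>j\<close> and \<open>k\<close> separate for fixed \<open>i\<close>;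
  the two swap lemmas bring products of \<open>A\<close> and \<open>v\<close> into this
  shape.\<close>

lemma inner3_split:
  assumes "\<And>i j k. X i j k * Y i j k = f i j * g i k"
  shows "inner3 X Y = (\<Sum>i\<in>UNIV. (\<Sum>j\<in>UNIV. f i j) * (\<Sum>k\<in>UNIV. g i k))"
  by (simp add: inner3_def assms sum_product)

text \<open>The coefficients come from rounding the solution of a small semidefinite program for
  dimension 4; the weights in the proof come from rational LDL factorisations of its blocks.\<close>

lemma certificate_arith:
  fixes BB ww bw BAv bb Bvvv rvb avb avw AAr rvw arr ara rrr :: real
  assumes "(bb + 196 / 81 * ww + 49 / 81 * ara + 1 / 36 * rrr + 28 / 9 * bw + 14 / 9 * avb + 1 / 3 * rvb
      + 196 / 81 * avw + 14 / 27 * rvw + 7 / 27 * arr) / 2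
     \<le> BB + 49 / 27 * AAr + 98 / 27 * ww + 1 / 36 * rrr + 14 / 3 * BAv + 1 / 3 * Bvvv + 7 / 9 * rvw"
    and "(4 * ww + ara + 9 / 64 * rrr + 4 * avw + 3 / 2 * rvw + 3 / 4 * arr) / 2
     \<le> 3 * AAr + 6 * ww + 9 / 64 * rrr + 9 / 4 * rvw"
    and "2 / 3 * (ww + ara - 2 * avw) \<le> 2 * AAr - 2 * ww"
    and "0 \<le> bb + 21316 / 6561 * ww + 169 / 6561 * ara + 100 / 729 * rrr + 292 / 81 * bw + 26 / 81 * avb
      + 20 / 27 * rvb + 3796 / 6561 * avw + 2920 / 2187 * rvw + 260 / 2187 * arr"
    and "0 \<le> ww + 47524 / 201601 * ara + 1764 / 201601 * rrr - 436 / 449 * avw - 84 / 449 * rvw + 18312 / 201601 * arr"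
    and "0 \<le> ara + 1849 / 144 * rrr - 43 / 6 * arr"
    and "0 \<le> rrr"
  shows "0 \<le> BB + 2 * (ww + bw + BAv) - 4 / 5 * (BAv - bw + BB - bb)
      - 1 / 6 * (Bvvv + 2 * BAv - rvb - bw - avb) - 1 / 30 * (avw + bw + avb)
      + 1 / 30 * (AAr + 2 * BAv) + 7 / 30 * (rvw + 2 * ww + Bvvv + avw)
      + 1 / 2 * (rvw + 2 * ww + rvb + AAr) - 1 / 30 * (arr + rvb + 2 * avw + ara)
      + 2 / 15 * (rrr + 4 * rvw + arr)"
proof -
  \<comment> \<open>\<open>x1\<close> to \<open>x3\<close> stand for the slacks of the trace
    inequalities, \<open>x4\<close> to \<open>x7\<close> for squares of vectors whose weights are
    the LDL pivots. Keeping them abstract reduces the claim to the signs of the weights.\<close>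
  have comb: "0 \<le> 1 / 5 * x1 + 2 / 405 * x2 + 7 / 90 * x3 + 9 / 10 * x4 + 898 / 3645 * x5 + 1 / 4490 * x6 + 1 / 576 * x7"
    if "0 \<le> x1" "0 \<le> x2" "0 \<le> x3" "0 \<le> x4" "0 \<le> x5" "0 \<le> x6" "0 \<le> x7" for x1 x2 x3 x4 x5 x6 x7 :: real
    using that by simp
  have "BB + 2 * (ww + bw + BAv) - 4 / 5 * (BAv - bw + BB - bb)
      - 1 / 6 * (Bvvv + 2 * BAv - rvb - bw - avb) - 1 / 30 * (avw + bw + avb)
      + 1 / 30 * (AAr + 2 * BAv) + 7 / 30 * (rvw + 2 * ww + Bvvv + avw)
      + 1 / 2 * (rvw + 2 * ww + rvb + AAr) - 1 / 30 * (arr + rvb + 2 * avw + ara)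
      + 2 / 15 * (rrr + 4 * rvw + arr)
    = 1 / 5 * ((BB + 49 / 27 * AAr + 98 / 27 * ww + 1 / 36 * rrr + 14 / 3 * BAv + 1 / 3 * Bvvv + 7 / 9 * rvw) - ((bb + 196 / 81 * ww + 49 / 81 * ara + 1 / 36 * rrr + 28 / 9 * bw + 14 / 9 * avb + 1 / 3 * rvb
      + 196 / 81 * avw + 14 / 27 * rvw + 7 / 27 * arr) / 2)) +
      2 / 405 * ((3 * AAr + 6 * ww + 9 / 64 * rrr + 9 / 4 * rvw) - ((4 * ww + ara + 9 / 64 * rrr + 4 * avw + 3 / 2 * rvw + 3 / 4 * arr) / 2)) +
      7 / 90 * ((2 * AAr - 2 * ww) - (2 / 3 * (ww + ara - 2 * avw))) +
      9 / 10 * (bb + 21316 / 6561 * ww + 169 / 6561 * ara + 100 / 729 * rrr + 292 / 81 * bw + 26 / 81 * avb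
      + 20 / 27 * rvb + 3796 / 6561 * avw + 2920 / 2187 * rvw + 260 / 2187 * arr) +
      898 / 3645 * (ww + 47524 / 201601 * ara + 1764 / 201601 * rrr - 436 / 449 * avw - 84 / 449 * rvw + 18312 / 201601 * arr) +
      1 / 4490 * (ara + 1849 / 144 * rrr - 43 / 6 * arr) +
      1 / 576 * (rrr)"
    by (simp add: ring_distribs add_divide_distrib diff_divide_distrib)
  also have "0 \<le> \<dots>"
    by (rule comb) (use assms in simp_all)
  finally show ?thesis .
qed

section \<open>Pointwise nonnegativity of the third-order integrand\<close>

context heat_flow
begin

lemma w_alt: "(\<Sum>j\<in>UNIV. v j t y * A i j t y) = w i t y" "(\<Sum>j\<in>UNIV. A j i t y * v j t y) = w i t y"
  "(\<Sum>j\<in>UNIV. v j t y * A j i t y) = w i t y"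
  by (simp_all add: w_def mult.commute A_sym[of _ i])

text \<open>\<open>M\<close> is the symmetrisation of A \<otimes> v up to scale. Its remaining part
  is recorded by \<open>R\<close>, which is antisymmetric in the outer indices, hence orthogonal to
  \<open>X\<close>, \<open>M\<close> and \<open>N\<close>, and so gets an inequality of its own. The
  trace inequalities for two symmetric combinations and for \<open>R\<close> leave a quadratic form
  in the vectors \<open>b\<close>, \<open>w\<close>, \<open>a v\<close>, \<open>r v\<close>, which
  is a sum of squares.\<close>

lemma divergence_certificate_nonneg:
  assumes n: "CARD('n) \<le> 4"
  shows "0 \<le> BB t y + 2 * (ww t y + bw t y + BAv t y)
      - 4 / 5 * (BAv t y - bw t y + BB t y - bb t y)
      - 1 / 6 * (Bvvv t y + 2 * BAv t y - r t y * vb t y - bw t y - a t y * vb t y)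
      - 1 / 30 * (a t y * vw t y + bw t y + a t y * vb t y)
      + 1 / 30 * (AA t y * r t y + 2 * BAv t y)
      + 7 / 30 * (r t y * vw t y + 2 * ww t y + Bvvv t y + a t y * vw t y)
      + 1 / 2 * (r t y * vw t y + 2 * ww t y + r t y * vb t y + AA t y * r t y)
      - 1 / 30 * (a t y * r t y * r t y + r t y * vb t y + 2 * (a t y * vw t y) + a t y * r t y * a t y)
      + 2 / 15 * (r t y * r t y * r t y + 4 * (r t y * vw t y) + a t y * r t y * r t y)"
proof -
  define X P1 P2 P3 M N R where "X i j k = B i j k t y" and "P1 i j k = A i j t y * v k t y"
    and "P2 i j k = A j k t y * v i t y" and "P3 i j k = A i k t y * v j t y"
    and "M i j k = P1 i j k + P2 i j k + P3 i j k" and "N i j k = v i t y * v j t y * v k t y"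
    and "R i j k = A i j t y * v k t y + (- 1) * (A k j t y * v i t y)" for i j k
  have Pab: "inner3 P1 P2 = ww t y" "inner3 P1 P3 = ww t y" "inner3 P2 P3 = ww t y"
  proof -
    show "inner3 P1 P2 = ww t y"
      by (subst inner3_swap12, subst inner3_split[where f="\<lambda>i j. A j i t y * v j t y" and g="\<lambda>i k. A i k t y * v k t y"])
        (simp add: P1_def P2_def mult_ac, simp only: w_alt w_def[symmetric] ww_def)
    show "inner3 P1 P3 = ww t y"
      by (subst inner3_split[where f="\<lambda>i j. A i j t y * v j t y" and g="\<lambda>i k. A i k t y * v k t y"])
        (simp add: P1_def P3_def mult_ac, simp only: w_alt w_def[symmetric] ww_def)
    show "inner3 P2 P3 = ww t y"
      by (subst inner3_swap23, subst inner3_swap12, subst inner3_split[where f="\<lambda>i j. A j i t y * v j t y" and g="\<lambda>i k. A k i t y * v k t y"])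
        (simp add: P2_def P3_def mult_ac, simp only: w_alt w_def[symmetric] ww_def)
  qed
  have Paa: "inner3 P1 P1 = AA t y * r t y" "inner3 P2 P2 = AA t y * r t y" "inner3 P3 P3 = AA t y * r t y"
  proof -
    show "inner3 P1 P1 = AA t y * r t y"
      by (subst inner3_split[where f="\<lambda>i j. A i j t y * A i j t y" and g="\<lambda>i k. v k t y * v k t y"])
        (simp add: P1_def P1_def mult_ac, simp only: AA_def r_def sum_distrib_right[symmetric])
    show "inner3 P2 P2 = AA t y * r t y"
      by (subst inner3_swap12, subst inner3_swap23, subst inner3_split[where f="\<lambda>i j. A i j t y * A i j t y" and g="\<lambda>i k. v k t y * v k t y"])
        (simp add: P2_def P2_def mult_ac, simp only: AA_def r_def sum_distrib_right[symmetric])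
    show "inner3 P3 P3 = AA t y * r t y"
      by (subst inner3_swap23, subst inner3_split[where f="\<lambda>i j. A i j t y * A i j t y" and g="\<lambda>i k. v k t y * v k t y"])
        (simp add: P3_def P3_def mult_ac, simp only: AA_def r_def sum_distrib_right[symmetric])
  qed
  have PN: "inner3 P1 N = r t y * vw t y" "inner3 P2 N = r t y * vw t y" "inner3 P3 N = r t y * vw t y"
  proof -
    have vw: "(\<Sum>i\<in>UNIV. (\<Sum>j\<in>UNIV. A i j t y * v j t y * v i t y) * (\<Sum>k\<in>UNIV. v k t y * v k t y)) = r t y * vw t y"
      by (simp only: sum_distrib_right[symmetric] w_def[symmetric] r_def[symmetric] w_v) (rule mult.commute)
    show "inner3 P1 N = r t y * vw t y"
      by (subst inner3_split[where f="\<lambda>i j. A i j t y * v j t y * v i t y" and g="\<lambda>i k. v k t y * v k t y"])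
        (simp add: P1_def N_def mult_ac, simp only: vw)
    show "inner3 P2 N = r t y * vw t y"
      by (subst inner3_swap12, subst inner3_swap23, subst inner3_split[where f="\<lambda>i j. A i j t y * v j t y * v i t y" and g="\<lambda>i k. v k t y * v k t y"])
        (simp add: P2_def N_def mult_ac, simp only: vw)
    show "inner3 P3 N = r t y * vw t y"
      by (subst inner3_swap23, subst inner3_split[where f="\<lambda>i j. A i j t y * v j t y * v i t y" and g="\<lambda>i k. v k t y * v k t y"])
        (simp add: P3_def N_def mult_ac, simp only: vw)
  qed
  have NN: "inner3 N N = r t y * r t y * r t y"
    by (subst inner3_split[where f="\<lambda>i j. v i t y * v i t y * (v j t y * v j t y)" and g="\<lambda>i k. v k t y * v k t y"])
      (simp_all add: N_def sum_distrib_left[symmetric] sum_distrib_right[symmetric] r_def[symmetric] mult_ac)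
  have XX: "inner3 X X = BB t y" by (simp add: inner3_def X_def BB_def)
  have XN: "inner3 X N = Bvvv t y"
    by (simp add: inner3_def X_def N_def Bvvv_def Bvv_def sum_distrib_left mult_ac)
  have XP: "inner3 X P1 = BAv t y" "inner3 X P2 = BAv t y" "inner3 X P3 = BAv t y"
  proof -
    have s: "B j k i t y = B i j k t y" "B j i k t y = B i j k t y" for i j k by (metis B_sym)+
    show x: "inner3 X P2 = BAv t y"
      by (simp add: inner3_def X_def P2_def BAv_def BA_def sum_distrib_left mult_ac)
    show "inner3 X P1 = BAv t y"
      unfolding x[symmetric] by (subst inner3_swap23, subst inner3_swap12) (simp add: inner3_def X_def P1_def P2_def s)
    show "inner3 X P3 = BAv t y"
      unfolding x[symmetric] by (subst inner3_swap12) (simp add: inner3_def X_def P3_def P2_def s)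
  qed
  have M: "inner3 X M = 3 * BAv t y" "inner3 M N = 3 * (r t y * vw t y)" "inner3 M M = 3 * (AA t y * r t y) + 6 * ww t y"
    unfolding M_def[abs_def] inner3_add_left inner3_add_right
    using Pab Paa PN XP inner3_commute[of P2 P1] inner3_commute[of P3 P1] inner3_commute[of P3 P2] by simp_all
  have RR: "inner3 R R = 2 * (AA t y * r t y) - 2 * ww t y"
  proof -
    have "R = (\<lambda>i j k. P1 i j k + (- 1) * P2 i j k)" 
      by (simp add: R_def[abs_def] P1_def P2_def A_sym)
    then show ?thesis using Pab Paa by (simp only: inner3_add) simp
  qed
  have trM: "(\<Sum>i\<in>UNIV. M i i k) = a t y * v k t y + 2 * w k t y" for k
    by (simp add: M_def P1_def P2_def P3_def sum.distrib sum_distrib_right[symmetric] a_def[symmetric])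
      (simp add: w_def A_sym[of _ k] sum_distrib_left mult_ac)
  have trN: "(\<Sum>i\<in>UNIV. N i i k) = r t y * v k t y" for k
    by (simp add: N_def r_def sum_distrib_right)
  have trX: "(\<Sum>i\<in>UNIV. X i i k) = b k t y" for k
    by (simp add: X_def B_trace)
  have trR: "(\<Sum>i\<in>UNIV. R i i k) = a t y * v k t y - w k t y" for k
    by (simp add: R_def sum_subtractf sum_distrib_right[symmetric] a_def[symmetric] w_def A_sym[of _ k])
  have symM: "M i j k = M j i k" "M i j k = M i k j" for i j k
    by (simp_all add: M_def P1_def P2_def P3_def A_sym)
  have symN: "N i j k = N j i k" "N i j k = N i k j" for i j k
    by (simp_all add: N_def)
  have symX: "X i j k = X j i k" "X i j k = X i k j" for i j k
    unfolding X_def by (rule B_sym)+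
  \<comment> \<open>Trace vectors of \<open>X + 7/9 M + 1/6 N\<close> and \<open>M + 3/8 N\<close>;
    the coefficients are rows of the unit triangular factor for the block of symmetric
    tensors.\<close>
  define s1 s2 where "s1 k = b k t y + 7 / 9 * (a t y * v k t y + 2 * w k t y) + 1 / 6 * (r t y * v k t y)"
    and "s2 k = a t y * v k t y + 2 * w k t y + 3 / 8 * (r t y * v k t y)" for k
  have S1: "(\<Sum>k\<in>UNIV. (s1 k)\<^sup>2) / 2 \<le> BB t y + (7 / 9)\<^sup>2 * (3 * (AA t y * r t y) + 6 * ww t y)
     + (1 / 6)\<^sup>2 * (r t y * r t y * r t y) + 2 * (7 / 9) * (3 * BAv t y) + 2 * (1 / 6) * Bvvv t y
     + 2 * (7 / 9) * (1 / 6) * (3 * (r t y * vw t y))"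
  proof -
    have "s1 k = (\<Sum>i\<in>UNIV. X i i k + 7 / 9 * M i i k + 1 / 6 * N i i k)" for k
      by (simp only: s1_def sum.distrib sum_distrib_left[symmetric] trX trM trN)
    then show ?thesis
      using symmetric_trace_bound[OF n, of "\<lambda>i j k. X i j k + 7 / 9 * M i j k + 1 / 6 * N i j k"] symX symM symN
      unfolding inner3_combine M XX XN NN by simp
  qed
  have S2: "(\<Sum>k\<in>UNIV. (s2 k)\<^sup>2) / 2 \<le> 3 * (AA t y * r t y) + 6 * ww t y + (3 / 8)\<^sup>2 * (r t y * r t y * r t y)
     + 2 * (3 / 8) * (3 * (r t y * vw t y))"
  proof -
    have "s2 k = (\<Sum>i\<in>UNIV. M i i k + 3 / 8 * N i i k)" for k
      by (simp only: s2_def sum.distrib sum_distrib_left[symmetric] trM trN)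
    then show ?thesis
      using symmetric_trace_bound[OF n, of "\<lambda>i j k. M i j k + 3 / 8 * N i j k"] symM symN
      unfolding inner3_add M NN by simp
  qed
  have S3: "2 / 3 * (\<Sum>k\<in>UNIV. (a t y * v k t y - w k t y)\<^sup>2) \<le> 2 * (AA t y * r t y) - 2 * ww t y"
    using antisymmetric_trace_bound[OF n, of R] unfolding trR RR by (simp add: R_def)
  have quad: "(\<Sum>k\<in>UNIV. (c1 * b k t y + c2 * w k t y + c3 * (a t y * v k t y) + c4 * (r t y * v k t y))\<^sup>2)
     = c1\<^sup>2 * bb t y + c2\<^sup>2 * ww t y + c3\<^sup>2 * (a t y * r t y * a t y) + c4\<^sup>2 * (r t y * r t y * r t y)
      + 2 * c1 * c2 * bw t y + 2 * c1 * c3 * (a t y * vb t y) + 2 * c1 * c4 * (r t y * vb t y)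
      + 2 * c2 * c3 * (a t y * vw t y) + 2 * c2 * c4 * (r t y * vw t y) + 2 * c3 * c4 * (a t y * r t y * r t y)" for c1 c2 c3 c4
  proof -
    have "(\<Sum>k\<in>UNIV. (c1 * f k + c2 * g k + d * h k)\<^sup>2) = c1\<^sup>2 * (\<Sum>k\<in>UNIV. f k * f k) + c2\<^sup>2 * (\<Sum>k\<in>UNIV. g k * g k)
      + d\<^sup>2 * (\<Sum>k\<in>UNIV. h k * h k) + 2 * c1 * c2 * (\<Sum>k\<in>UNIV. f k * g k) + 2 * c1 * d * (\<Sum>k\<in>UNIV. h k * f k)
      + 2 * c2 * d * (\<Sum>k\<in>UNIV. h k * g k)" for d and f g h :: "'n \<Rightarrow> real"
      by (simp add: sum_distrib_left flip: sum.distrib) (simp add: algebra_simps power2_eq_square)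
    \<comment> \<open>\<open>a v\<close> and \<open>r v\<close> are multiples of the same vector, so
      an expansion in three vectors suffices.\<close>
    from this[of "\<lambda>k. b k t y" "\<lambda>k. w k t y" "c3 * a t y + c4 * r t y" "\<lambda>k. v k t y"]
    show ?thesis
      unfolding bb_def[symmetric] ww_def[symmetric] bw_def[symmetric] r_def[symmetric] vb_def[symmetric] vw_def[symmetric]
      by (simp add: algebra_simps power2_eq_square)
  qed
  have q1: "(\<Sum>k\<in>UNIV. (s1 k)\<^sup>2) = (\<Sum>k\<in>UNIV. (1 * b k t y + 14 / 9 * w k t y + 7 / 9 * (a t y * v k t y) + 1 / 6 * (r t y * v k t y))\<^sup>2)"
    by (simp add: s1_def algebra_simps)
  have q2: "(\<Sum>k\<in>UNIV. (s2 k)\<^sup>2) = (\<Sum>k\<in>UNIV. (0 * b k t y + 2 * w k t y + 1 * (a t y * v k t y) + 3 / 8 * (r t y * v k t y))\<^sup>2)"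
    by (simp add: s2_def algebra_simps)
  have q3: "(\<Sum>k\<in>UNIV. (a t y * v k t y - w k t y)\<^sup>2) = (\<Sum>k\<in>UNIV. (0 * b k t y + (- 1) * w k t y + 1 * (a t y * v k t y) + 0 * (r t y * v k t y))\<^sup>2)"
    by simp
  have sq: "0 \<le> (\<Sum>k\<in>UNIV. (c1 * b k t y + c2 * w k t y + c3 * (a t y * v k t y) + c4 * (r t y * v k t y))\<^sup>2)" for c1 c2 c3 c4
    by (intro sum_nonneg) auto
  have rrr: "0 \<le> r t y * r t y * r t y"
  proof -
    have "0 \<le> r t y" unfolding r_def by (intro sum_nonneg) simp
    then show ?thesis by simp
  qed
  \<comment> \<open>The arguments of \<open>sq\<close> are the rows of the unit triangular factor
    for the four vectors; the last square is that of \<open>r v\<close>, which sums to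
    \<open>rrr\<close>.\<close>
  note lin = S1[unfolded q1 quad, unfolded power2_eq_square] S2[unfolded q2 quad, unfolded power2_eq_square] S3[unfolded q3 quad, unfolded power2_eq_square]
    sq[of 1 "146 / 81" "13 / 81" "10 / 27", unfolded quad, unfolded power2_eq_square]
    sq[of 0 1 "- 218 / 449" "- 42 / 449", unfolded quad, unfolded power2_eq_square]
    sq[of 0 0 1 "- 43 / 12", unfolded quad, unfolded power2_eq_square] rrr
  show ?thesis
    by (rule certificate_arith) (use lin in \<open>simp_all add: algebra_simps\<close>)
qed

lemma third_derivative_expectation_nonneg:
  assumes n: "CARD('n) \<le> 4" and t: "0 < t"
  shows "0 \<le> ev BB t - 2 * ev AAA t"
proof -
  define f1 where "f1 t y = BB t y + 2 * (ww t y + bw t y + BAv t y)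
      - 4 / 5 * (BAv t y - bw t y + BB t y - bb t y)
      - 1 / 6 * (Bvvv t y + 2 * BAv t y - r t y * vb t y - bw t y - a t y * vb t y)
      - 1 / 30 * (a t y * vw t y + bw t y + a t y * vb t y)
      + 1 / 30 * (AA t y * r t y + 2 * BAv t y)
      + 7 / 30 * (r t y * vw t y + 2 * ww t y + Bvvv t y + a t y * vw t y)
      + 1 / 2 * (r t y * vw t y + 2 * ww t y + r t y * vb t y + AA t y * r t y)
      - 1 / 30 * (a t y * r t y * r t y + r t y * vb t y + 2 * (a t y * vw t y) + a t y * r t y * a t y)
      + 2 / 15 * (r t y * r t y * r t y + 4 * (r t y * vw t y) + a t y * r t y * r t y)" for t y
  note mod = moderate_tensors moderate_EA moderate_Evv
  have "0 \<le> ev f1 t"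
    unfolding ev_def f1_def
    by (intro integral_nonneg_AE AE_I2 mult_nonneg_nonneg u_nonneg divergence_certificate_nonneg[OF n])
  moreover
  define f0 where "f0 t y = BB t y - 2 * AAA t y" for t y
  define g1 g2 g3 g4 where "g1 t y = ww t y + (bw t y + (BAv t y + AAA t y))"
    and "g2 t y = BAv t y + (EA t y + BB t y)" and "g3 t y = bw t y + (bb t y + EA t y)"
    and "g4 t y = Bvvv t y + (Evv t y + 2 * BAv t y)" for t y
  define g5 g6 g7 g8 where "g5 t y = vb t y * r t y + (bw t y + Evv t y) + vb t y * a t y"
    and "g6 t y = a t y * vw t y + bw t y + a t y * (vb t y + AA t y)"
    and "g7 t y = AA t y * r t y + 2 * BAv t y + AA t y * a t y"
    and "g8 t y = vw t y * r t y + (2 * ww t y + Bvvv t y) + vw t y * a t y" for t y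
  define g9 g10 g11 where "g9 t y = r t y * vw t y + 2 * ww t y + r t y * (vb t y + AA t y)"
    and "g10 t y = a t y * r t y * r t y + (r t y * vb t y + 2 * (a t y * vw t y)) + a t y * r t y * a t y"
    and "g11 t y = r t y * r t y * r t y + 4 * (r t y * vw t y) + r t y * r t y * a t y" for t y
  note g = g1_def g2_def g3_def g4_def g5_def g6_def g7_def g8_def g9_def g10_def g11_def
  have m: "moderate g1" "moderate g2" "moderate g3" "moderate g4" "moderate g5" "moderate g6" "moderate g7"
    "moderate g8" "moderate g9" "moderate g10" "moderate g11" "moderate f0"
    unfolding g[abs_def] f0_def[abs_def] by (intro mod)+
  have z: "ev g1 t = 0" "ev g2 t = 0" "ev g3 t = 0" "ev g4 t = 0" "ev g5 t = 0" "ev g6 t = 0" "ev g7 t = 0"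
    "ev g8 t = 0" "ev g9 t = 0" "ev g10 t = 0" "ev g11 t = 0"
    unfolding g[abs_def]
    using ev_Aw[OF t] ev_BA[OF t] ev_Ab[OF t] ev_Bvv[OF t] ev_vbv[OF t] ev_aw[OF t] ev_AAv[OF t] ev_vwv[OF t]
      ev_rw[OF t] ev_arv[OF t] ev_rrv[OF t] by simp_all
  \<comment> \<open>Weight 2 on \<open>g1\<close> cancels \<open>AAA\<close>. The opposite weights
    on \<open>g2\<close> and \<open>g3\<close> cancel \<open>EA\<close>, those on \<open>g4\<close>
    and \<open>g5\<close> cancel \<open>Evv\<close>, and those on \<open>g6\<close> and
    \<open>g7\<close> cancel the product of \<open>a\<close> and \<open>AA\<close>.\<close>
  have "f1 = (\<lambda>t y. f0 t y + 2 * g1 t y + (- 4 / 5) * g2 t y + 4 / 5 * g3 t y + (- 1 / 6) * g4 t y + 1 / 6 * g5 t y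
      + (- 1 / 30) * g6 t y + 1 / 30 * g7 t y + 7 / 30 * g8 t y + 1 / 2 * g9 t y + (- 1 / 30) * g10 t y + 2 / 15 * g11 t y)"
    unfolding f1_def f0_def g by (intro ext) (simp add: algebra_simps add_divide_distrib diff_divide_distrib)
  then have "ev f1 t = ev f0 t"
    using t by (simp only: ev_add ev_cmult z mod m)
  also have "ev f0 t = ev BB t - 2 * ev AAA t"
    using ev_add[OF moderate_BB moderate_mult[OF moderate_const[of "- 2"] moderate_AAA] t] ev_cmult[of "- 2" AAA t]
    by (simp add: f0_def[abs_def])
  ultimately show ?thesis by simp
qed

end

section \<open>Entropy\<close>

text \<open>The derivative - ln (x / C) - 1 is nonnegative up to C / e. The bound ln y \<le> y - 1
  for y = z / x replaces the integration of this derivative.\<close>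

lemma neg_mult_ln_mono:
  fixes x z C :: real
  assumes "0 < x" "x \<le> z" "0 < C" "z \<le> C * exp (- 1)"
  shows "- (x * ln (x / C)) \<le> - (z * ln (z / C))"
proof -
  have z: "0 < z" using assms by simp
  have "ln (z / C) \<le> ln (exp (- 1))"
    using z assms by (subst ln_le_cancel_iff) (auto simp: field_simps)
  then have lz: "ln (z / C) \<le> - 1" by simp
  have "ln (z / x) \<le> z / x - 1" using z assms by (intro ln_le_minus_one) auto
  then have "x * ln (z / x) \<le> x * (z / x - 1)" using assms by (intro mult_left_mono) auto
  then have 1: "x * ln (z / x) \<le> z - x" using assms by (simp add: right_diff_distrib)
  have 2: "ln (x / C) = ln (z / C) - ln (z / x)" using z assms by (simp add: ln_div)
  have "(z - x) * 1 \<le> (z - x) * (- ln (z / C))" using lz assms by (intro mult_left_mono) auto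
  then show ?thesis using 1 unfolding 2 by (simp add: algebra_simps)
qed

lemma nn_integral_gaussian_density_rescale:
  fixes f :: "real ^ 'n \<Rightarrow> ennreal"
  assumes s: "0 < s" and b: "0 < b" and [measurable]: "f \<in> borel_measurable borel"
  shows "(\<integral>\<^sup>+z. ennreal (gaussian_density b z) * f (sqrt (s / b) *\<^sub>R z) \<partial>lborel)
    = (\<integral>\<^sup>+z. ennreal (gaussian_density s z) * f z \<partial>lborel)"
proof -
  define \<theta> where "\<theta> = sqrt (s / b)"
  have th: "\<theta> > 0" using s b by (simp add: \<theta>_def)
  have g: "\<theta> ^ CARD('n) * gaussian_density s (\<theta> *\<^sub>R z) = gaussian_density b z" for z :: "real ^ 'n"
  proof -
    have 1: "\<theta> ^ CARD('n) = (s / b) powr (real CARD('n) / 2)"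
      using s b by (simp add: \<theta>_def powr_half_sqrt[symmetric] powr_realpow[symmetric] powr_powr)
    have 2: "(norm (\<theta> *\<^sub>R z))\<^sup>2 / (2 * s) = (norm z)\<^sup>2 / (2 * b)"
      using s b by (simp add: \<theta>_def power_mult_distrib)
    have 3: "(s / b) powr (real CARD('n) / 2) * (1 / (2 * pi * s) powr (real CARD('n) / 2))
        = 1 / (2 * pi * b) powr (real CARD('n) / 2)"
      using s b by (simp add: powr_divide powr_mult)
    show ?thesis unfolding gaussian_density_def 1 3[symmetric] using 2 by simp
  qed
  have "(\<integral>\<^sup>+z. ennreal (gaussian_density s z) * f z \<partial>lborel)
    = (\<integral>\<^sup>+z. ennreal (gaussian_density s z) * f z \<partial>density (distr lborel borel (\<lambda>x. 0 + \<theta> *\<^sub>R x)) (\<lambda>_. ennreal (\<bar>\<theta>\<bar> ^ DIM(real ^ 'n))))"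
    using lborel_affine[of \<theta> "0 :: real ^ 'n"] th by simp
  also have "\<dots> = (\<integral>\<^sup>+z. ennreal (\<theta> ^ CARD('n)) * (ennreal (gaussian_density s (\<theta> *\<^sub>R z)) * f (\<theta> *\<^sub>R z)) \<partial>lborel)"
    using th by (simp add: nn_integral_density nn_integral_distr)
  also have "\<dots> = (\<integral>\<^sup>+z. ennreal (gaussian_density b z) * f (\<theta> *\<^sub>R z) \<partial>lborel)"
    using th by (simp add: g[symmetric] ennreal_mult gaussian_density_nonneg mult.assoc)
  finally show ?thesis by (simp add: \<theta>_def)
qed

section \<open>Finiteness of the entropy at all times\<close>

context heat_flow
begin

definition finite_entropy :: "real \<Rightarrow> bool" where
  "finite_entropy t \<longleftrightarrow> integrable lborel (\<lambda>y. u t y * ln (u t y))"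

text \<open>Since \<open>u s0 \<le> \<kappa> * u s1\<close> and \<open>x \<mapsto> - x ln (x / C)\<close> increases up to \<open>C / e\<close>, a large
  normalisation \<open>C\<close> allows a pointwise comparison of the entropy integrands.\<close>

lemma finite_entropy_downward:
  assumes s: "0 < s0" "s0 \<le> s1" and fin: "finite_entropy s1"
  shows "finite_entropy s0"
proof -
  define \<kappa> where "\<kappa> = (s1 / s0) powr (real CARD('n) / 2)"
  define K where "K = 1 / (2 * pi * s1) powr (real CARD('n) / 2)"
  have s1: "0 < s1" using s by simp
  have pos: "0 < \<kappa>" "0 < K" using s s1 by (simp_all add: \<kappa>_def K_def)
  \<comment> \<open>Places the end of the increasing range, C / e, exactly at
    \<open>\<kappa> * K\<close>, an upper bound for \<open>\<kappa> * u s1 y\<close>.\<close>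
  define C where "C = exp 1 * \<kappa> * K"
  have C: "0 < C" "C * exp (- 1) = \<kappa> * K" using pos by (simp_all add: C_def flip: exp_add)
  have le: "u s0 y \<le> \<kappa> * u s1 y" for y unfolding \<kappa>_def by (rule u_mono_scaled[OF s])
  have leK: "\<kappa> * u s1 y \<le> \<kappa> * K" for y 
    using pos unfolding K_def by (intro mult_left_mono u_le s1) auto
  have u0: "0 < u s0 y" "0 < u s1 y" for y using u_pos s s1 by auto
  have mono: "- (u s0 y * ln (u s0 y / C)) \<le> - (\<kappa> * u s1 y * ln (\<kappa> * u s1 y / C))" for y
    by (rule neg_mult_ln_mono) (use u0 le leK C in auto)
  have nonneg: "0 \<le> - (u s0 y * ln (u s0 y / C))" for y
  proof -
    have "C * exp (- 1) \<le> C * 1" using C by (intro mult_left_mono) auto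
    then have "u s0 y \<le> C" using order_trans[OF le leK, of y] C by linarith
    then have "ln (u s0 y / C) \<le> 0" using u0[of y] C by (subst ln_le_zero_iff) auto
    then show ?thesis using u0[of y] by (simp add: mult_nonneg_nonpos)
  qed
  have "integrable lborel (\<lambda>y. - (u s0 y * ln (u s0 y / C)))"
  proof (rule Bochner_Integration.integrable_bound)
    have "integrable lborel (\<lambda>y. - \<kappa> * (u s1 y * ln (u s1 y)) - \<kappa> * ln (\<kappa> / C) * u s1 y)"
      using fin integrable_u[OF s1] unfolding finite_entropy_def by (intro Bochner_Integration.integrable_diff integrable_mult_right) auto
    also have "(\<lambda>y. - \<kappa> * (u s1 y * ln (u s1 y)) - \<kappa> * ln (\<kappa> / C) * u s1 y) = (\<lambda>y. - (\<kappa> * u s1 y * ln (\<kappa> * u s1 y / C)))"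
      using u0 pos C by (intro ext) (simp add: ln_div ln_mult algebra_simps)
    finally show "integrable lborel (\<lambda>y. - (\<kappa> * u s1 y * ln (\<kappa> * u s1 y / C)))" .
    show "AE y in lborel. norm (- (u s0 y * ln (u s0 y / C))) \<le> norm (- (\<kappa> * u s1 y * ln (\<kappa> * u s1 y / C)))"
    proof (intro AE_I2)
      fix y
      show "norm (- (u s0 y * ln (u s0 y / C))) \<le> norm (- (\<kappa> * u s1 y * ln (\<kappa> * u s1 y / C)))"
        using nonneg[of y] mono[of y] unfolding real_norm_def by linarith
    qed
  qed measurable
  then have "integrable lborel (\<lambda>y. ln C * u s0 y - (- (u s0 y * ln (u s0 y / C))))"
    using integrable_u[OF s(1)] by (intro Bochner_Integration.integrable_diff integrable_mult_right) auto
  moreover have "ln C * u s0 y - (- (u s0 y * ln (u s0 y / C))) = u s0 y * ln (u s0 y)" for y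
    using u0[of y] C by (simp add: ln_div algebra_simps)
  ultimately show ?thesis by (simp add: finite_entropy_def)
qed

text \<open>Compare \<open>ln (u a)\<close> at \<open>x + z\<close> with \<open>ln (u (a / 2))\<close> at \<open>x + \<theta> z\<close>, where \<open>\<theta>\<close> rescales
  the Gaussian of variance \<open>b\<close> to variance \<open>a / 2\<close>.\<close>

lemma integrable_u_ln_u_double:
  fixes a b :: real
  assumes a: "0 < a" and b: "0 < b" and fin: "finite_entropy (a / 2)"
  shows "integrable lborel (\<lambda>y. u b y * ln (u a y))"
proof -
  define s where "s = a / 2"
  have s: "0 < s" using a by (simp add: s_def)
  \<comment> \<open>The sum bounds both densities at once, so that \<open>l\<close> is nonnegative
    at the times \<open>s\<close> and \<open>a\<close> and nonnegative integrals can be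
    used.\<close>
  define K where "K = 1 / (2 * pi * s) powr (real CARD('n) / 2) + 1 / (2 * pi * a) powr (real CARD('n) / 2)"
  define l where "l t y = ln K - ln (u t y)" for t y
  have Ks: "0 < 1 / (2 * pi * s) powr (real CARD('n) / 2)" "0 < 1 / (2 * pi * a) powr (real CARD('n) / 2)"
    using s a by simp_all
  then have K: "0 < K" unfolding K_def by linarith
  have "u s y \<le> K" "u a y \<le> K" for y
    using u_le[OF s, of y] u_le[OF a, of y] Ks unfolding K_def by linarith+
  then have l: "0 \<le> l s y" "0 \<le> l a y" for y
    using u_pos[OF s, of y] u_pos[OF a, of y] K by (simp_all add: l_def)
  have [measurable]: "l t \<in> borel_measurable borel" for t unfolding l_def by measurable
  define \<theta> where "\<theta> = sqrt (s / b)"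
  \<comment> \<open>The Harnack price for the points \<open>x + z\<close> and
    \<open>x + \<theta> z\<close>, whose difference is \<open>(1 - \<theta>) z\<close>.\<close>
  define \<kappa> where "\<kappa> = (1 - \<theta>)\<^sup>2 / a"
  define c where "c = real CARD('n) / 2 * ln 2"
  have c: "0 \<le> c" "0 \<le> \<kappa>" using a by (simp_all add: c_def \<kappa>_def)
  define E where "E = 2 powr (real CARD('n) / 2)"
  have comp: "l a (x + z) \<le> c + \<kappa> * (norm z)\<^sup>2 + l s (x + \<theta> *\<^sub>R z)" for x z
  proof -
    have n: "(norm (x + z - (x + \<theta> *\<^sub>R z)))\<^sup>2 / a = \<kappa> * (norm z)\<^sup>2"
    proof -
      have "x + z - (x + \<theta> *\<^sub>R z) = (1 - \<theta>) *\<^sub>R z" by (simp add: algebra_simps)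
      then show ?thesis by (simp add: \<kappa>_def power_mult_distrib)
    qed
    have "exp (- (\<kappa> * (norm z)\<^sup>2)) * u s (x + \<theta> *\<^sub>R z) \<le> E * u a (x + z)"
      using u_harnack[OF a, of "x + z" "x + \<theta> *\<^sub>R z"] unfolding minus_divide_left[symmetric] n s_def E_def .
    then have "ln (exp (- (\<kappa> * (norm z)\<^sup>2)) * u s (x + \<theta> *\<^sub>R z)) \<le> ln (E * u a (x + z))"
      using u_pos[OF s] u_pos[OF a] by (subst ln_le_cancel_iff) (auto simp: E_def)
    then have "- (\<kappa> * (norm z)\<^sup>2) + ln (u s (x + \<theta> *\<^sub>R z)) \<le> c + ln (u a (x + z))"
      using u_pos[OF s, of "x + \<theta> *\<^sub>R z"] u_pos[OF a, of "x + z"] by (simp add: ln_mult E_def c_def ln_powr)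
    then show ?thesis by (simp add: l_def)
  qed
  \<comment> \<open>Doubling the variance releases a factor exp(-x) with |z|^2 = 4 b x, and x
    exp(-x) is at most 1.\<close>
  have quad: "gaussian_density b z * (c + \<kappa> * (norm z)\<^sup>2) \<le> (c + 4 * b * \<kappa>) * E * gaussian_density (2 * b) z" for z :: "real ^ 'n"
  proof -
    define x where "x = (norm z)\<^sup>2 / (4 * b)"
    have x: "0 \<le> x" "(norm z)\<^sup>2 = 4 * b * x" using b by (simp_all add: x_def)
    have "gaussian_density b z = E * gaussian_density (2 * b) z * exp (- x)"
    proof -
      have "(2 * pi * (2 * b)) powr (real CARD('n) / 2) = E * (2 * pi * b) powr (real CARD('n) / 2)"
        using powr_mult[of 2 "2 * pi * b" "real CARD('n) / 2"] b by (simp add: mult_ac E_def)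
      moreover have "- (norm z)\<^sup>2 / (2 * b) = - (norm z)\<^sup>2 / (2 * (2 * b)) + - x"
        using b by (simp add: x_def field_simps)
      moreover have "E > 0" by (simp add: E_def)
      ultimately show ?thesis unfolding gaussian_density_def by (simp only: exp_add) simp
    qed
    moreover have "exp (- x) * (c + \<kappa> * (norm z)\<^sup>2) \<le> c + 4 * b * \<kappa>"
    proof -
      have "x * exp (- x) \<le> 1"
      proof -
        have "x \<le> exp x" using exp_ge_add_one_self[of x] by linarith
        then show ?thesis by (simp add: exp_minus divide_simps)
      qed
      then have "(4 * b * \<kappa>) * (x * exp (- x)) \<le> (4 * b * \<kappa>) * 1" using b c by (intro mult_left_mono) auto
      moreover have "c * exp (- x) \<le> c * 1" using c x by (intro mult_left_mono) auto
      ultimately show ?thesis unfolding x(2) by (simp add: algebra_simps)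
    qed
    ultimately show ?thesis
      using mult_left_mono[of "exp (- x) * (c + \<kappa> * (norm z)\<^sup>2)" "c + 4 * b * \<kappa>" "E * gaussian_density (2 * b) z"]
        gaussian_density_nonneg[of "2 * b" z] by (simp add: E_def mult_ac)
  qed
  define C where "C = (c + 4 * b * \<kappa>) * E"
  have C: "0 \<le> C" using b c by (simp add: C_def E_def)
  have "(\<integral>\<^sup>+y. ennreal (u b y) * ennreal (l a y) \<partial>lborel)
     = (\<integral>\<^sup>+x. (\<integral>\<^sup>+z. ennreal (gaussian_density b z) * ennreal (l a (x + z)) \<partial>lborel) \<partial>\<mu>)"
    by (rule nn_integral_u_mult[OF b]) measurable
  also have "\<dots> \<le> (\<integral>\<^sup>+x. (\<integral>\<^sup>+z. ennreal C * ennreal (gaussian_density (2 * b) z)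
       + ennreal (gaussian_density b z) * ennreal (l s (x + \<theta> *\<^sub>R z)) \<partial>lborel) \<partial>\<mu>)"
  proof (intro nn_integral_mono)
    fix x z :: "real ^ 'n"
    have "gaussian_density b z * l a (x + z) \<le> gaussian_density b z * (c + \<kappa> * (norm z)\<^sup>2 + l s (x + \<theta> *\<^sub>R z))"
      by (intro mult_left_mono comp gaussian_density_nonneg)
    also have "\<dots> \<le> C * gaussian_density (2 * b) z + gaussian_density b z * l s (x + \<theta> *\<^sub>R z)"
      using quad[of z] by (simp add: C_def distrib_left)
    finally have "ennreal (gaussian_density b z * l a (x + z)) \<le> ennreal (C * gaussian_density (2 * b) z + gaussian_density b z * l s (x + \<theta> *\<^sub>R z))"
      by (rule ennreal_leI)
    then show "ennreal (gaussian_density b z) * ennreal (l a (x + z)) \<le> ennreal C * ennreal (gaussian_density (2 * b) z)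
       + ennreal (gaussian_density b z) * ennreal (l s (x + \<theta> *\<^sub>R z))"
      using C l by (simp add: ennreal_mult ennreal_plus gaussian_density_nonneg)
  qed
  \<comment> \<open>After rescaling, the noise has variance \<open>s\<close> in place of
    \<open>b\<close>, so the logarithm at time \<open>s\<close> is integrated against the density at
    the same time. This is where finiteness of the entropy at \<open>s\<close> applies.\<close>
  also have "\<dots> = (\<integral>\<^sup>+x. ennreal C + (\<integral>\<^sup>+z. ennreal (gaussian_density s z) * ennreal (l s (x + z)) \<partial>lborel) \<partial>\<mu>)"
  proof (intro nn_integral_cong)
    fix x
    have "(\<integral>\<^sup>+z. ennreal (gaussian_density b z) * ennreal (l s (x + \<theta> *\<^sub>R z)) \<partial>lborel)
       = (\<integral>\<^sup>+z. ennreal (gaussian_density s z) * ennreal (l s (x + z)) \<partial>lborel)"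
      unfolding \<theta>_def by (rule nn_integral_gaussian_density_rescale[OF s b, of "\<lambda>z. ennreal (l s (x + z))"]) measurable
    then show "(\<integral>\<^sup>+z. ennreal C * ennreal (gaussian_density (2 * b) z)
       + ennreal (gaussian_density b z) * ennreal (l s (x + \<theta> *\<^sub>R z)) \<partial>lborel)
      = ennreal C + (\<integral>\<^sup>+z. ennreal (gaussian_density s z) * ennreal (l s (x + z)) \<partial>lborel)"
      using b by (simp add: nn_integral_add nn_integral_cmult nn_integral_gaussian_density)
  qed
  also have "\<dots> = ennreal C + (\<integral>\<^sup>+y. ennreal (u s y) * ennreal (l s y) \<partial>lborel)"
    by (subst nn_integral_add) (simp_all add: nn_integral_u_mult[OF s] emeasure_space_1[simplified])
  also have "(\<integral>\<^sup>+y. ennreal (u s y) * ennreal (l s y) \<partial>lborel) < \<infinity>"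
  proof -
    have i: "integrable lborel (\<lambda>y. u s y * l s y)"
      using fin integrable_u[OF s] unfolding finite_entropy_def s_def[symmetric] l_def
      by (simp add: right_diff_distrib)
    have "(\<integral>\<^sup>+y. ennreal (u s y) * ennreal (l s y) \<partial>lborel) = (\<integral>\<^sup>+y. ennreal (u s y * l s y) \<partial>lborel)"
      using l u_nonneg by (simp add: ennreal_mult)
    also have "\<dots> = ennreal (\<integral>y. u s y * l s y \<partial>lborel)"
      using l u_nonneg by (intro nn_integral_eq_integral i) auto
    finally show ?thesis by simp
  qed
  then have "ennreal C + (\<integral>\<^sup>+y. ennreal (u s y) * ennreal (l s y) \<partial>lborel) < \<infinity>" by simp
  finally have "(\<integral>\<^sup>+y. ennreal (u b y * l a y) \<partial>lborel) < \<infinity>"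
    using l u_nonneg by (simp add: ennreal_mult)
  then have "integrable lborel (\<lambda>y. u b y * l a y)"
    by (intro integrableI_nonneg) (use l u_nonneg in auto)
  then have "integrable lborel (\<lambda>y. ln K * u b y - u b y * l a y)"
    using integrable_u[OF b] by (intro Bochner_Integration.integrable_diff integrable_mult_right) auto
  then show ?thesis by (simp add: l_def algebra_simps)
qed

text \<open>With both arguments equal, \<open>integrable_u_ln_u_double\<close> passes from a time to
  its double, so finiteness reaches arbitrarily late times; \<open>finite_entropy_downward\<close>
  then covers everything before them.\<close>

lemma finite_entropy_everywhere:
  assumes "finite_entropy s" "0 < s" "0 < t"
  shows "finite_entropy t"
proof -
  have pow: "finite_entropy (2 ^ k * s)" for k
  proof (induction k)
    case (Suc k)
    then have "finite_entropy ((2 ^ Suc k * s) / 2)" by simp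
    then show ?case
      using integrable_u_ln_u_double[of "2 ^ Suc k * s" "2 ^ Suc k * s"] assms by (simp add: finite_entropy_def)
  qed (use assms in simp)
  obtain k where "t / s < 2 ^ k" using real_arch_pow[of 2 "t / s"] by auto
  then have "t \<le> 2 ^ k * s" using assms by (simp add: field_simps)
  then show ?thesis using finite_entropy_downward[OF assms(3) _ pow] by simp
qed

lemma integrable_u_ln_u:
  fixes a b :: real
  assumes "finite_entropy s" "0 < s" "0 < a" "0 < b"
  shows "integrable lborel (\<lambda>y. u b y * ln (u a y))"
  using finite_entropy_everywhere[of s "a / 2"] integrable_u_ln_u_double[of a b] assms by simp

text \<open>The substitute for the majorant \<open>C * u c\<close> wherever a logarithm of
  \<open>u\<close> occurs.\<close>

lemma integrable_log_dominator:
  fixes a b :: real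
  assumes "finite_entropy s" "0 < s" "0 < a" "0 < b"
  shows "integrable lborel (\<lambda>y. C * u b y * (L + \<bar>ln (u a y)\<bar>))"
proof -
  have "integrable lborel (\<lambda>y. \<bar>u b y * ln (u a y)\<bar>)"
    using integrable_u_ln_u[OF assms] by (rule integrable_abs)
  then have "integrable lborel (\<lambda>y. (C * L) * u b y + C * \<bar>u b y * ln (u a y)\<bar>)"
    using integrable_u[of b] assms by auto
  moreover have "(C * L) * u b y + C * \<bar>u b y * ln (u a y)\<bar> = C * u b y * (L + \<bar>ln (u a y)\<bar>)" for y
    by (simp add: abs_mult u_nonneg algebra_simps)
  ultimately show ?thesis by simp
qed

text \<open>From above \<open>u\<close> is bounded by a constant; from below it is compared with
  \<open>u (t / 2)\<close>, by monotonicity in time or by the Harnack inequality. Thus one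
  logarithm, at time \<open>t / 2\<close>, serves a whole neighbourhood in time and in
  space.\<close>

lemma abs_ln_u_le:
  assumes t: "0 < t"
  obtains L where "0 \<le> L" "\<And>s y. t / 2 \<le> s \<Longrightarrow> s \<le> 2 * t \<Longrightarrow> \<bar>ln (u s y)\<bar> \<le> L + \<bar>ln (u (t / 2) y)\<bar>"
    "\<And>y s. \<bar>s\<bar> < 1 \<Longrightarrow> \<bar>ln (u t (y + s *\<^sub>R axis i 1))\<bar> \<le> L + \<bar>ln (u (t / 2) y)\<bar>"
proof -
  define K where "K = 1 / (2 * pi * (t / 2)) powr (real CARD('n) / 2)"
  \<comment> \<open>The base 4 bounds \<open>s / (t / 2)\<close> for
    \<open>s \<le> 2 * t\<close>.\<close>
  define \<kappa> where "\<kappa> = 4 powr (real CARD('n) / 2)"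
  have K: "0 < K" using t by (simp add: K_def)
  have up: "ln (u s y) \<le> \<bar>ln K\<bar>" if s: "t / 2 \<le> s" for s y
  proof -
    have s0: "0 < s" using that t by linarith
    have "u s y \<le> 1 / (2 * pi * s) powr (real CARD('n) / 2)" by (rule u_le[OF s0])
    also have "\<dots> \<le> K" unfolding K_def using that t by (intro divide_left_mono powr_mono2) auto
    finally have "ln (u s y) \<le> ln K" using u_pos[OF s0, of y] K by simp
    then show ?thesis by linarith
  qed
  have t2: "0 < t / 2" using t by simp
  have low: "ln (u (t / 2) y) - ln \<kappa> \<le> ln (u s y)" if s: "t / 2 \<le> s" "s \<le> 2 * t" for s y
  proof -
    have s0: "0 < s" using that t by linarith
    have "u (t / 2) y \<le> (s / (t / 2)) powr (real CARD('n) / 2) * u s y"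
      by (rule u_mono_scaled[OF t2 s(1)])
    also have "\<dots> \<le> \<kappa> * u s y"
      unfolding \<kappa>_def using s t s0 by (intro mult_right_mono powr_mono2 u_nonneg) (auto simp: field_simps)
    finally have "ln (u (t / 2) y) \<le> ln (\<kappa> * u s y)"
      using u_pos[OF s0, of y] u_pos[OF t2, of y] by (subst ln_le_cancel_iff) (auto simp: \<kappa>_def)
    then show ?thesis using u_pos[OF s0, of y] by (simp add: ln_mult \<kappa>_def)
  qed
  define E where "E = 2 powr (real CARD('n) / 2)"
  have shift: "ln (u (t / 2) y) - 1 / t - ln E \<le> ln (u t (y + s *\<^sub>R axis i 1))" if s: "\<bar>s\<bar> < 1" for s y
  proof -
    have "exp (- (s\<^sup>2 / t)) * u (t / 2) y \<le> E * u t (y + s *\<^sub>R axis i 1)"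
      using u_harnack[OF t, of "y + s *\<^sub>R axis i 1" y] by (simp add: E_def norm_axis_1)
    then have "ln (exp (- (s\<^sup>2 / t)) * u (t / 2) y) \<le> ln (E * u t (y + s *\<^sub>R axis i 1))"
      using u_pos[OF t, of "y + s *\<^sub>R axis i 1"] u_pos[OF t2, of y] by (subst ln_le_cancel_iff) (auto simp: E_def)
    then have "- (s\<^sup>2 / t) + ln (u (t / 2) y) \<le> ln E + ln (u t (y + s *\<^sub>R axis i 1))"
      using u_pos[OF t, of "y + s *\<^sub>R axis i 1"] u_pos[OF t2, of y] by (simp add: ln_mult E_def)
    moreover have "s\<^sup>2 \<le> 1" using s by (simp add: abs_square_le_1 less_imp_le)
    then have "s\<^sup>2 / t \<le> 1 / t" using t by (intro divide_right_mono) auto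
    ultimately show ?thesis by linarith
  qed
  show ?thesis
  proof (rule that[of "\<bar>ln K\<bar> + \<bar>ln \<kappa>\<bar> + 1 / t + \<bar>ln E\<bar>"])
    show "0 \<le> \<bar>ln K\<bar> + \<bar>ln \<kappa>\<bar> + 1 / t + \<bar>ln E\<bar>" using t by simp
    have t1: "0 \<le> 1 / t" using t by simp
    show "\<bar>ln (u s y)\<bar> \<le> \<bar>ln K\<bar> + \<bar>ln \<kappa>\<bar> + 1 / t + \<bar>ln E\<bar> + \<bar>ln (u (t / 2) y)\<bar>"
      if "t / 2 \<le> s" "s \<le> 2 * t" for s y
      using up[OF that(1), of y] low[OF that, of y] t1 by linarith
    show "\<bar>ln (u t (y + s *\<^sub>R axis i 1))\<bar> \<le> \<bar>ln K\<bar> + \<bar>ln \<kappa>\<bar> + 1 / t + \<bar>ln E\<bar> + \<bar>ln (u (t / 2) y)\<bar>"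
      if "\<bar>s\<bar> < 1" for y s
      using up[of t "y + s *\<^sub>R axis i 1"] shift[OF that, of y] t1 t by linarith
  qed
qed

section \<open>Integration by parts against the logarithm\<close>

lemma D_eq: "0 < t \<Longrightarrow> D \<alpha> t y = u t y * q \<alpha> t y"
  using u_pos[of t y] by (simp add: q_def)

text \<open>The partial derivative of \<open>D {#i#} * (ln u + 1)\<close> is
  \<open>D {#i, i#} * (ln u + 1) + u * v i * v i\<close>, and its integral vanishes. As
  \<open>ln u\<close> need not be moderate, \<open>expectation_divergence\<close> is replaced by the
  translation argument with a logarithmic majorant.\<close>

lemma integral_D2_ln_u:
  assumes fin: "finite_entropy s0" "0 < s0" and t: "0 < t"
  shows "(\<integral>y. D {#i, i#} t y * (ln (u t y) + 1) \<partial>lborel) = - (\<integral>y. u t y * (v i t y * v i t y) \<partial>lborel)"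
    and "integrable lborel (\<lambda>y. D {#i, i#} t y * (ln (u t y) + 1))"
proof -
  obtain L where L: "0 \<le> L" "\<And>s y. t / 2 \<le> s \<Longrightarrow> s \<le> 2 * t \<Longrightarrow> \<bar>ln (u s y)\<bar> \<le> L + \<bar>ln (u (t / 2) y)\<bar>"
    "\<And>y s. \<bar>s\<bar> < 1 \<Longrightarrow> \<bar>ln (u t (y + s *\<^sub>R axis i 1))\<bar> \<le> L + \<bar>ln (u (t / 2) y)\<bar>"
    by (rule abs_ln_u_le[OF t]) blast
  have Dint: "integrable lborel (\<lambda>y. D \<alpha> t y * (ln (u t y) + 1))" for \<alpha>
  proof -
    obtain C c where C: "0 \<le> C" "0 < c" "\<And>s y. t \<le> s \<Longrightarrow> s \<le> t \<Longrightarrow> u s y * \<bar>q \<alpha> s y\<bar> ^ 1 \<le> C * u c y"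
      by (rule moderateE[OF moderate_q t order_refl]) blast
    show ?thesis
    proof (rule Bochner_Integration.integrable_bound[OF integrable_log_dominator[OF fin t C(2), of C 1]])
      show "AE y in lborel. norm (D \<alpha> t y * (ln (u t y) + 1)) \<le> norm (C * u c y * (1 + \<bar>ln (u t y)\<bar>))"
      proof (intro AE_I2)
        fix y
        have "\<bar>D \<alpha> t y\<bar> \<le> C * u c y" using C(3)[of t y] unfolding D_eq[OF t, of \<alpha>] by (simp add: abs_mult u_nonneg)
        then have "\<bar>D \<alpha> t y\<bar> * \<bar>ln (u t y) + 1\<bar> \<le> (C * u c y) * (1 + \<bar>ln (u t y)\<bar>)"
          by (intro mult_mono) auto
        then show "norm (D \<alpha> t y * (ln (u t y) + 1)) \<le> norm (C * u c y * (1 + \<bar>ln (u t y)\<bar>))"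
          unfolding real_norm_def abs_mult[of "D \<alpha> t y"] by linarith
      qed
    qed measurable
  qed
  show "integrable lborel (\<lambda>y. D {#i, i#} t y * (ln (u t y) + 1))" by (rule Dint)
  \<comment> \<open>One moderate function controls both terms of the derivative, after the second is
    enlarged by the factor 1 + |ln u| \<ge> 1.\<close>
  obtain C1 c1 where C1: "0 \<le> C1" "0 < c1" "\<And>s y. t \<le> s \<Longrightarrow> s \<le> t \<Longrightarrow> u s y * \<bar>\<bar>q {#i, i#} s y\<bar> + v i s y * v i s y\<bar> ^ 1 \<le> C1 * u c1 y"
  proof -
    have "moderate (\<lambda>t y. \<bar>q {#i, i#} t y\<bar> + v i t y * v i t y)"
      by (intro moderate_tensors moderate_abs)
    then show ?thesis using that by (rule moderateE[OF _ t order_refl]) blast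
  qed
  define C2 where "C2 = exp (1 / (2 * c1)) * 2 powr (real CARD('n) / 2)"
  have "(\<integral>y. D {#i, i#} t y * (ln (u t y) + 1) + u t y * (v i t y * v i t y) \<partial>lborel) = 0"
  proof (rule integral_partial_derivative_eq_0[where F="\<lambda>y. D {#i#} t y * (ln (u t y) + 1)" and i=i
        and g="\<lambda>y. (C1 * C2) * u (2 * c1) y * ((L + 1) + \<bar>ln (u (t / 2) y)\<bar>)"])
    show "integrable lborel (\<lambda>y. D {#i#} t y * (ln (u t y) + 1))" by (rule Dint)
    show "integrable lborel (\<lambda>y. (C1 * C2) * u (2 * c1) y * ((L + 1) + \<bar>ln (u (t / 2) y)\<bar>))"
      using C1 t by (intro integrable_log_dominator[OF fin]) auto
    fix y :: "real ^ 'n" and s :: real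
    define y' where "y' = y + s *\<^sub>R axis i 1"
    have u: "0 < u t y'" by (rule u_pos[OF t])
    have d1: "((\<lambda>s. u t (y + s *\<^sub>R axis i 1)) has_real_derivative D {#i#} t y') (at s)"
      unfolding y'_def by (rule has_derivative_D_space[OF t])
    have d2: "((\<lambda>s. D {#i#} t (y + s *\<^sub>R axis i 1)) has_real_derivative D {#i, i#} t y') (at s)"
      unfolding y'_def by (rule has_derivative_D_space[OF t])
    have "((\<lambda>s. ln (u t (y + s *\<^sub>R axis i 1))) has_real_derivative inverse (u t y') * D {#i#} t y') (at s)"
      by (rule DERIV_chain2[OF _ d1]) (use DERIV_ln[OF u] in \<open>simp only: y'_def\<close>)
    from DERIV_add[OF this DERIV_const[of 1]]
    have d3: "((\<lambda>s. ln (u t (y + s *\<^sub>R axis i 1)) + 1) has_real_derivative inverse (u t y') * D {#i#} t y') (at s)"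
      by simp
    have "((\<lambda>s. D {#i#} t (y + s *\<^sub>R axis i 1) * (ln (u t (y + s *\<^sub>R axis i 1)) + 1)) has_real_derivative
      D {#i, i#} t y' * (ln (u t y') + 1) + inverse (u t y') * D {#i#} t y' * D {#i#} t y') (at s)"
      using DERIV_mult[OF d2 d3] by (simp only: y'_def)
    also have "inverse (u t y') * D {#i#} t y' * D {#i#} t y' = u t y' * (v i t y' * v i t y')"
      using u by (simp add: v_def D_eq[OF t, of "{#i#}"])
    finally show "((\<lambda>s. D {#i#} t (y + s *\<^sub>R axis i 1) * (ln (u t (y + s *\<^sub>R axis i 1)) + 1)) has_real_derivative
      D {#i, i#} t (y + s *\<^sub>R axis i 1) * (ln (u t (y + s *\<^sub>R axis i 1)) + 1) + u t (y + s *\<^sub>R axis i 1) *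
       (v i t (y + s *\<^sub>R axis i 1) * v i t (y + s *\<^sub>R axis i 1))) (at s)"
      unfolding y'_def .
    assume s: "\<bar>s\<bar> < 1"
    define X where "X = u t y' * (\<bar>q {#i, i#} t y'\<bar> + v i t y' * v i t y')"
    have X: "0 \<le> X" unfolding X_def using u by simp
    have "\<bar>D {#i, i#} t y' * (ln (u t y') + 1) + u t y' * (v i t y' * v i t y')\<bar>
        \<le> \<bar>D {#i, i#} t y' * (ln (u t y') + 1)\<bar> + \<bar>u t y' * (v i t y' * v i t y')\<bar>"
      by (rule abs_triangle_ineq)
    also have "\<dots> = u t y' * \<bar>q {#i, i#} t y'\<bar> * \<bar>ln (u t y') + 1\<bar> + u t y' * (v i t y' * v i t y')"
      using u unfolding D_eq[OF t, of "{#i, i#}"] abs_mult by simp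
    also have "\<dots> \<le> u t y' * \<bar>q {#i, i#} t y'\<bar> * (1 + \<bar>ln (u t y')\<bar>) + u t y' * (v i t y' * v i t y') * (1 + \<bar>ln (u t y')\<bar>)"
    proof (intro add_mono mult_left_mono)
      show "u t y' * (v i t y' * v i t y') \<le> u t y' * (v i t y' * v i t y') * (1 + \<bar>ln (u t y')\<bar>)"
        using u by (simp add: distrib_left)
    qed (use u in auto)
    also have "\<dots> = X * (1 + \<bar>ln (u t y')\<bar>)" by (simp add: X_def algebra_simps)
    also have "\<dots> \<le> (C1 * (C2 * u (2 * c1) y)) * ((L + 1) + \<bar>ln (u (t / 2) y)\<bar>)"
    proof (rule mult_mono)
      have "X \<le> C1 * u c1 y'" using C1(3)[of t y'] by (simp add: X_def)
      also have "\<dots> \<le> C1 * (C2 * u (2 * c1) y)"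
        unfolding C2_def y'_def using C1 s by (intro mult_left_mono u_shift_le) auto
      finally show "X \<le> C1 * (C2 * u (2 * c1) y)" .
      then show "0 \<le> C1 * (C2 * u (2 * c1) y)" using X by linarith
    qed (use L(3)[OF s, of y] in \<open>auto simp: y'_def\<close>)
    finally show "\<bar>D {#i, i#} t (y + s *\<^sub>R axis i 1) * (ln (u t (y + s *\<^sub>R axis i 1)) + 1) + u t (y + s *\<^sub>R axis i 1) *
       (v i t (y + s *\<^sub>R axis i 1) * v i t (y + s *\<^sub>R axis i 1))\<bar> \<le> (C1 * C2) * u (2 * c1) y * ((L + 1) + \<bar>ln (u (t / 2) y)\<bar>)"
      by (simp add: y'_def mult.assoc)
  qed
  moreover have "integrable lborel (\<lambda>y. u t y * (v i t y * v i t y))"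
    by (intro integrable_moderate t moderate_tensors)
  ultimately show "(\<integral>y. D {#i, i#} t y * (ln (u t y) + 1) \<partial>lborel) = - (\<integral>y. u t y * (v i t y * v i t y) \<partial>lborel)"
    using Dint by simp
qed

text \<open>De Bruijn's identity. Differentiating x ln x produces the factor
  \<open>ln u + 1\<close>, the heat equation produces second derivatives of \<open>u\<close>, and
  integration by parts in each coordinate gives the Fisher information.\<close>

theorem has_derivative_entropy:
  assumes fin: "finite_entropy s0" "0 < s0" and t: "0 < t"
  shows "((\<lambda>t. - (\<integral>y. u t y * ln (u t y) \<partial>lborel)) has_real_derivative ev r t / 2) (at t)"
proof -
  obtain L where L: "0 \<le> L" "\<And>s y. t / 2 \<le> s \<Longrightarrow> s \<le> 2 * t \<Longrightarrow> \<bar>ln (u s y)\<bar> \<le> L + \<bar>ln (u (t / 2) y)\<bar>"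
    by (rule abs_ln_u_le[OF t]) blast
  define h where "h t y = (\<Sum>j\<in>UNIV. q {#j, j#} t y) / 2" for t y
  have h: "moderate h" unfolding h_def by (intro moderate_tensors)
  obtain C c where C: "0 \<le> C" "0 < c" "\<And>s y. t / 2 \<le> s \<Longrightarrow> s \<le> 2 * t \<Longrightarrow> u s y * \<bar>h s y\<bar> ^ 1 \<le> C * u c y"
    by (rule moderateE[OF h, of "t / 2" "2 * t" 1]) (use t in auto)
  have uh: "u s y * h s y = (\<Sum>j\<in>UNIV. D {#j, j#} s y) / 2" if "0 < s" for s y
    unfolding h_def D_eq[OF that, of "{#_, _#}"] by (simp add: sum_distrib_left)
  have "((\<lambda>t. \<integral>y. u t y * ln (u t y) \<partial>lborel) has_real_derivative
      (\<integral>y. (u t y * h t y) * (ln (u t y) + 1) \<partial>lborel)) (at t)"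
  proof (rule has_real_derivative_integral_dominated[where g="\<lambda>y. C * u c y * ((L + 1) + \<bar>ln (u (t / 2) y)\<bar>)" and d="t / 2"
        and f'="\<lambda>s y. (u s y * h s y) * (ln (u s y) + 1)"])
    fix s y assume "\<bar>s - t\<bar> < t / 2"
    then have s: "t / 2 \<le> s" "s \<le> 2 * t" unfolding abs_less_iff by linarith+
    then have s0: "0 < s" using t by linarith
    show "integrable lborel (\<lambda>y. u s y * ln (u s y))"
      by (rule integrable_u_ln_u[OF fin s0 s0])
    have u: "0 < u s y" by (rule u_pos[OF s0])
    have d1: "((\<lambda>s. u s y) has_real_derivative u s y * h s y) (at s)"
      unfolding uh[OF s0] by (rule has_derivative_D_time[OF s0])
    show "((\<lambda>s. u s y * ln (u s y)) has_real_derivative (u s y * h s y) * (ln (u s y) + 1)) (at s)"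
    proof -
      define d where "d = u s y * h s y"
      have "((\<lambda>s. ln (u s y)) has_real_derivative inverse (u s y) * d) (at s)"
        unfolding d_def by (rule DERIV_chain2[OF DERIV_ln d1]) (rule u)
      note DERIV_mult[OF d1[folded d_def] this]
      also have "inverse (u s y) * d * u s y = d" using u by simp
      finally show ?thesis unfolding d_def[symmetric] by (simp only: distrib_left mult_1_right)
    qed
    have "\<bar>u s y * h s y\<bar> * \<bar>ln (u s y) + 1\<bar> \<le> (C * u c y) * ((L + 1) + \<bar>ln (u (t / 2) y)\<bar>)"
    proof (rule mult_mono)
      show "\<bar>u s y * h s y\<bar> \<le> C * u c y" using C(3)[OF s, of y] by (simp add: abs_mult u_nonneg)
      then show "0 \<le> C * u c y" by linarith
      show "\<bar>ln (u s y) + 1\<bar> \<le> (L + 1) + \<bar>ln (u (t / 2) y)\<bar>" using L(2)[OF s, of y] by linarith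
    qed simp
    then show "\<bar>(u s y * h s y) * (ln (u s y) + 1)\<bar> \<le> C * u c y * ((L + 1) + \<bar>ln (u (t / 2) y)\<bar>)"
      by (simp only: abs_mult)
  next
    show "integrable lborel (\<lambda>y. C * u c y * ((L + 1) + \<bar>ln (u (t / 2) y)\<bar>))"
      using C t by (intro integrable_log_dominator[OF fin]) simp_all
  qed (use t in simp)
  also have "(\<integral>y. (u t y * h t y) * (ln (u t y) + 1) \<partial>lborel)
     = (\<Sum>j\<in>UNIV. \<integral>y. D {#j, j#} t y * (ln (u t y) + 1) \<partial>lborel) / 2"
  proof -
    have "(\<integral>y. (u t y * h t y) * (ln (u t y) + 1) \<partial>lborel)
      = (\<integral>y. (\<Sum>j\<in>UNIV. D {#j, j#} t y * (ln (u t y) + 1)) / 2 \<partial>lborel)"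
      by (simp only: uh[OF t] times_divide_eq_left sum_distrib_right)
    also have "\<dots> = (\<Sum>j\<in>UNIV. \<integral>y. D {#j, j#} t y * (ln (u t y) + 1) \<partial>lborel) / 2"
      by (simp only: integral_divide_zero Bochner_Integration.integral_sum[OF integral_D2_ln_u(2)[OF fin t]])
    finally show ?thesis .
  qed
  also have "\<dots> = - ev r t / 2"
  proof -
    have "ev r t = (\<Sum>i\<in>UNIV. ev (\<lambda>t y. v i t y * v i t y) t)"
      unfolding r_def[abs_def] using t by (intro ev_sum moderate_tensors) auto
    then show ?thesis by (simp only: integral_D2_ln_u(1)[OF fin t] ev_def sum_negf)
  qed
  finally show ?thesis using DERIV_minus[of "\<lambda>t. \<integral>y. u t y * ln (u t y) \<partial>lborel" "- ev r t / 2"] by simp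
qed

text \<open>\<open>H\<close> is prescribed only at positive times. Each derivative is therefore
  computed on the open half-line before it is identified with an iterate of
  \<open>deriv\<close>.\<close>

lemma third_derivative_entropy:
  assumes n: "CARD('n) \<le> 4" and t: "0 < t"
    and H: "\<And>s. 0 < s \<Longrightarrow> H s = - (\<integral>y. u s y * ln (u s y) \<partial>lborel)"
  shows "(\<forall>k<3. (deriv ^^ k) H differentiable at t) \<and> (deriv ^^ 3) H t \<ge> 0"
proof -
  have "\<exists>H1 H2 H3. (\<forall>s>0. (H has_real_derivative H1 s) (at s)) \<and> (\<forall>s>0. (H1 has_real_derivative H2 s) (at s))
     \<and> (\<forall>s>0. (H2 has_real_derivative H3 s) (at s)) \<and> 0 \<le> H3 t"
  proof (cases "\<exists>s0>0. finite_entropy s0")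
    case True
    then obtain s0 where fin: "finite_entropy s0" "0 < s0" by blast
    show ?thesis
    proof (intro exI conjI allI impI)
      fix s :: real assume s: "0 < s"
      show "(H has_real_derivative ev r s / 2) (at s)"
        by (rule has_field_derivative_transform_within_open[OF has_derivative_entropy[OF fin s], of "{0<..}"])
          (use s H in auto)
      show "((\<lambda>s. ev r s / 2) has_real_derivative - ev AA s / 2) (at s)"
        by (rule DERIV_cdivide[OF has_derivative_ev_r[OF s]])
      show "((\<lambda>s. - ev AA s / 2) has_real_derivative (ev BB s - 2 * ev AAA s) / 2) (at s)"
        using DERIV_cdivide[OF DERIV_minus[OF has_derivative_ev_AA[OF s]], of 2] by simp
    next
      show "0 \<le> (ev BB t - 2 * ev AAA t) / 2"
        using third_derivative_expectation_nonneg[OF n t] by simp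
    qed
  next
    \<comment> \<open>No positive time gives an integrable integrand, so the Bochner integral takes
      its default value 0 throughout and all derivatives vanish.\<close>
    case False
    then have "H s = 0" if "0 < s" for s
      using H[OF that] that unfolding finite_entropy_def by (simp add: not_integrable_integral_eq)
    then have "(H has_real_derivative 0) (at s)" if "0 < s" for s
      using that by (intro has_field_derivative_transform_within_open[OF DERIV_const[of 0], of "{0<..}"]) auto
    then show ?thesis by (intro exI[of _ "\<lambda>_. 0"]) auto
  qed
  then obtain H1 H2 H3 where d1: "\<And>s. 0 < s \<Longrightarrow> (H has_real_derivative H1 s) (at s)"
    and d2: "\<And>s. 0 < s \<Longrightarrow> (H1 has_real_derivative H2 s) (at s)"
    and d3: "\<And>s. 0 < s \<Longrightarrow> (H2 has_real_derivative H3 s) (at s)" and nonneg: "0 \<le> H3 t" by blast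
  have D1: "deriv H s = H1 s" if "0 < s" for s by (rule DERIV_imp_deriv[OF d1[OF that]])
  have e2: "(deriv H has_real_derivative H2 s) (at s)" if "0 < s" for s
    by (rule has_field_derivative_transform_within_open[OF d2[OF that], of "{0<..}"])
      (use that in \<open>auto simp: D1\<close>)
  have D2: "deriv (deriv H) s = H2 s" if "0 < s" for s by (rule DERIV_imp_deriv[OF e2[OF that]])
  have e3: "(deriv (deriv H) has_real_derivative H3 s) (at s)" if "0 < s" for s
    by (rule has_field_derivative_transform_within_open[OF d3[OF that], of "{0<..}"])
      (use that in \<open>auto simp: D2\<close>)
  have "(deriv ^^ k) H differentiable at t" if "k < 3" for k
  proof -
    have "k = 0 \<or> k = 1 \<or> k = 2" using that by auto
    then show ?thesis
      using d1[OF t] e2[OF t] e3[OF t] by (auto simp: real_differentiable_def numeral_2_eq_2)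
  qed
  moreover have "(deriv ^^ 3) H t = H3 t"
    using DERIV_imp_deriv[OF e3[OF t]] by (simp add: numeral_3_eq_3)
  ultimately show ?thesis using nonneg by simp
qed

end

text \<open>\<open>deriv\<close> is a total operator, so the sign of \<open>(deriv ^^ 3) H t\<close>
  is meaningful only together with the existence of the derivatives; the first conjunct supplies
  it.\<close>

theorem mainTheorem1:
  fixes M :: "'a measure" and X :: "'a \<Rightarrow> real ^ 'n" and Z :: "real \<Rightarrow> 'a \<Rightarrow> real ^ 'n"
    and p :: "real ^ 'n \<Rightarrow> real" and t :: real
  assumes "prob_space M"
    and "CARD('n) \<in> {2, 3, 4}"
    and "\<And>x. 0 \<le> p x"
    and "distributed M lborel X (\<lambda>x. ennreal (p x))"
    and "\<And>s. 0 < s \<Longrightarrow> distributed M lborel (Z s) (\<lambda>z. ennreal (gaussian_density s z))"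
    and "\<And>s. 0 < s \<Longrightarrow> prob_space.indep_var M borel X borel (Z s)"
    and "0 < t"
  shows "let H = (\<lambda>s. differential_entropy M (\<lambda>\<omega>. X \<omega> + Z s \<omega>))
         in (\<forall>k<3. (deriv ^^ k) H differentiable at t) \<and> (deriv ^^ 3) H t \<ge> 0"
proof -
  interpret prob_space M by fact
  have meas [measurable]: "p \<in> borel_measurable borel"
    using distributed_real_measurable[OF _ assms(4)] assms(3) by simp
  \<comment> \<open>The law of \<open>X\<close>; its heat flow at time \<open>s\<close> has density
    \<open>smoothed_density p s\<close>, which connects the statement to the locale.\<close>
  define \<mu> where "\<mu> = density lborel (\<lambda>x. ennreal (p x))"
  have mu: "\<mu> = distr M lborel X" using assms(4) by (simp add: distributed_def \<mu>_def)
  interpret h: heat_flow \<mu>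
  proof (rule heat_flow.intro)
    have "X \<in> measurable M lborel" using distributed_measurable[OF assms(4)] .
    then show "prob_space \<mu>" unfolding mu by (rule prob_space_distr)
    show "heat_flow_axioms \<mu>" by unfold_locales (simp add: \<mu>_def)
  qed
  have u: "smoothed_density p s y = h.u s y" for s y
    unfolding smoothed_density_altdef h.u_altdef unfolding \<mu>_def
    by (subst integral_real_density) (use assms(3) in auto)
  have "CARD('n) \<le> 4" using assms(2) by auto
  moreover have "differential_entropy M (\<lambda>\<omega>. X \<omega> + Z s \<omega>) = - (\<integral>y. h.u s y * ln (h.u s y) \<partial>lborel)" if "0 < s" for s
    using differential_entropy_smoothed[OF assms(4,3) assms(5,6)[OF that] that] by (simp add: u)
  ultimately show ?thesis
    unfolding Let_def by (intro h.third_derivative_entropy assms(7))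
qed

end
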